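(* Let $V$ be a finite-dimensional vector space over a field $\mathbb{K}$ and $m\in\mathbb{Z}^+$. Let $J_m(V)$ be the bilateral ideal of the algebra $\mathbb{K}\otimes_{\mathbb{Z}}\mathrm{Skew}[V|\underline{m}]$ generated by the elements $(v|i)-\lambda(v_1|i)-\mu(v_2|i)$ for all $v=\lambda v_1+\mu v_2$ in $V$ ($v_1,v_2\in V$, $\lambda,\mu\in\mathbb{K}$) and all $1\le i\le m$. Then: (1) sending $(v|i)$ to $1\otimes\cdots\otimes1\otimes v\otimes1\otimes\cdots\otimes1$ ($v$ in the $i$-th factor) induces an algebra isomorphism $$\Phi_V:\frac{\mathbb{K}\otimes\mathrm{Skew}[V|\underline{m}]}{J_m(V)}\longrightarrow\Lambda(V)^{\otimes m};$$ (2) the place polarizations and their divided powers leave $J_m(V)$ invariant, and the geometric products on $\Lambda(V)^{\otimes m}$ correspond via $\Phi_V$ to the divided powers of place polarizations induced on the quotient: for all $i\neq j$ in $\{1,\dots,m\}$ and $h\in\mathbb{Z}^+$, $$\diamond_{ji}^{(h)}=\Phi_V\circ D_{ji}^{(h)}\circ\Phi_V^{-1};$$ (3) the mapping sending each $m\times m$ elementary matrix with $1$ in the $(i,j)$-th entry (and $0$ elsewhere) to the simple geometric product $\diamond_{ij}$ induces a Lie representation of the general linear Lie algebra $gl(m,\mathbb{K})$ in the Lie algebra of derivations of $\Lambda(V)^{\otimes m}$.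
   Context: $\Lambda(V)$ is the exterior algebra of $V$, and $\Lambda(V)^{\otimes m}$ its $m$-th tensor power in the category of $\mathbb{Z}_2$-graded $\mathbb{K}$-algebras (e.g. for $m=2$, $(A_1\otimes A_2)(B_1\otimes B_2)=(-1)^{a_2b_1}A_1B_1\otimes A_2B_2$ for homogeneous elements of degrees $a_i,b_i$). "Derivation" means ordinary (unsigned) derivation. Letterplace algebra: $\underline{m}=\{1,\dots,m\}$; regarding the underlying set of $V$ as a set of letters, $\mathrm{Skew}[V|\underline{m}]$ is the free associative skew-symmetric unital $\mathbb{Z}$-algebra generated by the symbols $(v|i)$, $v\in V$, $i\in\underline{m}$, i.e. the exterior algebra of the free $\mathbb{Z}$-module on these symbols (generators anticommute and square to zero). For $i,j\in\underline{m}$, the place polarization $D_{ji}$ is the unique derivation with $D_{ji}(v|k)=\delta_{ik}(v|j)$ for all $v\in V$, $k\in\underline{m}$. For $i\ne j$ and $h\in\mathbb{Z}^+$, the divided power $D_{ji}^{(h)}=D_{ji}^{\,h}/h!$ is well defined on $\mathrm{Skew}[V|\underline{m}]$. All these operators are extended $\mathbb{K}$-linearly to $\mathbb{K}\otimes\mathrm{Skew}[V|\underline{m}]$. Coproduct slices: an extensor of step $a$ is an element $A=v_1\cdots v_a$ of $\Lambda(V)$ that is a product of $a$ vectors; for $r+s=a$, $r,s\geq 0$, $\sum_{(A)_{(r,s)}}A_{(1)}\otimes A_{(2)}=\sum_I\operatorname{sgn}(I,J)\,v_I\otimes v_J$, where $I$ runs over the $r$-subsets of $\{1,\dots,a\}$,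 $J$ is its complement, $v_I,v_J$ are the products in increasing order of index, and $\operatorname{sgn}(I,J)$ is the sign of the permutation listing $I$ increasingly then $J$ increasingly; the slice is $0$ if $r<0$ or $s<0$. Geometric products on $\Lambda(V)^{\otimes m}$: let $A_1,\dots,A_m$ be extensors of steps $a_1,\dots,a_m$ and let $i<j$. Then $$\diamond^{(h)}_{ji}(A_1\otimes\cdots\otimes A_m)=(-1)^{h(a_{i+1}+\cdots+a_{j-1})}\sum_{(A_i)_{(a_i-h,h)}}A_1\otimes\cdots\otimes (A_i)_{(1)}\otimes\cdots\otimes(A_i)_{(2)}A_j\otimes\cdots\otimes A_m,$$ $$\diamond^{(h)}_{ij}(A_1\otimes\cdots\otimes A_m)=(-1)^{h(a_{i+1}+\cdots+a_{j-1})}\sum_{(A_j)_{(h,a_j-h)}}A_1\otimes\cdots\otimes A_i(A_j)_{(1)}\otimes\cdots\otimes(A_j)_{(2)}\otimes\cdots\otimes A_m,$$ where the displayed modified factors are in positions $i$ and $j$; these are extended linearly. The simple geometric products are $\diamond_{ij}=\diamond_{ij}^{(1)}$ for $i\ne j$, and $\diamond_{ii}$ is the operator on $\Lambda(V)^{\otimes m}$ corresponding under $\Phi_V$ to the operator induced by $D_{ii}$. *)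

theory Defs
  imports
    "HOL-Analysis.Cartesian_Space"
    "HOL-Library.Poly_Mapping"
    "HOL-Combinatorics.Permutations"
    "HOL-Algebra.QuotRing"
    "HOL-Algebra.Module"
begin

text \<open>
  Conventions. The field is a type \<open>'k\<close> of class \<open>field\<close>, and the vector space \<open>V\<close> is a type \<open>'v\<close>
  with a scalar multiplication \<open>sc\<close>. The set of places \<open>{1, \<dots>, m}\<close> is a finite linearly
  ordered type \<open>'m\<close>, so that \<open>m = CARD('m) \<ge> 1\<close>. Algebras over \<open>'k\<close> are records of type
  \<open>('k, 'a) module\<close>, which carry a (not necessarily commutative) product as well as a scalar
  multiplication; quotients consist of cosets. Operators on an algebra are functions that are
  \<open>undefined\<close> outside its carrier (\<open>extensional\<close>), so that they can be compared by equality.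
\<close>

section \<open>Algebras, linear maps, derivations\<close>

definition klinear :: "('k, 'a) module \<Rightarrow> ('k, 'b) module \<Rightarrow> ('a \<Rightarrow> 'b) \<Rightarrow> bool" where
  "klinear A B f \<longleftrightarrow> f \<in> carrier A \<rightarrow> carrier B \<and>
     (\<forall>x\<in>carrier A. \<forall>y\<in>carrier A. f (x \<oplus>\<^bsub>A\<^esub> y) = f x \<oplus>\<^bsub>B\<^esub> f y) \<and>
     (\<forall>c. \<forall>x\<in>carrier A. f (c \<odot>\<^bsub>A\<^esub> x) = c \<odot>\<^bsub>B\<^esub> f x)"

definition alg_hom :: "('k, 'a) module \<Rightarrow> ('k, 'b) module \<Rightarrow> ('a \<Rightarrow> 'b) set" where
  "alg_hom A B = {f \<in> ring_hom A B. klinear A B f}"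

definition alg_iso :: "('k, 'a) module \<Rightarrow> ('k, 'b) module \<Rightarrow> ('a \<Rightarrow> 'b) set" where
  "alg_iso A B = {f \<in> ring_iso A B. klinear A B f}"

definition additive_endo :: "('a, 'z) ring_scheme \<Rightarrow> ('a \<Rightarrow> 'a) \<Rightarrow> bool" where
  "additive_endo R d \<longleftrightarrow> d \<in> extensional (carrier R) \<and> d \<in> carrier R \<rightarrow> carrier R \<and>
     (\<forall>x\<in>carrier R. \<forall>y\<in>carrier R. d (x \<oplus>\<^bsub>R\<^esub> y) = d x \<oplus>\<^bsub>R\<^esub> d y)"

definition derivation :: "('a, 'z) ring_scheme \<Rightarrow> ('a \<Rightarrow> 'a) \<Rightarrow> bool" where
  "derivation R d \<longleftrightarrow> additive_endo R d \<and>
     (\<forall>x\<in>carrier R. \<forall>y\<in>carrier R. d (x \<otimes>\<^bsub>R\<^esub> y) = (d x \<otimes>\<^bsub>R\<^esub> y) \<oplus>\<^bsub>R\<^esub> (x \<otimes>\<^bsub>R\<^esub> d y))"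

definition alg_derivations :: "('k, 'a) module \<Rightarrow> ('a \<Rightarrow> 'a) set" where
  "alg_derivations A = {d. derivation A d \<and> klinear A A d}"

definition quot_alg :: "('k, 'a) module \<Rightarrow> 'a set \<Rightarrow> ('k, 'a set) module" where
  "quot_alg A I =
    \<lparr>carrier = carrier (A Quot I), mult = mult (A Quot I), one = one (A Quot I),
     zero = zero (A Quot I), add = add (A Quot I),
     smult = (\<lambda>c X. \<Union>x\<in>X. I +>\<^bsub>A\<^esub> (c \<odot>\<^bsub>A\<^esub> x))\<rparr>"

definition induced :: "('k, 'a) module \<Rightarrow> 'a set \<Rightarrow> ('a \<Rightarrow> 'a) \<Rightarrow> 'a set \<Rightarrow> 'a set" where
  "induced A I D = (\<lambda>X\<in>carrier (quot_alg A I). \<Union>x\<in>X. I +>\<^bsub>A\<^esub> D x)"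

definition transport ::
  "('k, 'a) module \<Rightarrow> ('k, 'b) module \<Rightarrow> ('a \<Rightarrow> 'b) \<Rightarrow> ('a \<Rightarrow> 'a) \<Rightarrow> 'b \<Rightarrow> 'b" where
  "transport A B \<Phi> D = (\<lambda>t\<in>carrier B. \<Phi> (D (inv_into (carrier A) \<Phi> t)))"

text \<open>The monoid algebra \<open>K[M]\<close>; it only uses the multiplicative structure of \<open>M\<close>.\<close>

definition monoid_algebra :: "('a, 'z) monoid_scheme \<Rightarrow> ('k::comm_ring_1, 'a \<Rightarrow>\<^sub>0 'k) module" where
  "monoid_algebra M =
    \<lparr>carrier = {f. Poly_Mapping.keys f \<subseteq> carrier M},
     mult = (\<lambda>f g. \<Sum>x\<in>Poly_Mapping.keys f. \<Sum>y\<in>Poly_Mapping.keys g.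
        Poly_Mapping.single (x \<otimes>\<^bsub>M\<^esub> y) (Poly_Mapping.lookup f x * Poly_Mapping.lookup g y)),
     one = Poly_Mapping.single \<one>\<^bsub>M\<^esub> 1,
     zero = 0,
     add = (+),
     smult = (\<lambda>c. Poly_Mapping.map ((*) c))\<rparr>"

definition word_monoid :: "'x list monoid" where
  "word_monoid = \<lparr>carrier = UNIV, mult = (@), one = []\<rparr>"

definition free_algebra :: "('k::comm_ring_1, 'x list \<Rightarrow>\<^sub>0 'k) module" where
  "free_algebra = monoid_algebra word_monoid"

definition gen :: "'x \<Rightarrow> ('x list \<Rightarrow>\<^sub>0 'k::comm_ring_1)" where
  "gen x = Poly_Mapping.single [x] 1"

section \<open>The exterior algebra of a vector space\<close>

text \<open>The tensor algebra of \<open>V\<close> (words in the letters \<open>v \<in> V\<close> modulo linearity) modulo \<open>v v = 0\<close>.\<close>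

type_synonym ('v, 'k) ext = "('v list \<Rightarrow>\<^sub>0 'k) set"

definition ext_relations :: "('k::field \<Rightarrow> 'v::ab_group_add \<Rightarrow> 'v) \<Rightarrow> ('v list \<Rightarrow>\<^sub>0 'k) set" where
  "ext_relations sc =
     {gen (sc a u + sc b v) \<ominus>\<^bsub>free_algebra\<^esub> (a \<odot>\<^bsub>free_algebra\<^esub> gen u)
        \<ominus>\<^bsub>free_algebra\<^esub> (b \<odot>\<^bsub>free_algebra\<^esub> gen v) | a b u v. True}
     \<union> {gen v \<otimes>\<^bsub>free_algebra\<^esub> gen v | v. True}"

definition ext_ideal :: "('k::field \<Rightarrow> 'v::ab_group_add \<Rightarrow> 'v) \<Rightarrow> ('v list \<Rightarrow>\<^sub>0 'k) set" where
  "ext_ideal sc = Idl\<^bsub>free_algebra\<^esub> (ext_relations sc)"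

definition exterior :: "('k::field \<Rightarrow> 'v::ab_group_add \<Rightarrow> 'v) \<Rightarrow> ('k, ('v, 'k) ext) module" where
  "exterior sc = quot_alg free_algebra (ext_ideal sc)"

definition ext_vec :: "('k::field \<Rightarrow> 'v::ab_group_add \<Rightarrow> 'v) \<Rightarrow> 'v \<Rightarrow> ('v, 'k) ext" where
  "ext_vec sc v = ext_ideal sc +>\<^bsub>free_algebra\<^esub> gen v"

text \<open>The extensor \<open>v\<^sub>1 \<cdots> v\<^sub>a\<close>, of step \<open>a\<close>, given by the list of its factors.\<close>

definition extensor :: "('k::field \<Rightarrow> 'v::ab_group_add \<Rightarrow> 'v) \<Rightarrow> 'v list \<Rightarrow> ('v, 'k) ext" where
  "extensor sc w =
     foldr (\<lambda>v A. ext_vec sc v \<otimes>\<^bsub>exterior sc\<^esub> A) w \<one>\<^bsub>exterior sc\<^esub>"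

definition ext_component :: "('k::field \<Rightarrow> 'v::ab_group_add \<Rightarrow> 'v) \<Rightarrow> nat \<Rightarrow> ('v, 'k) ext set" where
  "ext_component sc a =
     {ext_ideal sc +>\<^bsub>free_algebra\<^esub> f | f. \<forall>w\<in>Poly_Mapping.keys f. length w = a}"

section \<open>Graded tensor powers\<close>

definition tuple_monoid :: "('k, 'a) module \<Rightarrow> ('m \<Rightarrow> 'a) monoid" where
  "tuple_monoid L =
    \<lparr>carrier = {A. \<forall>k. A k \<in> carrier L}, mult = (\<lambda>A B k. A k \<otimes>\<^bsub>L\<^esub> B k), one = (\<lambda>k. \<one>\<^bsub>L\<^esub>)\<rparr>"

definition multilinear_relations :: "('k::comm_ring_1, 'a) module \<Rightarrow> (('m \<Rightarrow> 'a) \<Rightarrow>\<^sub>0 'k) set" where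
  "multilinear_relations L =
     {Poly_Mapping.single (A(k := x \<oplus>\<^bsub>L\<^esub> y)) 1 - Poly_Mapping.single (A(k := x)) 1
        - Poly_Mapping.single (A(k := y)) 1
        | A k x y. A \<in> carrier (tuple_monoid L) \<and> x \<in> carrier L \<and> y \<in> carrier L}
     \<union> {Poly_Mapping.single (A(k := c \<odot>\<^bsub>L\<^esub> x)) 1 - Poly_Mapping.single (A(k := x)) c
        | A k c x. A \<in> carrier (tuple_monoid L) \<and> x \<in> carrier L}"

text \<open>
  The ordinary (ungraded) tensor power: formal combinations of tuples modulo multilinearity, with
  the componentwise product. The multilinear relations are stable under that product, so that the
  ideal they generate is their linear span, and the underlying vector space is the usual one.
\<close>

definition multilinear_ideal :: "('k::field, 'a) module \<Rightarrow> (('m \<Rightarrow> 'a) \<Rightarrow>\<^sub>0 'k) set" where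
  "multilinear_ideal L = Idl\<^bsub>monoid_algebra (tuple_monoid L)\<^esub> (multilinear_relations L)"

definition tensor_power :: "('k::field, 'a) module \<Rightarrow> ('k, (('m \<Rightarrow> 'a) \<Rightarrow>\<^sub>0 'k) set) module" where
  "tensor_power L = quot_alg (monoid_algebra (tuple_monoid L)) (multilinear_ideal L)"

definition pure_tensor :: "('k::field, 'a) module \<Rightarrow> ('m \<Rightarrow> 'a) \<Rightarrow> (('m \<Rightarrow> 'a) \<Rightarrow>\<^sub>0 'k) set" where
  "pure_tensor L A =
     multilinear_ideal L +>\<^bsub>monoid_algebra (tuple_monoid L)\<^esub> Poly_Mapping.single A 1"

text \<open>
  The product in the category of \<open>\<int>\<^sub>2\<close>-graded algebras: the bilinear operation with
  \<open>(A\<^sub>1 \<otimes> \<cdots> \<otimes> A\<^sub>m)(B\<^sub>1 \<otimes> \<cdots> \<otimes> B\<^sub>m) = (-1)\<^bsup>e\<^esup> A\<^sub>1B\<^sub>1 \<otimes> \<cdots> \<otimes> A\<^sub>mB\<^sub>m\<close>, where \<open>e\<close> is the sum of the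
  \<open>a\<^sub>k b\<^sub>l\<close> with \<open>l < k\<close>, for \<open>A\<^sub>k, B\<^sub>k\<close> homogeneous of degrees \<open>a\<^sub>k, b\<^sub>k\<close>. The argument \<open>H\<close> is the
  family of homogeneous components of \<open>L\<close>.
\<close>

definition graded_mult :: "('k::field, 'a) module \<Rightarrow> (nat \<Rightarrow> 'a set) \<Rightarrow>
    (('m::{finite,linorder} \<Rightarrow> 'a) \<Rightarrow>\<^sub>0 'k) set \<Rightarrow> (('m \<Rightarrow> 'a) \<Rightarrow>\<^sub>0 'k) set \<Rightarrow> (('m \<Rightarrow> 'a) \<Rightarrow>\<^sub>0 'k) set"
  where
  "graded_mult L H = (let T = tensor_power L in
     THE \<mu>. (\<forall>x y. x \<notin> carrier T \<or> y \<notin> carrier T \<longrightarrow> \<mu> x y = undefined) \<and>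
       (\<forall>x\<in>carrier T. klinear T T (\<mu> x)) \<and>
       (\<forall>y\<in>carrier T. klinear T T (\<lambda>x. \<mu> x y)) \<and>
       (\<forall>a b A B. (\<forall>k. A k \<in> H (a k) \<and> B k \<in> H (b k)) \<longrightarrow>
          \<mu> (pure_tensor L A) (pure_tensor L B) =
            (-1) ^ (\<Sum>k\<in>UNIV. \<Sum>l\<in>{..<k}. a k * b l) \<odot>\<^bsub>T\<^esub> pure_tensor L (\<lambda>k. A k \<otimes>\<^bsub>L\<^esub> B k)))"

type_synonym ('m, 'v, 'k) ext_power = "(('m \<Rightarrow> ('v, 'k) ext) \<Rightarrow>\<^sub>0 'k) set"

definition ext_power :: "('k::field \<Rightarrow> 'v::ab_group_add \<Rightarrow> 'v) \<Rightarrow>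
    ('k, ('m::{finite,linorder}, 'v, 'k) ext_power) module" where
  "ext_power sc =
     (tensor_power (exterior sc))\<lparr>mult := graded_mult (exterior sc) (ext_component sc)\<rparr>"

definition ext_tensor :: "('k::field \<Rightarrow> 'v::ab_group_add \<Rightarrow> 'v) \<Rightarrow>
    ('m::{finite,linorder} \<Rightarrow> ('v, 'k) ext) \<Rightarrow> ('m, 'v, 'k) ext_power" where
  "ext_tensor sc = pure_tensor (exterior sc)"

section \<open>The letterplace algebra\<close>

definition skew_relations :: "('x list \<Rightarrow>\<^sub>0 int) set" where
  "skew_relations =
     {gen x \<otimes>\<^bsub>free_algebra\<^esub> gen x | x. True}
     \<union> {(gen x \<otimes>\<^bsub>free_algebra\<^esub> gen y) \<oplus>\<^bsub>free_algebra\<^esub> (gen y \<otimes>\<^bsub>free_algebra\<^esub> gen x) | x y. True}"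

definition skew_ideal :: "('x list \<Rightarrow>\<^sub>0 int) set" where
  "skew_ideal = Idl\<^bsub>free_algebra\<^esub> skew_relations"

type_synonym ('v, 'm) skew = "(('v \<times> 'm) list \<Rightarrow>\<^sub>0 int) set"

definition Skew :: "('v, 'm) skew ring" where
  "Skew = free_algebra Quot skew_ideal"

definition lp :: "'v \<Rightarrow> 'm \<Rightarrow> ('v, 'm) skew" where
  "lp v i = skew_ideal +>\<^bsub>free_algebra\<^esub> gen (v, i)"

definition polarization :: "'m \<Rightarrow> 'm \<Rightarrow> ('v, 'm) skew \<Rightarrow> ('v, 'm) skew" where
  "polarization j i = (THE d. derivation Skew d \<and>
     (\<forall>v k. d (lp v k) = (if k = i then lp v j else \<zero>\<^bsub>Skew\<^esub>)))"

definition divided_power :: "('a, 'z) ring_scheme \<Rightarrow> ('a \<Rightarrow> 'a) \<Rightarrow> nat \<Rightarrow> 'a \<Rightarrow> 'a" where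
  "divided_power R d h = (THE e. additive_endo R e \<and>
     (\<forall>x\<in>carrier R. [(fact h :: nat)] \<cdot>\<^bsub>R\<^esub> e x = (d ^^ h) x))"

text \<open>
  \<open>K \<otimes>\<^sub>\<int> R\<close> for a ring \<open>R\<close>: formal \<open>K\<close>-combinations of the elements \<open>x\<close> of \<open>R\<close> (which stand for
  \<open>1 \<otimes> x\<close>) modulo additivity in \<open>x\<close>, with \<open>(c \<otimes> x)(d \<otimes> y) = cd \<otimes> xy\<close>.
\<close>

definition additivity_ideal :: "('r, 'z) ring_scheme \<Rightarrow> ('r \<Rightarrow>\<^sub>0 'k::field) set" where
  "additivity_ideal R = Idl\<^bsub>monoid_algebra R\<^esub>
     {Poly_Mapping.single (x \<oplus>\<^bsub>R\<^esub> y) 1 - Poly_Mapping.single x 1 - Poly_Mapping.single y 1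
        | x y. x \<in> carrier R \<and> y \<in> carrier R}"

definition scalar_ext :: "('r, 'z) ring_scheme \<Rightarrow> ('k::field, ('r \<Rightarrow>\<^sub>0 'k) set) module" where
  "scalar_ext R = quot_alg (monoid_algebra R) (additivity_ideal R)"

definition scalar_tensor :: "('r, 'z) ring_scheme \<Rightarrow> 'k::field \<Rightarrow> 'r \<Rightarrow> ('r \<Rightarrow>\<^sub>0 'k) set" where
  "scalar_tensor R c x = additivity_ideal R +>\<^bsub>monoid_algebra R\<^esub> Poly_Mapping.single x c"

definition extend_op ::
    "('r, 'z) ring_scheme \<Rightarrow> ('r \<Rightarrow> 'r) \<Rightarrow> ('r \<Rightarrow>\<^sub>0 'k::field) set \<Rightarrow> ('r \<Rightarrow>\<^sub>0 'k) set" where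
  "extend_op R t = (THE E. E \<in> extensional (carrier (scalar_ext R)) \<and>
     klinear (scalar_ext R) (scalar_ext R) E \<and>
     (\<forall>c. \<forall>x\<in>carrier R. E (scalar_tensor R c x) = scalar_tensor R c (t x)))"

type_synonym ('v, 'm, 'k) kskew = "(('v, 'm) skew \<Rightarrow>\<^sub>0 'k) set"

definition KSkew :: "('k::field, ('v, 'm, 'k) kskew) module" where
  "KSkew = scalar_ext Skew"

definition klp :: "'v \<Rightarrow> 'm \<Rightarrow> ('v, 'm, 'k::field) kskew" where
  "klp v i = scalar_tensor Skew 1 (lp v i)"

definition kpolarization :: "'m \<Rightarrow> 'm \<Rightarrow> ('v, 'm, 'k::field) kskew \<Rightarrow> ('v, 'm, 'k) kskew" where
  "kpolarization j i = extend_op Skew (polarization j i)"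

definition kdivided_polarization ::
    "'m \<Rightarrow> 'm \<Rightarrow> nat \<Rightarrow> ('v, 'm, 'k::field) kskew \<Rightarrow> ('v, 'm, 'k) kskew" where
  "kdivided_polarization j i h = extend_op Skew (divided_power Skew (polarization j i) h)"

definition lp_ideal :: "('k::field \<Rightarrow> 'v::ab_group_add \<Rightarrow> 'v) \<Rightarrow> ('v, 'm, 'k) kskew set" where
  "lp_ideal sc = Idl\<^bsub>KSkew\<^esub>
     {klp (sc a v1 + sc b v2) i \<ominus>\<^bsub>KSkew\<^esub> (a \<odot>\<^bsub>KSkew\<^esub> klp v1 i)
        \<ominus>\<^bsub>KSkew\<^esub> (b \<odot>\<^bsub>KSkew\<^esub> klp v2 i) | a b v1 v2 i. True}"

definition lp_quot :: "('k::field \<Rightarrow> 'v::ab_group_add \<Rightarrow> 'v) \<Rightarrow>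
    ('k, ('v, 'm, 'k) kskew set) module" where
  "lp_quot sc = quot_alg KSkew (lp_ideal sc)"

section \<open>Geometric products\<close>

text \<open>
  The index sets \<open>I\<close> of the \<open>(r, s)\<close> slice of the coproduct of an extensor of step \<open>n\<close>; there are
  none if \<open>r\<close> or \<open>s\<close> is negative. Positions are numbered from 0, as in \<open>nths\<close>.
\<close>

definition slice_sets :: "nat \<Rightarrow> int \<Rightarrow> int \<Rightarrow> nat set set" where
  "slice_sets n r s = {I. I \<subseteq> {..<n} \<and> int (card I) = r \<and> int (card ({..<n} - I)) = s}"

definition slice_perm :: "nat \<Rightarrow> nat set \<Rightarrow> nat \<Rightarrow> nat" where
  "slice_perm n I p =
     (if p < n then (sorted_list_of_set I @ sorted_list_of_set ({..<n} - I)) ! p else p)"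

definition slice_sign :: "nat \<Rightarrow> nat set \<Rightarrow> 'k::field" where
  "slice_sign n I = of_int (sign (slice_perm n I))"

text \<open>
  The value of \<open>\<diamond>\<^sub>j\<^sub>i\<^bsup>(h)\<^esup>\<close> on the tensor of the extensors with factor lists \<open>w k\<close>: place \<open>i\<close> is
  sliced, and the slice of step \<open>h\<close> is moved to place \<open>j\<close>.
\<close>

definition geom_value :: "('k::field \<Rightarrow> 'v::ab_group_add \<Rightarrow> 'v) \<Rightarrow> 'm \<Rightarrow> 'm \<Rightarrow> nat \<Rightarrow>
    ('m::{finite,linorder} \<Rightarrow> 'v list) \<Rightarrow> ('m, 'v, 'k) ext_power" where
  "geom_value sc j i h w =
    (let T = ext_power sc; E = exterior sc; A = (\<lambda>k. extensor sc (w k));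
         a = (\<lambda>k. length (w k)) in
     if i < j then
       (-1) ^ (h * (\<Sum>k\<in>{i<..<j}. a k)) \<odot>\<^bsub>T\<^esub>
         finsum T (\<lambda>I. slice_sign (a i) I \<odot>\<^bsub>T\<^esub>
             ext_tensor sc (A(i := extensor sc (nths (w i) I),
                                 j := extensor sc (nths (w i) (- I)) \<otimes>\<^bsub>E\<^esub> A j)))
           (slice_sets (a i) (int (a i) - int h) (int h))
     else
       (-1) ^ (h * (\<Sum>k\<in>{j<..<i}. a k)) \<odot>\<^bsub>T\<^esub>
         finsum T (\<lambda>I. slice_sign (a i) I \<odot>\<^bsub>T\<^esub>
             ext_tensor sc (A(j := A j \<otimes>\<^bsub>E\<^esub> extensor sc (nths (w i) I),
                                 i := extensor sc (nths (w i) (- I)))))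
           (slice_sets (a i) (int h) (int (a i) - int h)))"

text \<open>Only meaningful for \<open>i \<noteq> j\<close>.\<close>

definition geom_product :: "('k::field \<Rightarrow> 'v::ab_group_add \<Rightarrow> 'v) \<Rightarrow> 'm \<Rightarrow> 'm \<Rightarrow> nat \<Rightarrow>
    ('m::{finite,linorder}, 'v, 'k) ext_power \<Rightarrow> ('m, 'v, 'k) ext_power" where
  "geom_product sc j i h = (THE G. G \<in> extensional (carrier (ext_power sc)) \<and>
     klinear (ext_power sc) (ext_power sc) G \<and>
     (\<forall>w. G (ext_tensor sc (\<lambda>k. extensor sc (w k))) = geom_value sc j i h w))"

text \<open>The simple geometric products; the diagonal ones depend on the isomorphism \<open>\<Phi>\<close>.\<close>

definition simple_geom_product :: "('k::field \<Rightarrow> 'v::ab_group_add \<Rightarrow> 'v) \<Rightarrow>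
    (('v, 'm, 'k) kskew set \<Rightarrow> ('m, 'v, 'k) ext_power) \<Rightarrow> 'm \<Rightarrow> 'm \<Rightarrow>
    ('m::{finite,linorder}, 'v, 'k) ext_power \<Rightarrow> ('m, 'v, 'k) ext_power" where
  "simple_geom_product sc \<Phi> i j =
     (if i = j then
        transport (lp_quot sc) (ext_power sc) \<Phi>
          (induced KSkew (lp_ideal sc) (kpolarization i i))
      else geom_product sc i j 1)"

section \<open>Lie representations of the general linear Lie algebra\<close>

definition elementary_matrix :: "'m \<Rightarrow> 'm \<Rightarrow> 'k::field ^ 'm::finite ^ 'm" where
  "elementary_matrix i j = (\<chi> a b. if a = i \<and> b = j then 1 else 0)"

definition gl_derivation_rep ::
    "('k::field, 'a) module \<Rightarrow> ('k ^ 'm::finite ^ 'm \<Rightarrow> 'a \<Rightarrow> 'a) \<Rightarrow> bool" where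
  "gl_derivation_rep A \<rho> \<longleftrightarrow>
     (\<forall>X. \<rho> X \<in> alg_derivations A) \<and>
     (\<forall>X Y. \<forall>t\<in>carrier A. \<rho> (X + Y) t = \<rho> X t \<oplus>\<^bsub>A\<^esub> \<rho> Y t) \<and>
     (\<forall>c X. \<forall>t\<in>carrier A. \<rho> (\<chi> a b. c * X $ a $ b) t = c \<odot>\<^bsub>A\<^esub> \<rho> X t) \<and>
     (\<forall>X Y. \<forall>t\<in>carrier A. \<rho> (X ** Y - Y ** X) t = \<rho> X (\<rho> Y t) \<ominus>\<^bsub>A\<^esub> \<rho> Y (\<rho> X t))"

end

theory Submission
  imports Defs
begin

text \<open>
  Let \<open>P\<close> be the quotient of \<open>K \<otimes> Skew[V|m]\<close>. Linear maps out of \<open>P\<close> are functions of words in the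
  letters \<open>(v|i)\<close> that are alternating and linear in each letter. Sending a word to the tensor of the
  extensors formed by its letters at the single places, with the sign of the inversions of places,
  gives a linear map \<open>\<Phi>\<close> from \<open>P\<close> to the tensor power. The ordered products of the images of
  \<open>\<Lambda>(V)\<close> under \<open>v \<mapsto> (v|i)\<close> give a linear map \<open>\<Psi>\<close> back; \<open>\<Phi> \<circ> \<Psi>\<close> is the identity on tensors of extensors,
  and \<open>\<Psi>\<close> is surjective because the letters of a word can be sorted by place up to sign. The graded
  product is the product of \<open>P\<close> transported along this bijection, since it has the prescribed values on
  homogeneous tensors.

  Divided powers act on a word by summing over all ways to replace \<open>h\<close> of its letters; that \<open>D\<^bsup>h\<^esup>\<close> can
  be divided by \<open>h!\<close> in only one way needs that \<open>Skew[V|m]\<close> has no torsion, which follows from normal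
  forms of words with respect to a well-order of the letters. On a word sorted by place this sum is
  the coproduct slice. The commutation relations need only be compared on letters, because
  derivations of \<open>P\<close> are determined by their values there.
\<close>

text \<open>Most operators in the statement are given by a unique description (\<open>THE\<close>):
  polarizations, divided powers, their scalar extensions, the graded product and the geometric
  products. Each needs existence and uniqueness, and both are settled on words: values on words that
  respect the relations define a linear map, and words span. The universal properties are stated for
  linear maps and not for algebra homomorphisms, for two reasons. Replacing h letters of a word is
  not multiplicative for h > 1.

  Division by h! can fail over the field, so the operators are found over the integers and then
  carried through the scalar extension and the quotient. Their formula on words contains no division
  and is preserved by ring homomorphisms, so it reads the same in all three algebras.\<close>

abbreviation "single \<equiv> Poly_Mapping.single"
abbreviation "keys \<equiv> Poly_Mapping.keys"
abbreviation "lookup \<equiv> Poly_Mapping.lookup"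
abbreviation pm_scale :: "'k::comm_ring_1 \<Rightarrow> ('a \<Rightarrow>\<^sub>0 'k) \<Rightarrow> ('a \<Rightarrow>\<^sub>0 'k)" where
  "pm_scale c \<equiv> Poly_Mapping.map ((*) c)"

section \<open>Modules, algebras and linear maps\<close>

text \<open>The scalars are a type of class \<open>comm_ring_1\<close>, so that the integers act as
  well as the field. The product fields of the record are left unconstrained: the target of a linear
  map may be any module.\<close>

locale kmod = abelian_group A for A :: "('k::comm_ring_1, 'a) module" (structure) +
  assumes smult_closed [simp, intro]: "x \<in> carrier A \<Longrightarrow> c \<odot> x \<in> carrier A"
    and smult_l_distr: "x \<in> carrier A \<Longrightarrow> (a + b) \<odot> x = a \<odot> x \<oplus> b \<odot> x"
    and smult_r_distr: "x \<in> carrier A \<Longrightarrow> y \<in> carrier A \<Longrightarrow> c \<odot> (x \<oplus> y) = c \<odot> x \<oplus> c \<odot> y"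
    and smult_smult: "x \<in> carrier A \<Longrightarrow> a \<odot> (b \<odot> x) = (a * b) \<odot> x"
    and smult_one [simp]: "x \<in> carrier A \<Longrightarrow> 1 \<odot> x = x"
begin

lemma smult_0 [simp]: "x \<in> carrier A \<Longrightarrow> 0 \<odot> x = \<zero>"
  using smult_l_distr[of x 0 0] by (simp add: add.l_cancel_one')

lemma smult_zero [simp]: "c \<odot> \<zero> = \<zero>"
  using smult_r_distr[of \<zero> \<zero> c] by (simp add: add.l_cancel_one')

lemma smult_minus_one: "x \<in> carrier A \<Longrightarrow> (- 1) \<odot> x = \<ominus> x"
  using smult_l_distr[of x 1 "-1"] by (metis add.right_inverse minus_equality smult_closed
      smult_0 smult_one local.add.m_comm)

lemma smult_uminus: "x \<in> carrier A \<Longrightarrow> (- c) \<odot> x = \<ominus> (c \<odot> x)"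
  using smult_smult[of x "-1" c] smult_minus_one[of "c \<odot> x"] by simp

lemma smult_a_inv: "x \<in> carrier A \<Longrightarrow> c \<odot> (\<ominus> x) = \<ominus> (c \<odot> x)"
  using smult_smult[of x c "-1"] smult_uminus[of x c] smult_minus_one[of x] by simp

lemma minus_zero_eq:
  assumes "x \<in> carrier A" "y \<in> carrier A" "x \<ominus> y = \<zero>"
  shows "x = y"
proof -
  have "x = (x \<ominus> y) \<oplus> y" using assms(1,2) by (simp add: a_minus_def a_assoc l_neg)
  then show ?thesis using assms by simp
qed

lemma plus_minus_minus:
  assumes "x \<in> carrier A" "y \<in> carrier A"
  shows "x \<oplus> y \<ominus> x \<ominus> y = \<zero>"
proof -
  have "x \<oplus> y \<ominus> x \<ominus> y = (x \<oplus> \<ominus> x) \<oplus> (y \<oplus> \<ominus> y)"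
    using assms by (simp add: a_minus_def a_ac)
  then show ?thesis using assms by (simp add: r_neg)
qed

lemma smult_finsum:
  "f \<in> S \<rightarrow> carrier A \<Longrightarrow> c \<odot> finsum A f S = finsum A (\<lambda>x. c \<odot> f x) S"
proof (induction S rule: infinite_finite_induct)
  case (insert x F)
  then show ?case by (simp add: finsum_insert Pi_def smult_r_distr)
qed (auto simp: finsum_infinite)

end

locale kalg = kmod A + ring A for A :: "('k::comm_ring_1, 'a) module" (structure) +
  assumes smult_mult_l: "x \<in> carrier A \<Longrightarrow> y \<in> carrier A \<Longrightarrow> (c \<odot> x) \<otimes> y = c \<odot> (x \<otimes> y)"
    and smult_mult_r: "x \<in> carrier A \<Longrightarrow> y \<in> carrier A \<Longrightarrow> x \<otimes> (c \<odot> y) = c \<odot> (x \<otimes> y)"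

lemma klinear_closed: "klinear A B f \<Longrightarrow> x \<in> carrier A \<Longrightarrow> f x \<in> carrier B"
  by (auto simp: klinear_def)

lemma klinear_add:
  "klinear A B f \<Longrightarrow> x \<in> carrier A \<Longrightarrow> y \<in> carrier A \<Longrightarrow> f (x \<oplus>\<^bsub>A\<^esub> y) = f x \<oplus>\<^bsub>B\<^esub> f y"
  by (auto simp: klinear_def)

lemma klinear_smult: "klinear A B f \<Longrightarrow> x \<in> carrier A \<Longrightarrow> f (c \<odot>\<^bsub>A\<^esub> x) = c \<odot>\<^bsub>B\<^esub> f x"
  by (auto simp: klinear_def)

lemma klinearI:
  assumes "\<And>x. x \<in> carrier A \<Longrightarrow> f x \<in> carrier B"
    and "\<And>x y. x \<in> carrier A \<Longrightarrow> y \<in> carrier A \<Longrightarrow> f (x \<oplus>\<^bsub>A\<^esub> y) = f x \<oplus>\<^bsub>B\<^esub> f y"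
    and "\<And>c x. x \<in> carrier A \<Longrightarrow> f (c \<odot>\<^bsub>A\<^esub> x) = c \<odot>\<^bsub>B\<^esub> f x"
  shows "klinear A B f"
  using assms by (auto simp: klinear_def)

lemma klinear_zero:
  assumes "kmod A" "kmod B" "klinear A B f"
  shows "f \<zero>\<^bsub>A\<^esub> = \<zero>\<^bsub>B\<^esub>"
proof -
  interpret A: kmod A by fact
  interpret B: kmod B by fact
  show ?thesis
    using klinear_smult[OF assms(3), of "\<zero>\<^bsub>A\<^esub>" 0] klinear_closed[OF assms(3), of "\<zero>\<^bsub>A\<^esub>"] by simp
qed

lemma klinear_a_inv:
  assumes "kmod A" "kmod B" "klinear A B f" "x \<in> carrier A"
  shows "f (\<ominus>\<^bsub>A\<^esub> x) = \<ominus>\<^bsub>B\<^esub> f x"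
proof -
  interpret A: kmod A by fact
  interpret B: kmod B by fact
  show ?thesis
    using klinear_smult[OF assms(3,4), of "-1"] klinear_closed[OF assms(3,4)] assms(4)
    by (simp add: A.smult_minus_one B.smult_minus_one)
qed

lemma klinear_minus:
  assumes "kmod A" "kmod B" "klinear A B f" "x \<in> carrier A" "y \<in> carrier A"
  shows "f (x \<ominus>\<^bsub>A\<^esub> y) = f x \<ominus>\<^bsub>B\<^esub> f y"
proof -
  interpret A: kmod A by fact
  interpret B: kmod B by fact
  show ?thesis
    using assms by (simp add: a_minus_def klinear_add klinear_a_inv)
qed

lemma klinear_finsum:
  assumes "kmod A" "kmod B" "klinear A B f" "g \<in> S \<rightarrow> carrier A"
  shows "f (finsum A g S) = finsum B (\<lambda>x. f (g x)) S"
proof -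
  interpret A: kmod A by fact
  interpret B: kmod B by fact
  show ?thesis using assms(4)
  proof (induction S rule: infinite_finite_induct)
    case (insert x F)
    then have "g x \<in> carrier A" "g \<in> F \<rightarrow> carrier A" by auto
    moreover from this have "f (g x) \<in> carrier B" "(\<lambda>x. f (g x)) \<in> F \<rightarrow> carrier B"
      using klinear_closed[OF assms(3)] by auto
    ultimately show ?case using insert
      by (simp add: A.finsum_insert B.finsum_insert klinear_add[OF assms(3)])
  qed (auto simp: klinear_zero[OF assms(1-3)] A.finsum_infinite B.finsum_infinite)
qed

lemma klinear_cong:
  assumes "klinear A B f" "\<And>x. x \<in> carrier A \<Longrightarrow> f x = g x" "kmod A"
  shows "klinear A B g"
proof -
  interpret A: kmod A by fact
  show ?thesis using assms(1,2)
    by (intro klinearI) (auto simp flip: assms(2) simp: klinear_closed klinear_add klinear_smult)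
qed

lemma klinear_compose: "klinear A B f \<Longrightarrow> klinear B C g \<Longrightarrow> klinear A C (\<lambda>x. g (f x))"
  by (auto simp: klinear_def Pi_def)

lemma klinear_ident: "klinear A A (\<lambda>x. x)"
  by (auto simp: klinear_def)

lemma (in kmod) klinear_plus:
  assumes "klinear B A f" "klinear B A g"
  shows "klinear B A (\<lambda>x. f x \<oplus> g x)"
  using assms by (intro klinearI)
    (auto simp: klinear_closed klinear_add klinear_smult smult_r_distr a_ac)

lemma (in kmod) klinear_scale:
  assumes "klinear B A f"
  shows "klinear B A (\<lambda>x. c \<odot> f x)"
  using assms by (intro klinearI)
    (auto simp: klinear_closed klinear_add klinear_smult smult_r_distr smult_smult mult.commute)

lemma (in kmod) klinear_const_zero: "klinear B A (\<lambda>x. \<zero>)"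
  by (intro klinearI) auto

lemma (in kalg) klinear_mult_l:
  assumes "klinear B A f" "a \<in> carrier A"
  shows "klinear B A (\<lambda>x. a \<otimes> f x)"
  using assms by (intro klinearI)
    (auto simp: klinear_closed klinear_add klinear_smult r_distr smult_mult_r)

lemma (in kalg) klinear_mult_r:
  assumes "klinear B A f" "a \<in> carrier A"
  shows "klinear B A (\<lambda>x. f x \<otimes> a)"
  using assms by (intro klinearI)
    (auto simp: klinear_closed klinear_add klinear_smult l_distr smult_mult_l)

subsection \<open>Linear spans\<close>

text \<open>Closure under the operations is used in place of finite combinations, so that facts
  about linear maps on a span follow by rule induction.\<close>

inductive_set kspan :: "('k, 'a) module \<Rightarrow> 'a set \<Rightarrow> 'a set" for A W where
  base: "w \<in> W \<Longrightarrow> w \<in> kspan A W"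
| zero: "\<zero>\<^bsub>A\<^esub> \<in> kspan A W"
| add: "x \<in> kspan A W \<Longrightarrow> y \<in> kspan A W \<Longrightarrow> x \<oplus>\<^bsub>A\<^esub> y \<in> kspan A W"
| smult: "x \<in> kspan A W \<Longrightarrow> c \<odot>\<^bsub>A\<^esub> x \<in> kspan A W"

lemma (in kmod) kspan_closed:
  assumes "W \<subseteq> carrier A" "x \<in> kspan A W"
  shows "x \<in> carrier A"
  using assms(2,1) by induction auto

lemma kspan_trans:
  assumes "W \<subseteq> kspan A W'" "x \<in> kspan A W"
  shows "x \<in> kspan A W'"
  using assms(2,1) by induction (auto intro: kspan.intros)

lemma klinear_kspan:
  assumes "kmod A" "kmod B" "klinear A B f" "W \<subseteq> carrier A"
    and "\<And>w. w \<in> W \<Longrightarrow> f w \<in> kspan B W'" and "x \<in> kspan A W"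
  shows "f x \<in> kspan B W'"
  using assms(6)
proof induction
  case (add x y)
  then show ?case using kmod.kspan_closed[OF assms(1,4)] klinear_add[OF assms(3)]
    by (metis kspan.add)
next
  case (smult x c)
  then show ?case using kmod.kspan_closed[OF assms(1,4)] klinear_smult[OF assms(3)]
    by (metis kspan.smult)
qed (use assms in \<open>auto simp: klinear_zero intro: kspan.zero\<close>)

text \<open>Nearly every uniqueness claim below is reduced to this comparison on a spanning
  set.\<close>

lemma klinear_eq_on_kspan:
  assumes "kmod A" "kmod B" "klinear A B f" "klinear A B g" "W \<subseteq> carrier A"
    and "\<And>w. w \<in> W \<Longrightarrow> f w = g w" and "x \<in> kspan A W"
  shows "f x = g x"
  using assms(7)
proof induction
  case (add x y)
  then show ?case using kmod.kspan_closed[OF assms(1,5)] klinear_add[OF assms(3)] klinear_add[OF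
    assms(4)]
    by metis
next
  case (smult x c)
  then show ?case using kmod.kspan_closed[OF assms(1,5)] klinear_smult[OF assms(3)]
      klinear_smult[OF assms(4)] by metis
qed (use assms in \<open>auto simp: klinear_zero\<close>)

subsection \<open>Quotients\<close>

text \<open>\<open>quot_alg\<close> and \<open>Quot\<close> build records of different types with
  equal ring fields; the ring axioms have to be carried across, in both directions.\<close>

lemma ring_cong:
  assumes "ring R" "carrier S = carrier R" "mult S = mult R" "one S = one R" "zero S = zero R"
    "add S = add R"
  shows "ring S"
proof -
  interpret R: ring R by fact
  have inv: "\<exists>y\<in>carrier R. y \<oplus>\<^bsub>R\<^esub> x = \<zero>\<^bsub>R\<^esub>" if "x \<in> carrier R" for x
    using that R.l_neg[OF that] by (intro bexI[of _ "\<ominus>\<^bsub>R\<^esub> x"]) simp_all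
  show ?thesis
  proof (intro ringI abelian_groupI monoidI, unfold assms(2-))
    show "x \<oplus>\<^bsub>R\<^esub> y = y \<oplus>\<^bsub>R\<^esub> x" if "x \<in> carrier R" "y \<in> carrier R" for x y
      using that by (rule R.a_comm)
  qed (simp_all add: R.m_assoc R.a_assoc R.l_distr R.r_distr inv)
qed

lemma quot_alg_sel:
  "carrier (quot_alg A I) = carrier (A Quot I)" "mult (quot_alg A I) = mult (A Quot I)"
  "one (quot_alg A I) = one (A Quot I)" "zero (quot_alg A I) = zero (A Quot I)"
  "add (quot_alg A I) = add (A Quot I)"
  by (simp_all add: quot_alg_def)

lemma carrier_quot_alg: "carrier (quot_alg A I) = (\<lambda>x. I +>\<^bsub>A\<^esub> x) ` carrier A"
  by (auto simp: quot_alg_def FactRing_def A_RCOSETS_def')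

lemma coset_in_carrier: "x \<in> carrier A \<Longrightarrow> I +>\<^bsub>A\<^esub> x \<in> carrier (quot_alg A I)"
  by (auto simp: carrier_quot_alg)

locale kalg_ideal = kalg A + ideal I A for A :: "('k::comm_ring_1, 'a) module" (structure) and I
begin

text \<open>Since \<open>c \<odot> x = (c \<odot> \<one>) \<otimes> x\<close>, absorbing products
  already means absorbing scalars.\<close>

lemma ideal_smult: "x \<in> I \<Longrightarrow> c \<odot> x \<in> I"
  using I_l_closed[of x "c \<odot> \<one>"] smult_mult_l[of \<one> x c] by simp

lemma coset_eq_iff:
  "x \<in> carrier A \<Longrightarrow> y \<in> carrier A \<Longrightarrow> I +> x = I +> y \<longleftrightarrow> x \<ominus> y \<in> I"
  using quotient_eq_iff_same_a_r_cos[OF is_ideal] by metis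

lemma coset_add:
  "x \<in> carrier A \<Longrightarrow> y \<in> carrier A \<Longrightarrow> (I +> x) \<oplus>\<^bsub>quot_alg A I\<^esub> (I +> y) = I +> (x \<oplus> y)"
  by (simp add: quot_alg_def FactRing_def a_rcos_sum)

lemma coset_mult:
  "x \<in> carrier A \<Longrightarrow> y \<in> carrier A \<Longrightarrow> (I +> x) \<otimes>\<^bsub>quot_alg A I\<^esub> (I +> y) = I +> (x \<otimes> y)"
  by (simp add: quot_alg_def FactRing_def rcoset_mult_add)

lemma coset_one: "\<one>\<^bsub>quot_alg A I\<^esub> = I +> \<one>"
  by (simp add: quot_alg_def FactRing_def)

lemma coset_zero: "\<zero>\<^bsub>quot_alg A I\<^esub> = I +> \<zero>"
  using a_coset_add_zero[OF a_subset] by (simp add: quot_alg_def FactRing_def)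

lemma coset_eq_zero_iff: "x \<in> carrier A \<Longrightarrow> I +> x = \<zero>\<^bsub>quot_alg A I\<^esub> \<longleftrightarrow> x \<in> I"
  by (simp add: coset_zero coset_eq_iff a_minus_def)

lemma coset_plusI:
  assumes "x \<in> carrier A" "y \<in> carrier A" "z \<in> carrier A" "x \<ominus> y \<ominus> z \<in> I"
  shows "I +> x = (I +> y) \<oplus>\<^bsub>quot_alg A I\<^esub> (I +> z)"
proof -
  have "x \<ominus> y \<ominus> z = x \<ominus> (y \<oplus> z)"
    using assms by (simp add: a_minus_def minus_add a_assoc)
  then show ?thesis using assms by (simp add: coset_add coset_eq_iff)
qed

text \<open>Scalar multiplication on a quotient and \<open>induced\<close> are unions over all
  representatives. Once the operation is independent of the representative, the union collapses to
  one coset.\<close>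

lemma UN_coset:
  assumes "\<And>y. y \<in> carrier A \<Longrightarrow> f y \<in> carrier A" "\<And>y. y \<in> I +> x \<Longrightarrow> I +> f y = I +> f x"
    "x \<in> carrier A"
  shows "(\<Union>y\<in>I +> x. I +> f y) = I +> f x"
  using assms a_rcos_self[OF assms(3)] by blast

lemma mem_coset_iff: "x \<in> carrier A \<Longrightarrow> y \<in> I +> x \<longleftrightarrow> y \<in> carrier A \<and> y \<ominus> x \<in> I"
  by (metis a_elemrcos_carrier a_rcos_self coset_eq_iff a_repr_independence')

lemma coset_smult:
  assumes "x \<in> carrier A"
  shows "c \<odot>\<^bsub>quot_alg A I\<^esub> (I +> x) = I +> (c \<odot> x)"
proof -
  have "I +> (c \<odot> y) = I +> (c \<odot> x)" if "y \<in> I +> x" for y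
  proof -
    have y: "y \<in> carrier A" "y \<ominus> x \<in> I" using that mem_coset_iff[OF assms] by auto
    have "c \<odot> y \<ominus> c \<odot> x = c \<odot> (y \<ominus> x)"
      using y assms by (simp add: a_minus_def smult_r_distr smult_a_inv)
    then show ?thesis using coset_eq_iff[of "c \<odot> y" "c \<odot> x"] ideal_smult[OF y(2)] y assms by simp
  qed
  then show ?thesis using UN_coset[of "\<lambda>x. c \<odot> x" x] assms by (simp add: quot_alg_def)
qed

lemma kalg_quot: "kalg (quot_alg A I)"
proof -
  interpret Q: ring "quot_alg A I"
    by (rule ring_cong[OF quotient_is_ring]) (simp_all add: quot_alg_sel)
  show ?thesis
    by unfold_locales
      (auto simp: carrier_quot_alg coset_smult coset_add coset_mult smult_l_distr smult_r_distr
        smult_smult smult_mult_l smult_mult_r)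
qed

lemma klinear_coset: "klinear A (quot_alg A I) (\<lambda>x. I +> x)"
  by (intro klinearI) (auto simp: coset_in_carrier coset_add coset_smult)

lemma ring_hom_coset: "(\<lambda>x. I +> x) \<in> ring_hom A (quot_alg A I)"
  by (auto simp: ring_hom_def coset_in_carrier coset_add coset_mult coset_one)

lemma klinear_descend:
  assumes "kmod B" "klinear A B L" "\<And>x. x \<in> I \<Longrightarrow> L x = \<zero>\<^bsub>B\<^esub>"
  obtains L' where "klinear (quot_alg A I) B L'" "\<And>x. x \<in> carrier A \<Longrightarrow> L' (I +> x) = L x"
proof -
  interpret B: kmod B by fact
  \<comment> \<open>Any representative will do, because \<open>L\<close> vanishes on
    \<open>I\<close>.\<close>
  define L' where "L' X = L (SOME x. x \<in> carrier A \<and> X = I +> x)" for X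
  have L': "L' (I +> x) = L x" if "x \<in> carrier A" for x
  proof -
    define y where "y = (SOME y. y \<in> carrier A \<and> I +> x = I +> y)"
    have y: "y \<in> carrier A \<and> I +> x = I +> y"
      unfolding y_def by (rule someI[of _ x]) (simp add: that)
    then have "L (x \<ominus> y) = \<zero>\<^bsub>B\<^esub>" using assms(3) coset_eq_iff[of x y] that by simp
    then have "L x \<ominus>\<^bsub>B\<^esub> L y = \<zero>\<^bsub>B\<^esub>"
      using klinear_minus[OF kmod_axioms assms(1,2)] y that by simp
    then have "L x = L y" using klinear_closed[OF assms(2)] y that B.minus_zero_eq by blast
    then show ?thesis by (simp add: L'_def y_def)
  qed
  have "klinear (quot_alg A I) B L'"
    using klinear_closed[OF assms(2)] klinear_add[OF assms(2)] klinear_smult[OF assms(2)]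
    by (intro klinearI) (auto simp: carrier_quot_alg coset_smult coset_add L')
  with that L' show thesis by blast
qed

lemma kspan_quot:
  assumes "W \<subseteq> carrier A" "\<And>x. x \<in> carrier A \<Longrightarrow> x \<in> kspan A W"
    and "X \<in> carrier (quot_alg A I)"
  shows "X \<in> kspan (quot_alg A I) ((\<lambda>x. I +> x) ` W)"
proof -
  obtain x where x: "x \<in> carrier A" "X = I +> x" using assms(3) by (auto simp: carrier_quot_alg)
  interpret Q: kalg "quot_alg A I" by (rule kalg_quot)
  show ?thesis unfolding x(2)
    by (rule klinear_kspan[OF kmod_axioms Q.kmod_axioms klinear_coset assms(1) _ assms(2)[OF x(1)]])
     (auto intro: kspan.base)
qed

end

text \<open>The elements x with L(a x b) = 0 for all a and b form a two-sided ideal, so only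
  generators need testing. By linearity in a and in b, these two may be taken from the spanning set.
  Nothing is asked of \<open>L\<close> on products.\<close>

lemma (in kalg) klinear_kills_Idl:
  assumes "kmod B" "klinear A B L" "S \<subseteq> carrier A" "W \<subseteq> carrier A"
    and span: "\<And>x. x \<in> carrier A \<Longrightarrow> x \<in> kspan A W"
    and kill: "\<And>s u v. s \<in> S \<Longrightarrow> u \<in> W \<Longrightarrow> v \<in> W \<Longrightarrow> L (u \<otimes> s \<otimes> v) = \<zero>\<^bsub>B\<^esub>"
    and "x \<in> Idl S"
  shows "L x = \<zero>\<^bsub>B\<^esub>"
proof -
  interpret B: kmod B by fact
  note L = klinear_closed[OF assms(2)] klinear_add[OF assms(2)] klinear_smult[OF assms(2)]
  have k1: "L (u \<otimes> s \<otimes> b) = \<zero>\<^bsub>B\<^esub>" if "s \<in> S" "u \<in> W" "b \<in> carrier A" for s u b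
    by (rule klinear_eq_on_kspan[OF kmod_axioms assms(1) _ _ assms(4) _ span[OF that(3)]])
      (use that assms in \<open>auto intro!: klinear_compose[OF _ assms(2)] klinear_mult_l klinear_ident
        B.klinear_const_zero\<close>)
  have k2: "L (a \<otimes> s \<otimes> b) = \<zero>\<^bsub>B\<^esub>" if "s \<in> S" "a \<in> carrier A" "b \<in> carrier A" for s a b
    by (rule klinear_eq_on_kspan[OF kmod_axioms assms(1) _ _ assms(4) _ span[OF that(2)]])
      (use that assms k1 in \<open>auto intro!: klinear_compose[OF _ assms(2)] klinear_mult_r
        klinear_ident
        B.klinear_const_zero\<close>)
  let ?J = "{x \<in> carrier A. \<forall>a\<in>carrier A. \<forall>b\<in>carrier A. L (a \<otimes> x \<otimes> b) = \<zero>\<^bsub>B\<^esub>}"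
  have "ideal ?J A"
  proof (rule idealI[OF ring_axioms])
    show "subgroup ?J (add_monoid A)"
    proof (rule add.subgroupI)
      show "?J \<noteq> {}" using klinear_zero[OF kmod_axioms assms(1,2)] by (auto intro!: exI[of _ \<zero>])
      fix x assume x: "x \<in> ?J"
      have "L (a \<otimes> \<ominus> x \<otimes> b) = \<ominus>\<^bsub>B\<^esub> L (a \<otimes> x \<otimes> b)" if "a \<in> carrier A" "b \<in> carrier A" for a b
        using klinear_a_inv[OF kmod_axioms assms(1,2), of "a \<otimes> x \<otimes> b"] x that
        by (simp add: r_minus l_minus)
      then show "\<ominus> x \<in> ?J" using x by auto
    next
      fix x y assume "x \<in> ?J" "y \<in> ?J"
      then show "x \<oplus> y \<in> ?J" by (auto simp: r_distr l_distr L)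
    qed auto
  next
    fix a x assume a: "a \<in> ?J" "x \<in> carrier A"
    then show "x \<otimes> a \<in> ?J" "a \<otimes> x \<in> ?J"
      by (auto simp: m_assoc[symmetric]) (auto simp: m_assoc)
  qed
  moreover have "S \<subseteq> ?J" using k2 assms(3) by auto
  ultimately have "x \<in> ?J" using \<open>x \<in> Idl S\<close> unfolding genideal_def by blast
  then have "L (\<one> \<otimes> x \<otimes> \<one>) = \<zero>\<^bsub>B\<^esub>" "x \<in> carrier A" by blast+
  then show ?thesis by simp
qed

subsection \<open>Monoid algebras\<close>

lemma poly_mapping_support_induct [consumes 1, case_names zero single add]:
  fixes p :: "'a \<Rightarrow>\<^sub>0 'k::comm_monoid_add"
  assumes "keys p \<subseteq> C" "P 0"
    and single: "\<And>x c. x \<in> C \<Longrightarrow> P (single x c)"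
    and add: "\<And>p q. keys p \<subseteq> C \<Longrightarrow> keys q \<subseteq> C \<Longrightarrow> P p \<Longrightarrow> P q \<Longrightarrow> P (p + q)"
  shows "P p"
proof -
  have sum: "P (\<Sum>x\<in>S. single x (lookup p x)) \<and>
      keys (\<Sum>x\<in>S. single x (lookup p x)) \<subseteq> S"
    if "finite S" "S \<subseteq> C" for S
    using that
  proof (induction S)
    case (insert x F)
    let ?q = "\<Sum>x\<in>F. single x (lookup p x)"
    have "keys (single x (lookup p x) + ?q) \<subseteq> insert x F"
      using insert Poly_Mapping.keys_add[of "single x (lookup p x)" ?q]
      by (auto split: if_splits)
    then show ?case using insert by (auto intro!: add single split: if_splits)
  qed (use assms(2) in auto)
  have "p = (\<Sum>x\<in>keys p. single x (lookup p x))"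
    by (rule poly_mapping_eqI)
      (auto simp: lookup_sum lookup_single when_def in_keys_iff)
  then show ?thesis using sum[OF _ assms(1)] by simp
qed

text \<open>The linear extension of \<open>f\<close> to the free module on \<open>'a\<close>; only
  values of \<open>f\<close> on the support enter, so \<open>f\<close> need not land in the carrier
  elsewhere.\<close>

definition lin :: "('k::comm_ring_1, 'b) module \<Rightarrow> ('a \<Rightarrow> 'b) \<Rightarrow> ('a \<Rightarrow>\<^sub>0 'k) \<Rightarrow> 'b" where
  "lin B f p = finsum B (\<lambda>x. lookup p x \<odot>\<^bsub>B\<^esub> f x) (keys p)"

context kmod
begin

text \<open>Supports change under addition and scaling. A common finite index set makes the sums
  comparable term by term; \<open>monoid_algebra_mult_superset\<close> does the same for
  products.\<close>

lemma lin_superset: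
  assumes "finite S" "keys p \<subseteq> S" "f \<in> S \<rightarrow> carrier A"
  shows "lin A f p = finsum A (\<lambda>x. lookup p x \<odot> f x) S"
  unfolding lin_def
  by (rule add.finprod_mono_neutral_cong_left) (use assms in \<open>auto simp: in_keys_iff Pi_def\<close>)

lemma lin_closed: "f \<in> C \<rightarrow> carrier A \<Longrightarrow> keys p \<subseteq> C \<Longrightarrow> lin A f p \<in> carrier A"
  unfolding lin_def by (rule finsum_closed) auto

lemma lin_single: "f x \<in> carrier A \<Longrightarrow> lin A f (single x c) = c \<odot> f x"
  by (subst lin_superset[of "{x}"]) (auto simp: finsum_singleton)

lemma lin_add:
  assumes "f \<in> C \<rightarrow> carrier A" "keys p \<subseteq> C" "keys q \<subseteq> C"
  shows "lin A f (p + q) = lin A f p \<oplus> lin A f q"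
proof -
  let ?S = "keys p \<union> keys q"
  have f: "f \<in> ?S \<rightarrow> carrier A" using assms by auto
  have "lin A f (p + q) = finsum A (\<lambda>x. lookup (p + q) x \<odot> f x) ?S"
    using f Poly_Mapping.keys_add[of p q] by (intro lin_superset) auto
  also have "\<dots> = finsum A (\<lambda>x. lookup p x \<odot> f x \<oplus> lookup q x \<odot> f x) ?S"
    using f by (intro finsum_cong') (auto simp: lookup_add smult_l_distr Pi_iff)
  also have "\<dots> = lin A f p \<oplus> lin A f q"
    using f by (subst finsum_addf) (auto simp: lin_superset[of ?S])
  finally show ?thesis .
qed

lemma lin_smult:
  assumes "f \<in> C \<rightarrow> carrier A" "keys p \<subseteq> C"
  shows "lin A f (pm_scale c p) = c \<odot> lin A f p"
proof -
  let ?S = "keys p"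
  have f: "f \<in> ?S \<rightarrow> carrier A" using assms by auto
  have "lin A f (pm_scale c p) = finsum A (\<lambda>x. lookup (pm_scale c p) x \<odot> f x) ?S"
    using f by (intro lin_superset) (auto simp: in_keys_iff map.rep_eq when_def)
  also have "\<dots> = finsum A (\<lambda>x. c \<odot> (lookup p x \<odot> f x)) ?S"
    using f by (intro finsum_cong') (auto simp: map.rep_eq when_def smult_smult in_keys_iff Pi_iff)
  also have "\<dots> = c \<odot> lin A f p"
    using f unfolding lin_def by (subst smult_finsum) auto
  finally show ?thesis .
qed

end

lemma monoid_algebra_sel:
  "carrier (monoid_algebra M) = {f. keys f \<subseteq> carrier M}"
  "one (monoid_algebra M) = single \<one>\<^bsub>M\<^esub> 1"
  "zero (monoid_algebra M) = 0"
  "add (monoid_algebra M) = (+)"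
  "smult (monoid_algebra M) = (\<lambda>c. pm_scale c)"
  by (simp_all add: monoid_algebra_def)

lemma keys_smult_subset: "keys (pm_scale c p) \<subseteq> keys (p :: 'a \<Rightarrow>\<^sub>0 'k::comm_ring_1)"
  by (auto simp: in_keys_iff map.rep_eq when_def)

lemma lookup_scale: "lookup (pm_scale c p) x = c * lookup p x"
  for c :: "'k::comm_ring_1"
  by (simp add: map.rep_eq when_def)

lemma kmod_monoid_algebra:
  "kmod (monoid_algebra M :: ('k::comm_ring_1, 'a \<Rightarrow>\<^sub>0 'k) module)"
proof -
  let ?A = "monoid_algebra M :: ('k, 'a \<Rightarrow>\<^sub>0 'k) module"
  have add: "keys (p + q) \<subseteq> C" if "keys p \<subseteq> C" "keys q \<subseteq> C"
    for p q :: "'a \<Rightarrow>\<^sub>0 'k" and C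
    using that Poly_Mapping.keys_add[of p q] by blast
  have inv: "\<exists>y\<in>carrier ?A. y \<oplus>\<^bsub>?A\<^esub> x = \<zero>\<^bsub>?A\<^esub>" if "x \<in> carrier ?A" for x
    using that by (intro bexI[of _ "- x"]) (auto simp: monoid_algebra_sel in_keys_iff)
  have "abelian_group ?A"
  proof (rule abelian_groupI)
    fix x y z assume x: "x \<in> carrier ?A" and y: "y \<in> carrier ?A"
    then show "x \<oplus>\<^bsub>?A\<^esub> y \<in> carrier ?A" using add by (simp add: monoid_algebra_sel)
    show "(x \<oplus>\<^bsub>?A\<^esub> y) \<oplus>\<^bsub>?A\<^esub> z = x \<oplus>\<^bsub>?A\<^esub> (y \<oplus>\<^bsub>?A\<^esub> z)" "x \<oplus>\<^bsub>?A\<^esub> y = y \<oplus>\<^bsub>?A\<^esub> x"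
      unfolding monoid_algebra_sel by (rule add.assoc, rule add.commute)
    show "\<exists>y\<in>carrier ?A. y \<oplus>\<^bsub>?A\<^esub> x = \<zero>\<^bsub>?A\<^esub>" using x by (rule inv)
  qed (simp_all add: monoid_algebra_sel)
  moreover have "keys (pm_scale c p) \<subseteq> C" if "keys p \<subseteq> C"
    for p :: "'a \<Rightarrow>\<^sub>0 'k" and c C
    by (rule subset_trans[OF keys_smult_subset that])
  ultimately show ?thesis
    by (intro kmod.intro kmod_axioms.intro)
     (simp_all add: monoid_algebra_sel poly_mapping_eq_iff lookup_scale lookup_add algebra_simps
       fun_eq_iff)
qed

lemma monoid_algebra_minus:
  fixes p q :: "'a \<Rightarrow>\<^sub>0 'k::comm_ring_1"
  assumes "p \<in> carrier (monoid_algebra M)" "q \<in> carrier (monoid_algebra M)"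
  shows "p - q \<in> carrier (monoid_algebra M)" "p \<ominus>\<^bsub>monoid_algebra M\<^esub> q = p - q"
proof -
  interpret A: kmod "monoid_algebra M :: ('k, 'a \<Rightarrow>\<^sub>0 'k) module" by (rule kmod_monoid_algebra)
  have "keys (- q) = keys q" by (auto simp: in_keys_iff)
  then have q: "- q \<in> carrier (monoid_algebra M)" using assms by (simp add: monoid_algebra_sel)
  then have "\<ominus>\<^bsub>monoid_algebra M\<^esub> q = - q"
    using assms by (intro A.minus_equality) (simp_all add: monoid_algebra_sel(3,4))
  then show "p \<ominus>\<^bsub>monoid_algebra M\<^esub> q = p - q" by (simp add: a_minus_def monoid_algebra_sel(4))
  then show "p - q \<in> carrier (monoid_algebra M)" using A.minus_closed[OF assms] by simp
qed

lemma klinear_lin: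
  assumes "kmod B" "f \<in> carrier M \<rightarrow> carrier B"
  shows "klinear (monoid_algebra M) B (lin B f)"
  using kmod.lin_closed[OF assms] kmod.lin_add[OF assms] kmod.lin_smult[OF assms]
  by (intro klinearI) (auto simp: monoid_algebra_sel)

lemma single_in_monoid_algebra:
  "x \<in> carrier M \<Longrightarrow> single x c \<in> carrier (monoid_algebra M)"
  by (auto simp: monoid_algebra_sel)

lemma monoid_algebra_span:
  fixes p :: "'a \<Rightarrow>\<^sub>0 'k::comm_ring_1"
  assumes "p \<in> carrier (monoid_algebra M)"
  shows "p \<in> kspan (monoid_algebra M) ((\<lambda>x. single x 1) ` carrier M)"
proof -
  have "keys p \<subseteq> carrier M" using assms by (simp add: monoid_algebra_sel)
  then show ?thesis
  proof (induction rule: poly_mapping_support_induct)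
    case zero
    then show ?case using kspan.zero[of "monoid_algebra M"] by (simp add: monoid_algebra_sel)
  next
    case (single x c)
    have "c \<odot>\<^bsub>monoid_algebra M\<^esub> single x 1
      \<in> kspan (monoid_algebra M) ((\<lambda>x. single x 1) ` carrier M)"
      using single by (intro kspan.smult kspan.base) auto
    then show ?case by (simp add: monoid_algebra_sel)
  next
    case (add p q)
    then show ?case using kspan.add[of p "monoid_algebra M" _ q] by (simp add: monoid_algebra_sel)
  qed
qed

lemma monoid_algebra_mult_superset:
  fixes f g :: "'a \<Rightarrow>\<^sub>0 'k::comm_ring_1"
  assumes "finite S" "finite T" "keys f \<subseteq> S" "keys g \<subseteq> T"
  shows "f \<otimes>\<^bsub>monoid_algebra M\<^esub> g =
    (\<Sum>x\<in>S. \<Sum>y\<in>T. single (x \<otimes>\<^bsub>M\<^esub> y) (lookup f x * lookup g y))"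
proof -
  have "f \<otimes>\<^bsub>monoid_algebra M\<^esub> g =
    (\<Sum>x\<in>keys f. \<Sum>y\<in>T. single (x \<otimes>\<^bsub>M\<^esub> y) (lookup f x * lookup g y))"
    unfolding monoid_algebra_def monoid.simps
    by (rule sum.cong[OF refl], rule sum.mono_neutral_left) (use assms in \<open>auto simp: in_keys_iff\<close>)
  also have "\<dots> = (\<Sum>x\<in>S. \<Sum>y\<in>T. single (x \<otimes>\<^bsub>M\<^esub> y) (lookup f x * lookup g y))"
    by (rule sum.mono_neutral_left) (use assms in \<open>auto simp: in_keys_iff\<close>)
  finally show ?thesis .
qed

lemma monoid_algebra_mult_single:
  "single x a \<otimes>\<^bsub>monoid_algebra M\<^esub> single y b =
    single (x \<otimes>\<^bsub>M\<^esub> y) (a * b)"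
  by (subst monoid_algebra_mult_superset[of "{x}" "{y}"]) auto

lemma monoid_algebra_distrib:
  fixes f g h :: "'a \<Rightarrow>\<^sub>0 'k::comm_ring_1"
  shows "(f + g) \<otimes>\<^bsub>monoid_algebra M\<^esub> h =
      f \<otimes>\<^bsub>monoid_algebra M\<^esub> h + g \<otimes>\<^bsub>monoid_algebra M\<^esub> h"
    "h \<otimes>\<^bsub>monoid_algebra M\<^esub> (f + g) =
      h \<otimes>\<^bsub>monoid_algebra M\<^esub> f + h \<otimes>\<^bsub>monoid_algebra M\<^esub> g"
proof -
  let ?S = "keys f \<union> keys g" and ?T = "keys h"
  have S: "keys (f + g) \<subseteq> ?S" "keys f \<subseteq> ?S" "keys g \<subseteq> ?S"
    "finite ?S" "finite ?T" "?T \<subseteq> ?T"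
    using Poly_Mapping.keys_add[of f g] by auto
  note l = monoid_algebra_mult_superset[OF S(4,5) _ S(6), of _ M]
    and r = monoid_algebra_mult_superset[OF S(5,4,6), of _ M]
  show "(f + g) \<otimes>\<^bsub>monoid_algebra M\<^esub> h =
      f \<otimes>\<^bsub>monoid_algebra M\<^esub> h + g \<otimes>\<^bsub>monoid_algebra M\<^esub> h"
    unfolding l[OF S(1)] l[OF S(2)] l[OF S(3)]
    by (simp only: lookup_add distrib_right single_add sum.distrib)
  show "h \<otimes>\<^bsub>monoid_algebra M\<^esub> (f + g) =
      h \<otimes>\<^bsub>monoid_algebra M\<^esub> f + h \<otimes>\<^bsub>monoid_algebra M\<^esub> g"
    unfolding r[OF S(1)] r[OF S(2)] r[OF S(3)]
    by (simp only: lookup_add distrib_left single_add sum.distrib)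
qed

lemma scale_single: "pm_scale c (single x d) = single x (c * d)"
  for c :: "'k::comm_ring_1"
  by (rule poly_mapping_eqI) (simp add: lookup_scale lookup_single when_def)

lemma scale_sum: "pm_scale c (\<Sum>x\<in>S. p x) = (\<Sum>x\<in>S. pm_scale c (p x))"
  for c :: "'k::comm_ring_1"
  by (rule poly_mapping_eqI) (simp add: lookup_scale lookup_sum sum_distrib_left)

lemma monoid_algebra_scale:
  fixes f g :: "'a \<Rightarrow>\<^sub>0 'k::comm_ring_1"
  shows "pm_scale c f \<otimes>\<^bsub>monoid_algebra M\<^esub> g =
      pm_scale c (f \<otimes>\<^bsub>monoid_algebra M\<^esub> g)"
    "f \<otimes>\<^bsub>monoid_algebra M\<^esub> pm_scale c g =
      pm_scale c (f \<otimes>\<^bsub>monoid_algebra M\<^esub> g)"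
proof -
  let ?S = "keys f" and ?T = "keys g"
  have S: "finite ?S" "finite ?T" "?S \<subseteq> ?S" "?T \<subseteq> ?T" by auto
  note m = monoid_algebra_mult_superset[OF S(1,2), of _ _ M]
  show "pm_scale c f \<otimes>\<^bsub>monoid_algebra M\<^esub> g =
      pm_scale c (f \<otimes>\<^bsub>monoid_algebra M\<^esub> g)"
    unfolding m[OF S(3,4)] m[OF keys_smult_subset S(4)]
    by (simp only: lookup_scale scale_single scale_sum mult.assoc)
  show "f \<otimes>\<^bsub>monoid_algebra M\<^esub> pm_scale c g =
      pm_scale c (f \<otimes>\<^bsub>monoid_algebra M\<^esub> g)"
    unfolding m[OF S(3,4)] m[OF S(3) keys_smult_subset]
    by (simp only: lookup_scale scale_single scale_sum mult.left_commute)
qed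

lemma keys_sum_subset:
  "(\<And>x. x \<in> S \<Longrightarrow> keys (p x) \<subseteq> C) \<Longrightarrow> keys (\<Sum>x\<in>S. p x) \<subseteq> C"
proof (induction S rule: infinite_finite_induct)
  case (insert x F)
  then show ?case using Poly_Mapping.keys_add[of "p x" "sum p F"] by auto
qed auto

lemma kalg_monoid_algebra:
  assumes "Group.monoid M"
  shows "kalg (monoid_algebra M :: ('k::comm_ring_1, 'a \<Rightarrow>\<^sub>0 'k) module)"
proof -
  let ?A = "monoid_algebra M :: ('k, 'a \<Rightarrow>\<^sub>0 'k) module"
  let ?W = "(\<lambda>x. single x (1::'k)) ` carrier M"
  interpret M: Group.monoid M by fact
  interpret A: kmod ?A by (rule kmod_monoid_algebra)
  have W: "?W \<subseteq> carrier ?A" by (auto simp: monoid_algebra_sel)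
  have cl: "f \<otimes>\<^bsub>?A\<^esub> g \<in> carrier ?A" if "f \<in> carrier ?A" "g \<in> carrier ?A" for f g
  proof -
    have "keys f \<subseteq> carrier M" "keys g \<subseteq> carrier M"
      using that by (simp_all add: monoid_algebra_sel)
    moreover from this have "keys (f \<otimes>\<^bsub>?A\<^esub> g) \<subseteq> carrier M"
      unfolding monoid_algebra_def monoid.simps by (intro keys_sum_subset) auto
    ultimately show ?thesis by (simp add: monoid_algebra_sel)
  qed
  have kl: "klinear ?A ?A (\<lambda>f. f \<otimes>\<^bsub>?A\<^esub> g)" "klinear ?A ?A (\<lambda>f. g \<otimes>\<^bsub>?A\<^esub> f)" if "g \<in> carrier ?A" for g
    using that cl by (auto intro!: klinearI simp: monoid_algebra_sel monoid_algebra_distrib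
      monoid_algebra_scale)
  \<comment> \<open>Both sides are linear in each argument. The reduction to basis elements is made
    one argument at a time: the last, then the middle, then the first.\<close>
  have assoc: "(f \<otimes>\<^bsub>?A\<^esub> g) \<otimes>\<^bsub>?A\<^esub> h = f \<otimes>\<^bsub>?A\<^esub> (g \<otimes>\<^bsub>?A\<^esub> h)"
    if f: "f \<in> carrier ?A" and g: "g \<in> carrier ?A" and h: "h \<in> carrier ?A" for f g h
  proof -
    have 1: "(f \<otimes>\<^bsub>?A\<^esub> g) \<otimes>\<^bsub>?A\<^esub> h = f \<otimes>\<^bsub>?A\<^esub> (g \<otimes>\<^bsub>?A\<^esub> h)"
      if fg: "f \<in> ?W" "g \<in> ?W" and h: "h \<in> carrier ?A" for f g h
    proof -
      have c: "f \<in> carrier ?A" "g \<in> carrier ?A" using fg W by auto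
      show ?thesis
        by (rule klinear_eq_on_kspan[OF A.kmod_axioms A.kmod_axioms kl(2)[OF cl[OF c]]
              klinear_compose[OF kl(2)[OF c(2)] kl(2)[OF c(1)]] W _ monoid_algebra_span[OF h]])
          (use fg in \<open>auto simp: monoid_algebra_mult_single M.m_assoc\<close>)
    qed
    have 2: "(f \<otimes>\<^bsub>?A\<^esub> g) \<otimes>\<^bsub>?A\<^esub> h = f \<otimes>\<^bsub>?A\<^esub> (g \<otimes>\<^bsub>?A\<^esub> h)"
      if fg: "f \<in> ?W" "g \<in> carrier ?A" and h: "h \<in> carrier ?A" for f g h
    proof -
      have c: "f \<in> carrier ?A" using fg W by auto
      show ?thesis
        by (rule klinear_eq_on_kspan[OF A.kmod_axioms A.kmod_axioms
              klinear_compose[OF kl(2)[OF c] kl(1)[OF h]] 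
              klinear_compose[OF kl(1)[OF h] kl(2)[OF c]] W _ monoid_algebra_span[OF fg(2)]])
          (use fg 1 h in blast)
    qed
    show ?thesis
      by (rule klinear_eq_on_kspan[OF A.kmod_axioms A.kmod_axioms
            klinear_compose[OF kl(1)[OF g] kl(1)[OF h]] kl(1)[OF cl[OF g h]] W _
              monoid_algebra_span[OF f]])
        (use g h 2 in blast)
  qed
  have one: "\<one>\<^bsub>?A\<^esub> \<in> carrier ?A" by (simp add: monoid_algebra_sel)
  have unit: "\<one>\<^bsub>?A\<^esub> \<otimes>\<^bsub>?A\<^esub> f = f" "f \<otimes>\<^bsub>?A\<^esub> \<one>\<^bsub>?A\<^esub> = f" if f: "f \<in> carrier ?A" for f
    by (rule klinear_eq_on_kspan[OF A.kmod_axioms A.kmod_axioms kl(2)[OF one] klinear_ident W _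
      monoid_algebra_span[OF f]];
        auto simp: monoid_algebra_sel monoid_algebra_mult_single)
      (rule klinear_eq_on_kspan[OF A.kmod_axioms A.kmod_axioms kl(1)[OF one] klinear_ident W _
        monoid_algebra_span[OF f]];
        auto simp: monoid_algebra_sel monoid_algebra_mult_single)
  interpret ring ?A
    by (intro ringI A.abelian_group_axioms monoidI)
      (use cl assoc one unit in \<open>auto simp: monoid_algebra_sel monoid_algebra_distrib\<close>)
  show ?thesis
    by unfold_locales (auto simp: monoid_algebra_sel monoid_algebra_scale)
qed

lemma monoid_word_monoid: "Group.monoid word_monoid"
  by (intro monoidI) (auto simp: word_monoid_def)

lemma kalg_free_algebra: "kalg free_algebra"
  unfolding free_algebra_def by (rule kalg_monoid_algebra[OF monoid_word_monoid])

section \<open>Words in anticommuting letters\<close>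

definition wprod :: "('a, 'z) monoid_scheme \<Rightarrow> ('x \<Rightarrow> 'a) \<Rightarrow> 'x list \<Rightarrow> 'a" where
  "wprod R g w = foldr (\<lambda>x a. g x \<otimes>\<^bsub>R\<^esub> a) w \<one>\<^bsub>R\<^esub>"

lemma wprod_Nil [simp]: "wprod R g [] = \<one>\<^bsub>R\<^esub>"
  and wprod_Cons [simp]: "wprod R g (x # w) = g x \<otimes>\<^bsub>R\<^esub> wprod R g w"
  by (simp_all add: wprod_def)

lemma wprod_map: "wprod R g (map f w) = wprod R (\<lambda>x. g (f x)) w"
  by (induction w) simp_all

lemma wprod_cong: "(\<And>x. x \<in> set w \<Longrightarrow> g x = h x) \<Longrightarrow> wprod R g w = wprod R h w"
  by (induction w) simp_all

context Group.monoid
begin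

lemma wprod_closed [intro]: "(\<And>x. x \<in> set w \<Longrightarrow> g x \<in> carrier G) \<Longrightarrow> wprod G g w \<in> carrier G"
  by (induction w) auto

lemma wprod_append:
  "(\<And>x. x \<in> set u \<union> set w \<Longrightarrow> g x \<in> carrier G) \<Longrightarrow> wprod G g (u @ w) = wprod G g u \<otimes> wprod G g w"
proof (induction u)
  case Nil
  then have "wprod G g w \<in> carrier G" by auto
  then show ?case by simp
next
  case (Cons x u)
  then have "g x \<in> carrier G" "wprod G g u \<in> carrier G" "wprod G g w \<in> carrier G" by auto
  then show ?case using Cons by (simp add: m_assoc)
qed

end

lemma ring_hom_wprod:
  assumes "f \<in> ring_hom A B" "Group.monoid A" "\<And>x. x \<in> set w \<Longrightarrow> g x \<in> carrier A"
  shows "f (wprod A g w) = wprod B (\<lambda>x. f (g x)) w"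
  using assms(3)
proof (induction w)
  case (Cons x w)
  then have "g x \<in> carrier A" "wprod A g w \<in> carrier A"
    by (auto intro!: monoid.wprod_closed[OF assms(2)])
  with Cons show ?case by (simp add: ring_hom_mult[OF assms(1)])
qed (simp add: ring_hom_one[OF assms(1)])

text \<open>Here \<open>r y x\<close> means that y should stand before x, and
  \<open>inversions r w\<close> counts the pairs standing the other way. Letters that
  \<open>r\<close> does not relate contribute nothing, as is required of letters at the same
  place.\<close>

primrec inversions :: "('x \<Rightarrow> 'x \<Rightarrow> bool) \<Rightarrow> 'x list \<Rightarrow> nat" where
  "inversions r [] = 0"
| "inversions r (x # w) = length (filter (\<lambda>y. r y x) w) + inversions r w"

text \<open>Only the swapped pair changes its contribution. With a term on each side, both
  directions are covered without subtraction on naturals.\<close>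

lemma inversions_swap:
  "inversions r (u @ x # y # v) + of_bool (r x y) = inversions r (u @ y # x # v) + of_bool (r y x)"
  by (induction u) auto

primrec opt_letter :: "('a, 'z) ring_scheme \<Rightarrow> ('x \<Rightarrow> 'a) \<Rightarrow> 'x option \<Rightarrow> 'a" where
  "opt_letter R g None = \<zero>\<^bsub>R\<^esub>"
| "opt_letter R g (Some x) = g x"

text \<open>
  \<open>divided_word R g \<sigma> w h\<close> is the sum of the words obtained from \<open>w\<close>
    by replacing \<open>h\<close> of its letters \<open>x\<close> by
  \<open>\<sigma> x\<close>, where \<open>None\<close> stands for 0. The index is an integer so that the recursion has no
  exceptional cases: the value is 0 for negative \<open>h\<close>.
\<close>

primrec divided_word :: "('a, 'z) ring_scheme \<Rightarrow> ('x \<Rightarrow> 'a) \<Rightarrow> ('x \<Rightarrow> 'x option) \<Rightarrow> 'x list \<Rightarrow> int \<Rightarrow> 'a"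
  where
  "divided_word R g \<sigma> [] h = (if h = 0 then \<one>\<^bsub>R\<^esub> else \<zero>\<^bsub>R\<^esub>)"
| "divided_word R g \<sigma> (x # w) h = (g x \<otimes>\<^bsub>R\<^esub> divided_word R g \<sigma> w h) \<oplus>\<^bsub>R\<^esub> (opt_letter R g (\<sigma> x)
  \<otimes>\<^bsub>R\<^esub> divided_word R g \<sigma> w (h - 1))"

section \<open>Words over a family of elements of an algebra\<close>

locale word_alg = kalg A for A :: "('k::comm_ring_1, 'a) module" (structure) +
  fixes g :: "'x \<Rightarrow> 'a"
  assumes g_closed [simp, intro]: "g x \<in> carrier A"
begin

abbreviation wd :: "'x list \<Rightarrow> 'a" where "wd w \<equiv> wprod A g w"

lemma wd_closed [simp, intro]: "wd w \<in> carrier A"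
  by auto

lemma wd_append: "wd (u @ w) = wd u \<otimes> wd w"
  by (rule wprod_append) auto

lemma wd_replace: "wd u = c \<odot> wd v \<Longrightarrow> wd (x @ u @ y) = c \<odot> wd (x @ v @ y)"
  by (simp add: wd_append smult_mult_l smult_mult_r)

lemma opt_letter_closed [simp, intro]: "opt_letter A g a \<in> carrier A"
  by (cases a) auto

lemma divided_word_closed [simp, intro]: "divided_word A g \<sigma> w h \<in> carrier A"
  by (induction w arbitrary: h) auto

lemma divided_word_neg: "h < 0 \<Longrightarrow> divided_word A g \<sigma> w h = \<zero>"
  by (induction w arbitrary: h) auto

lemma divided_word_0: "divided_word A g \<sigma> w 0 = wd w"
  by (induction w) (auto simp: divided_word_neg)

lemma ring_hom_opt_letter:
  assumes "ring B" "f \<in> ring_hom A B"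
  shows "f (opt_letter A g a) = opt_letter B (\<lambda>x. f (g x)) a"
  by (cases a) (auto simp: ring_hom_zero[OF assms(2) ring_axioms assms(1)])

lemma ring_hom_divided_word:
  assumes "ring B" "f \<in> ring_hom A B"
  shows "f (divided_word A g \<sigma> w h) = divided_word B (\<lambda>x. f (g x)) \<sigma> w h"
  by (induction w arbitrary: h)
    (auto simp: ring_hom_zero[OF assms(2) ring_axioms assms(1)] ring_hom_one[OF assms(2)]
      ring_hom_add[OF assms(2)] ring_hom_mult[OF assms(2)] ring_hom_opt_letter[OF assms])

lemma divided_word_prefix_fixed: "\<forall>x\<in>set u. \<sigma> x = None \<Longrightarrow> divided_word A g \<sigma> (u @ w) h =
  wd u \<otimes> divided_word A g \<sigma> w h"
  by (induction u) (auto simp: m_assoc)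

lemma divided_word_snoc:
  "divided_word A g \<sigma> (w @ [x]) h = divided_word A g \<sigma> w h \<otimes> g x \<oplus> divided_word A g \<sigma> w (h - 1)
    \<otimes> opt_letter A g (\<sigma> x)"
  by (induction w arbitrary: h) (auto simp: m_assoc l_distr r_distr a_ac)

lemma divided_word_suffix_fixed: "\<forall>x\<in>set u. \<sigma> x = None \<Longrightarrow> divided_word A g \<sigma> (w @ u) h =
  divided_word A g \<sigma> w h \<otimes> wd u"
proof (induction u rule: rev_induct)
  case (snoc x u)
  have "divided_word A g \<sigma> (w @ u @ [x]) h = divided_word A g \<sigma> (w @ u) h \<otimes> g x"
    using snoc.prems divided_word_snoc[of \<sigma> "w @ u" x h] by simp
  then show ?case using snoc by (simp add: wd_append m_assoc)
qed simp

text \<open>The single replaced letter lies either in \<open>u\<close> or in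
  \<open>w\<close>.\<close>

lemma divided_word_Leibniz_word:
  "divided_word A g \<sigma> (u @ w) 1 = divided_word A g \<sigma> u 1 \<otimes> wd w \<oplus> wd u \<otimes> divided_word A g \<sigma> w 1"
proof (induction u)
  case (Cons x u)
  then show ?case by (simp add: divided_word_0 wd_append r_distr l_distr m_assoc a_assoc)
    (simp add: a_ac)
qed auto

lemma klinear_eq_on_words:
  assumes "\<And>x. x \<in> carrier A \<Longrightarrow> x \<in> kspan A (range wd)" "klinear A B L" "klinear A B L'" "kmod B"
    "\<And>w. L (wd w) = L' (wd w)" "x \<in> carrier A"
  shows "L x = L' x"
  by (rule klinear_eq_on_kspan[OF kmod_axioms assms(4,2,3) _ _ assms(1)[OF assms(6)]])
    (use assms(5) in auto)

text \<open>Linearity in the second argument is asked only when the first is a word: agreement is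
  extended to all second arguments there, and only then to all first arguments.\<close>

lemma bilinear_eq_on_words:
  assumes span: "\<And>x. x \<in> carrier A \<Longrightarrow> x \<in> kspan A (range wd)" and "kmod B"
    and "\<And>y. y \<in> carrier A \<Longrightarrow> klinear A B (\<lambda>x. f x y)" "\<And>y. y \<in> carrier A \<Longrightarrow> klinear A B (\<lambda>x. f' x y)"
    and "\<And>u. klinear A B (f (wd u))" "\<And>u. klinear A B (f' (wd u))"
    and eq: "\<And>u v. f (wd u) (wd v) = f' (wd u) (wd v)" and "x \<in> carrier A" "y \<in> carrier A"
  shows "f x y = f' x y"
proof -
  have "f (wd u) y = f' (wd u) y" for u
    by (rule klinear_eq_on_words[OF span assms(5,6,2) eq assms(9)])
  from klinear_eq_on_words[OF span assms(3)[OF assms(9)] assms(4)[OF assms(9)] assms(2) this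
    assms(8)]
  show ?thesis .
qed

lemma Leibniz_of_words:
  assumes span: "\<And>x. x \<in> carrier A \<Longrightarrow> x \<in> kspan A (range wd)" and L: "klinear A A L"
    and words: "\<And>w. L (wd w) = divided_word A g \<sigma> w 1" and "x \<in> carrier A" "y \<in> carrier A"
  shows "L (x \<otimes> y) = L x \<otimes> y \<oplus> x \<otimes> L y"
proof (rule bilinear_eq_on_words[OF span kmod_axioms _ _ _ _ _ assms(4,5), where
      f = "\<lambda>x y. L (x \<otimes> y)" and f' = "\<lambda>x y. L x \<otimes> y \<oplus> x \<otimes> L y"])
  note id = klinear_ident[of A]
  show "klinear A A (\<lambda>x. L (x \<otimes> y))" if "y \<in> carrier A" for y
    by (rule klinear_compose[OF klinear_mult_r[OF id that] L])
  show "klinear A A (\<lambda>x. L x \<otimes> y \<oplus> x \<otimes> L y)" if "y \<in> carrier A" for y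
    by (intro klinear_plus klinear_mult_r id L that klinear_closed[OF L that])
  show "klinear A A (\<lambda>y. L (wd u \<otimes> y))" for u
    by (rule klinear_compose[OF klinear_mult_l[OF id wd_closed] L])
  show "klinear A A (\<lambda>y. L (wd u) \<otimes> y \<oplus> wd u \<otimes> L y)" for u
    by (intro klinear_plus klinear_mult_l id L klinear_closed[OF L] wd_closed)
  show "L (wd u \<otimes> wd v) = L (wd u) \<otimes> wd v \<oplus> wd u \<otimes> L (wd v)" for u v
    by (simp add: words divided_word_Leibniz_word flip: wd_append)
qed

text \<open>From 1 = 1 1 one gets L(1) = L(1) + L(1).\<close>

lemma Leibniz_one:
  assumes "L \<one> \<in> carrier A" "L (\<one> \<otimes> \<one>) = L \<one> \<otimes> \<one> \<oplus> \<one> \<otimes> L \<one>"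
  shows "L \<one> = \<zero>"
  using assms by (simp add: add.l_cancel_one')

text \<open>The converse of \<open>Leibniz_of_words\<close>. That lemma gives the existence of
  polarizations, this one their uniqueness.\<close>

lemma Leibniz_words:
  assumes "\<And>x. x \<in> carrier A \<Longrightarrow> L x \<in> carrier A"
    and Leibniz: "\<And>x y. x \<in> carrier A \<Longrightarrow> y \<in> carrier A \<Longrightarrow> L (x \<otimes> y) = L x \<otimes> y \<oplus> x \<otimes> L y"
    and "\<And>x. L (g x) = opt_letter A g (\<sigma> x)"
  shows "L (wd w) = divided_word A g \<sigma> w 1"
proof (induction w)
  case Nil
  then show ?case using Leibniz_one[of L] Leibniz[of \<one> \<one>] assms(1) by simp
next
  case (Cons x w)
  then show ?case by (simp add: Leibniz assms(3) divided_word_0 a_comm)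
qed

text \<open>If no letter can be replaced twice, then applying the derivation to a sum over \<open>h\<close>-subsets of
  positions produces every \<open>(h + 1)\<close>-subset \<open>h + 1\<close> times.\<close>

lemma derivation_divided_word:
  assumes L: "klinear A A L"
    and Leibniz: "\<And>x y. x \<in> carrier A \<Longrightarrow> y \<in> carrier A \<Longrightarrow> L (x \<otimes> y) = L x \<otimes> y \<oplus> x \<otimes> L y"
    and letters: "\<And>x. L (g x) = opt_letter A g (\<sigma> x)" and "\<And>x y. \<sigma> x = Some y \<Longrightarrow> \<sigma> y = None"
  shows "L (divided_word A g \<sigma> w h) = of_int (h + 1) \<odot> divided_word A g \<sigma> w (h + 1)"
proof (induction w arbitrary: h)
  case Nil
  have "L \<zero> = \<zero>" "L \<one> = \<zero>"
    using klinear_zero[OF kmod_axioms kmod_axioms L] Leibniz_one[of L] Leibniz[of \<one> \<one>]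
      klinear_closed[OF L] by auto
  \<comment> \<open>For h = -1 the right-hand \<open>divided_word\<close> is the unit, but its
    coefficient h + 1 is 0.\<close>
  then show ?case by (cases "h = - 1") auto
next
  case (Cons x w)
  have "L (opt_letter A g (\<sigma> x)) = \<zero>"
  proof (cases "\<sigma> x")
    case (Some y)
    then show ?thesis using letters[of y] assms(4)[of x y] by simp
  qed (use klinear_zero[OF kmod_axioms kmod_axioms L] in simp)
  \<comment> \<open>The coefficient h + 1 of the words with x replaced splits as 1 + h: one copy
    comes from differentiating an unreplaced x, and h copies from differentiating the tail when x is
    already replaced.\<close>
  moreover have "of_int (h + 1) \<odot> (g x \<otimes> divided_word A g \<sigma> w (h + 1)) \<oplus>
      of_int (h + 1) \<odot> (opt_letter A g (\<sigma> x) \<otimes> divided_word A g \<sigma> w h) =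
      (opt_letter A g (\<sigma> x) \<otimes> divided_word A g \<sigma> w h \<oplus> g x \<otimes> (of_int (h + 1) \<odot> divided_word A g \<sigma>
        w (h + 1)))
      \<oplus> opt_letter A g (\<sigma> x) \<otimes> (of_int h \<odot> divided_word A g \<sigma> w h)"
    by (simp add: smult_l_distr smult_mult_r r_distr a_ac)
  ultimately show ?case
    using Cons[of h] Cons[of "h - 1"]
    by (simp add: klinear_add[OF L] Leibniz letters smult_r_distr)
qed

end

section \<open>Replacement of letters as a sum over sets of positions\<close>

lemma shifted_subsets:
  "{J. J \<subseteq> {..<Suc n} \<and> int (card J) = h} =
    {J. J \<subseteq> {..<n} \<and> int (card J) = h} \<union> insert n ` {J. J \<subseteq> {..<n} \<and> int (card J) = h - 1}"
proof (intro Set.equalityI subsetI)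
  fix J assume J: "J \<in> {J. J \<subseteq> {..<Suc n} \<and> int (card J) = h}"
  then have "finite J" using finite_subset by auto
  show "J \<in> {J. J \<subseteq> {..<n} \<and> int (card J) = h} \<union> insert n ` {J. J \<subseteq> {..<n} \<and> int (card J) = h - 1}"
  proof (cases "n \<in> J")
    case True
    then have "J = insert n (J - {n})" "J - {n} \<subseteq> {..<n}" "int (card (J - {n})) = h - 1"
      using J \<open>finite J\<close> card_Suc_Diff1[OF \<open>finite J\<close> True] by (auto simp: less_Suc_eq)
    then show ?thesis by blast
  next
    case False
    then have "J \<subseteq> {..<n}" using J by (auto simp: less_Suc_eq)
    then show ?thesis using J by auto
  qed
next
  fix J assume "J \<in> {J. J \<subseteq> {..<n} \<and> int (card J) = h} \<union> insert n ` {J. J \<subseteq> {..<n} \<and> int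
    (card J) = h - 1}"
  then show "J \<in> {J. J \<subseteq> {..<Suc n} \<and> int (card J) = h}"
    using finite_subset[OF _ finite_lessThan[of n]] by (auto simp: less_Suc_eq card_insert_if)
qed

context word_alg
begin

definition replace_at :: "('x \<Rightarrow> 'x) \<Rightarrow> 'x list \<Rightarrow> nat set \<Rightarrow> 'x list" where
  "replace_at \<tau> w J = map (\<lambda>p. if p \<in> J then \<tau> (w ! p) else w ! p) [0..<length w]"

text \<open>The induction adds letters at the right end, so that earlier letters keep their
  positions and a set of positions in \<open>w\<close> can be reused in \<open>w @ [x]\<close>. The
  two summands of \<open>divided_word_snoc\<close> correspond to the sets without and with the last
  position.\<close>

lemma divided_word_eq_sum:
  assumes "\<And>x. x \<in> set w \<Longrightarrow> \<sigma> x = Some (\<tau> x)"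
  shows "divided_word A g \<sigma> w h =
    finsum A (\<lambda>J. wd (replace_at \<tau> w J)) {J. J \<subseteq> {..<length w} \<and> int (card J) = h}"
  using assms
proof (induction w arbitrary: h rule: rev_induct)
  case Nil
  have "{J :: nat set. J = {} \<and> int (card J) = h} = (if h = 0 then {{}} else {})" by auto
  then show ?case by (simp add: replace_at_def finsum_singleton)
next
  case (snoc x w)
  let ?n = "length w"
  let ?S = "\<lambda>h. {J. J \<subseteq> {..<?n} \<and> int (card J) = h}"
  have fin: "finite (?S h)" for h by (rule finite_subset[of _ "Pow {..<?n}"]) auto
  have eq: "replace_at \<tau> (w @ [x]) J = replace_at \<tau> w J @ [x]"
    "replace_at \<tau> (w @ [x]) (insert ?n J) = replace_at \<tau> w J @ [\<tau> x]" if "J \<subseteq> {..<?n}" for J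
    using that by (auto simp: replace_at_def nth_append)
  have "divided_word A g \<sigma> (w @ [x]) h = divided_word A g \<sigma> w h \<otimes> g x \<oplus> divided_word A g \<sigma> w
    (h - 1) \<otimes> g (\<tau> x)"
    using snoc.prems by (simp add: divided_word_snoc)
  also have "divided_word A g \<sigma> w h \<otimes> g x = finsum A (\<lambda>J. wd (replace_at \<tau> (w @ [x]) J)) (?S h)"
    using snoc fin by (subst snoc.IH, simp, subst finsum_ldistr)
      (auto intro!: finsum_cong' simp: eq wd_append)
  also have "divided_word A g \<sigma> w (h - 1) \<otimes> g (\<tau> x) =
      finsum A (\<lambda>J. wd (replace_at \<tau> (w @ [x]) (insert ?n J))) (?S (h - 1))"
    using snoc fin by (subst snoc.IH, simp, subst finsum_ldistr)
      (auto intro!: finsum_cong' simp: eq wd_append)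
  also have "\<dots> = finsum A (\<lambda>J. wd (replace_at \<tau> (w @ [x]) J)) (insert ?n ` ?S (h - 1))"
  proof (rule finsum_reindex[symmetric])
    show "inj_on (insert ?n) (?S (h - 1))"
      by (rule inj_onI) (metis (mono_tags, lifting) insert_ident lessThan_iff less_irrefl
        mem_Collect_eq subsetD)
  qed auto
  also have "finsum A (\<lambda>J. wd (replace_at \<tau> (w @ [x]) J)) (?S h) \<oplus>
      finsum A (\<lambda>J. wd (replace_at \<tau> (w @ [x]) J)) (insert ?n ` ?S (h - 1)) =
      finsum A (\<lambda>J. wd (replace_at \<tau> (w @ [x]) J)) (?S h \<union> insert ?n ` ?S (h - 1))"
    using fin by (subst finsum_Un_disjoint) auto
  finally show ?case by (simp add: shifted_subsets)
qed

end

text \<open>Squares are required separately: anticommutation gives only that twice a square is 0,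
  which is weaker over the integers and in characteristic 2.\<close>

locale skew_alg = word_alg A g
  for A :: "('k::comm_ring_1, 'a) module" (structure) and g :: "'x \<Rightarrow> 'a" +
  assumes g_square: "g x \<otimes> g x = \<zero>"
    and g_anti: "g x \<otimes> g y \<oplus> g y \<otimes> g x = \<zero>"
begin

lemma g_swap: "g x \<otimes> g y = (- 1) \<odot> (g y \<otimes> g x)"
  using g_anti[of x y] minus_equality[of "g x \<otimes> g y" "g y \<otimes> g x"] by (simp add: smult_minus_one)

lemma opt_anti:
  "opt_letter A g a \<otimes> opt_letter A g b \<oplus> opt_letter A g b \<otimes> opt_letter A g a = \<zero>"
  by (cases a; cases b) (auto simp: g_anti)

lemma opt_square: "opt_letter A g a \<otimes> opt_letter A g a = \<zero>"
  by (cases a) (auto simp: g_square)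

lemma move_letter: "g x \<otimes> wd u = (- 1) ^ length u \<odot> (wd u \<otimes> g x)"
proof (induction u)
  case (Cons y u)
  have "g x \<otimes> wd (y # u) = (- 1) \<odot> (g y \<otimes> (g x \<otimes> wd u))"
    using g_swap[of x y] smult_mult_l[of "g y \<otimes> g x" "wd u" "-1"]
    by (simp add: m_assoc[symmetric])
  then show ?case by (simp add: Cons smult_mult_r smult_smult m_assoc)
qed simp

lemma move_word: "wd v \<otimes> wd u = (- 1) ^ (length v * length u) \<odot> (wd u \<otimes> wd v)"
proof (induction v)
  case (Cons x v)
  have "wd (x # v) \<otimes> wd u = (- 1) ^ (length v * length u) \<odot> ((g x \<otimes> wd u) \<otimes> wd v)"
    by (simp add: m_assoc Cons smult_mult_r)
  also have "\<dots> = (- 1) ^ (length (x # v) * length u) \<odot> (wd u \<otimes> wd (x # v))"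
    by (simp add: move_letter smult_mult_l smult_smult m_assoc power_add mult.commute)
  finally show ?case .
qed simp

lemma swap_blocks: "wd (x @ u @ v @ y) = (- 1) ^ (length u * length v) \<odot> wd (x @ v @ u @ y)"
  using wd_replace[of "u @ v" _ "v @ u" x y] move_word[of u v] by (simp add: wd_append)

text \<open>Sorted by how many of the two equal letters are replaced, with x' for the replacement of
  x, the terms contain x x, x x' + x' x and x' x', all of them 0. Together with
  \<open>divided_word_anti\<close> this makes the replacement of h letters well defined on a
  skew-symmetric algebra.\<close>

lemma divided_word_square_zero: "divided_word A g \<sigma> (u @ x # x # v) h = \<zero>"
proof (induction u arbitrary: h)
  case Nil
  let ?x = "g x" and ?y = "opt_letter A g (\<sigma> x)" and ?D = "divided_word A g \<sigma> v"
  have "divided_word A g \<sigma> (x # x # v) h = (?x \<otimes> ?x) \<otimes> ?D h \<oplus>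
    ((?x \<otimes> ?y \<oplus> ?y \<otimes> ?x) \<otimes> ?D (h - 1) \<oplus> (?y \<otimes> ?y) \<otimes> ?D (h - 1 - 1))"
    by (simp add: m_assoc r_distr l_distr a_assoc)
  then show ?case using opt_anti[of "Some x" "\<sigma> x"] by (simp add: g_square opt_square)
qed simp

lemma divided_word_anti: "divided_word A g \<sigma> (u @ x # y # v) h \<oplus> divided_word A g \<sigma>
  (u @ y # x # v) h = \<zero>"
proof (induction u arbitrary: h)
  case Nil
  let ?x = "g x" and ?x' = "opt_letter A g (\<sigma> x)" and ?D = "divided_word A g \<sigma> v"
  let ?y = "g y" and ?y' = "opt_letter A g (\<sigma> y)"
  have "divided_word A g \<sigma> (x # y # v) h \<oplus> divided_word A g \<sigma> (y # x # v) h =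
    (?x \<otimes> ?y \<oplus> ?y \<otimes> ?x) \<otimes> ?D h \<oplus> (?x \<otimes> ?y' \<oplus> ?y' \<otimes> ?x) \<otimes> ?D (h - 1) \<oplus>
    (?x' \<otimes> ?y \<oplus> ?y \<otimes> ?x') \<otimes> ?D (h - 1) \<oplus> (?x' \<otimes> ?y' \<oplus> ?y' \<otimes> ?x') \<otimes> ?D (h - 1 - 1)"
    by (simp add: m_assoc r_distr l_distr a_ac)
  then show ?case using opt_anti[of "Some x" "\<sigma> y"] opt_anti[of "\<sigma> x" "Some y"]
    by (simp add: g_anti opt_anti)
next
  case (Cons z u)
  have "divided_word A g \<sigma> ((z # u) @ x # y # v) h \<oplus> divided_word A g \<sigma> ((z # u) @ y # x # v) h =
    g z \<otimes> (divided_word A g \<sigma> (u @ x # y # v) h \<oplus> divided_word A g \<sigma> (u @ y # x # v) h) \<oplus>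
    opt_letter A g (\<sigma> z) \<otimes> (divided_word A g \<sigma> (u @ x # y # v) (h - 1) \<oplus> divided_word A g \<sigma>
      (u @ y # x # v) (h - 1))"
    by (simp add: r_distr a_ac)
  then show ?case by (simp only: Cons) simp
qed

text \<open>Both letters cross the stretch \<open>?v\<close> between them, which gives the same sign
  twice; what remains is the single sign from exchanging the two letters themselves.\<close>

lemma wd_transpose:
  assumes "a < b" "b < n"
  shows "wd (map (\<lambda>i. y (Transposition.transpose a b i)) [0..<n]) = (- 1) \<odot> wd (map y [0..<n])"
proof -
  let ?u = "map y [0..<a]" and ?v = "map y [Suc a..<b]" and ?w = "map y [Suc b..<n]"
  have split: "[0..<n] = [0..<a] @ a # [Suc a..<b] @ b # [Suc b..<n]"
    using assms upt_add_eq_append[of 0 a "n - a"] upt_add_eq_append[of "Suc a" b "n - b"]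
    by (simp add: upt_conv_Cons)
  have "map (\<lambda>i. y (Transposition.transpose a b i)) [0..<n] = ?u @ y b # ?v @ y a # ?w"
    using assms unfolding split by (auto simp: Transposition.transpose_def)
  moreover have "map y [0..<n] = ?u @ y a # ?v @ y b # ?w" unfolding split by simp
  moreover have "g (y b) \<otimes> (wd ?v \<otimes> (g (y a) \<otimes> wd ?w)) =
      (- 1) \<odot> (g (y a) \<otimes> (wd ?v \<otimes> (g (y b) \<otimes> wd ?w)))"
  proof -
    let ?s = "(- 1 :: 'k) ^ length ?v"
    have "g (y b) \<otimes> (wd ?v \<otimes> (g (y a) \<otimes> wd ?w)) = (g (y b) \<otimes> wd ?v) \<otimes> (g (y a) \<otimes> wd ?w)"
      by (simp add: m_assoc)
    also have "\<dots> = ?s \<odot> (wd ?v \<otimes> ((g (y b) \<otimes> g (y a)) \<otimes> wd ?w))"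
      unfolding move_letter[of _ ?v] by (simp add: m_assoc smult_mult_l)
    also have "\<dots> = (- 1) \<odot> (?s \<odot> ((wd ?v \<otimes> g (y a)) \<otimes> (g (y b) \<otimes> wd ?w)))"
      unfolding g_swap[of "y b"] by (simp add: m_assoc smult_mult_l smult_mult_r smult_smult)
    also have "?s \<odot> ((wd ?v \<otimes> g (y a)) \<otimes> (g (y b) \<otimes> wd ?w)) = g (y a) \<otimes> (wd ?v \<otimes> (g (y b) \<otimes> wd ?w))"
    proof -
      have "?s \<odot> ((wd ?v \<otimes> g (y a)) \<otimes> (g (y b) \<otimes> wd ?w)) =
        (?s \<odot> (wd ?v \<otimes> g (y a))) \<otimes> (g (y b) \<otimes> wd ?w)" by (simp add: smult_mult_l)
      also have "\<dots> = (g (y a) \<otimes> wd ?v) \<otimes> (g (y b) \<otimes> wd ?w)" by (simp add: move_letter)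
      finally show ?thesis by (simp add: m_assoc)
    qed
    finally show ?thesis .
  qed
  ultimately show ?thesis by (simp add: wd_append smult_mult_r)
qed

lemma wd_permutes:
  assumes "p permutes {..<n}"
  shows "wd (map (\<lambda>i. y (p i)) [0..<n]) = of_int (sign p) \<odot> wd (map y [0..<n])"
  using assms finite_lessThan
proof (induction arbitrary: y rule: permutes_induct)
  case id
  then show ?case by simp
next
  case (swap a b p)
  have "wd (map (\<lambda>i. y (Transposition.transpose a b i)) [0..<n]) = (- 1) \<odot> wd (map y [0..<n])"
    using swap(1-3) wd_transpose[of a b n y] wd_transpose[of b a n y]
    by (cases "a < b") (auto simp: transpose_commute)
  moreover have "sign (Transposition.transpose a b \<circ> p) = - sign p"
    using swap permutes_imp_permutation[OF finite_lessThan swap(4)]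
    by (simp add: sign_compose permutation_swap_id sign_swap_id)
  \<comment> \<open>The transposition is absorbed into the labelling \<open>y\<close>, for which the
    induction hypothesis was kept general.\<close>
  ultimately show ?case
    using swap(5)[of "\<lambda>i. y (Transposition.transpose a b i)"]
    by (simp add: comp_def smult_minus_one smult_a_inv smult_uminus)
qed

end

section \<open>Quotients of free algebras\<close>

lemma carrier_word_monoid: "carrier word_monoid = UNIV"
  by (simp add: word_monoid_def)

lemma free_algebra_sel:
  "carrier free_algebra = UNIV" "one free_algebra = single [] 1" "zero free_algebra = 0"
  "add free_algebra = (+)" "smult free_algebra = (\<lambda>c. pm_scale c)"
  by (simp_all add: free_algebra_def monoid_algebra_sel word_monoid_def)

lemma free_algebra_mult_single:
  "single u a \<otimes>\<^bsub>free_algebra\<^esub> single v b = single (u @ v) (a * b)"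
  by (simp add: free_algebra_def monoid_algebra_mult_single word_monoid_def)

lemma wprod_gen: "wprod free_algebra gen w = single w 1"
  by (induction w) (simp_all add: free_algebra_sel gen_def free_algebra_mult_single)

lemma free_algebra_span: "p \<in> kspan free_algebra (range (\<lambda>w. single w 1))"
  using monoid_algebra_span[of p word_monoid]
  by (simp add: free_algebra_def monoid_algebra_sel carrier_word_monoid)

lemma klinear_lin_free:
  assumes "kmod B" "f \<in> UNIV \<rightarrow> carrier B"
  shows "klinear free_algebra B (lin B f)"
  unfolding free_algebra_def by (rule klinear_lin) (use assms in \<open>auto simp: word_monoid_def\<close>)

lemma kalg_ideal_Idl_free: "kalg_ideal free_algebra (Idl\<^bsub>free_algebra\<^esub> S)"
proof -
  interpret kalg free_algebra by (rule kalg_free_algebra)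
  show ?thesis
    by (intro kalg_ideal.intro kalg_free_algebra genideal_ideal) (simp add: free_algebra_sel)
qed

abbreviation "free_quot S \<equiv> quot_alg free_algebra (Idl\<^bsub>free_algebra\<^esub> S)"
abbreviation "free_gen S x \<equiv> (Idl\<^bsub>free_algebra\<^esub> S) +>\<^bsub>free_algebra\<^esub> gen x"

lemma free_quot_span:
  assumes "x \<in> carrier (free_quot S)"
  shows "x \<in> kspan (free_quot S)
    (range (wprod (free_quot S) (free_gen S)))"
proof -
  interpret kalg_ideal free_algebra "Idl\<^bsub>free_algebra\<^esub> S" by (rule kalg_ideal_Idl_free)
  have "wprod (free_quot S) (free_gen S) w =
    (Idl\<^bsub>free_algebra\<^esub> S) +>\<^bsub>free_algebra\<^esub> single w 1" for w
    using ring_hom_wprod[OF ring_hom_coset monoid_axioms, of w gen]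
    by (simp add: free_algebra_sel wprod_gen)
  then show ?thesis
    using kspan_quot[OF _ free_algebra_span assms] by (simp add: free_algebra_sel image_image)
qed

text \<open>A linear map is obtained even if \<open>f\<close> is not multiplicative in the word.
  Relations are tested between two words because the ideal is two-sided.\<close>

lemma free_quot_hom:
  fixes S :: "('x list \<Rightarrow>\<^sub>0 'k::comm_ring_1) set" and f :: "'x list \<Rightarrow> 'b"
  assumes "kmod B" "\<And>w. f w \<in> carrier B"
    and "\<And>s u v. s \<in> S \<Longrightarrow> lin B f (single u 1 \<otimes>\<^bsub>free_algebra\<^esub> s \<otimes>\<^bsub>free_algebra\<^esub> single v 1) = \<zero>\<^bsub>B\<^esub>"
  obtains L where "klinear (free_quot S) B L"
    "\<And>w. L (wprod (free_quot S) (free_gen S) w) = f w"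
proof -
  interpret kalg_ideal free_algebra "Idl\<^bsub>free_algebra\<^esub> S" by (rule kalg_ideal_Idl_free)
  interpret B: kmod B by fact
  have f: "f \<in> UNIV \<rightarrow> carrier B" using assms by auto
  have kill: "lin B f x = \<zero>\<^bsub>B\<^esub>" if x: "x \<in> Idl\<^bsub>free_algebra\<^esub> S" for x
  proof (rule klinear_kills_Idl[OF B.kmod_axioms klinear_lin_free[OF assms(1) f] _ _
    free_algebra_span _ x])
  qed (use assms(3) in \<open>auto simp: free_algebra_sel\<close>)
  obtain L where L: "klinear (free_quot S) B L"
    "\<And>x. x \<in> carrier free_algebra \<Longrightarrow> L ((Idl\<^bsub>free_algebra\<^esub> S) +>\<^bsub>free_algebra\<^esub> x) = lin B f x"
    using klinear_descend[OF B.kmod_axioms klinear_lin_free[OF assms(1) f] kill] by blast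
  have "L (wprod (free_quot S) (free_gen S) w) = f w" for w
  proof -
    have "wprod (free_quot S) (free_gen S) w =
      (Idl\<^bsub>free_algebra\<^esub> S) +>\<^bsub>free_algebra\<^esub> single w 1"
      using ring_hom_wprod[OF ring_hom_coset monoid_axioms, of w gen]
      by (simp add: free_algebra_sel wprod_gen)
    then show ?thesis using assms(2) by (simp add: free_algebra_sel L(2) B.lin_single)
  qed
  with L(1) that show thesis by blast
qed

section \<open>The letterplace algebra over the integers\<close>

text \<open>\<open>Skew\<close> with its structure of \<open>\<int>\<close>-module.\<close>

definition SkewM :: "(int, ('v, 'm) skew) module" where
  "SkewM = quot_alg free_algebra skew_ideal"

definition skew_letter :: "'v \<times> 'm \<Rightarrow> ('v, 'm) skew" where
  "skew_letter x = skew_ideal +>\<^bsub>free_algebra\<^esub> gen x"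

abbreviation "skew_word \<equiv> wprod SkewM skew_letter"

lemma lp_eq_skew_letter: "lp v i = skew_letter (v, i)"
  by (simp add: lp_def skew_letter_def)

lemma SkewM_sel:
  "carrier SkewM = carrier Skew" "mult SkewM = mult Skew" "one SkewM = one Skew"
  "zero SkewM = zero Skew" "add SkewM = add Skew"
  by (simp_all add: SkewM_def Skew_def quot_alg_sel)

interpretation Skew: skew_alg "SkewM :: (int, ('v, 'm) skew) module" skew_letter
  rewrites "carrier SkewM = carrier Skew"
proof -
  interpret I: kalg_ideal free_algebra "skew_ideal :: (('v \<times> 'm) list \<Rightarrow>\<^sub>0 int) set"
    unfolding skew_ideal_def by (rule kalg_ideal_Idl_free)
  interpret Q: kalg "SkewM :: (int, ('v, 'm) skew) module"
    unfolding SkewM_def by (rule I.kalg_quot)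
  have c: "gen x \<in> carrier free_algebra" for x :: "'v \<times> 'm" by (simp add: free_algebra_sel)
  have cl: "skew_letter x \<in> carrier SkewM" for x :: "'v \<times> 'm"
    unfolding SkewM_def skew_letter_def by (rule coset_in_carrier[OF c])
  have rel: "p \<in> skew_ideal" if "p \<in> skew_relations" for p :: "('v \<times> 'm) list \<Rightarrow>\<^sub>0 int"
    using that I.genideal_self[of skew_relations] unfolding skew_ideal_def
    by (auto simp: free_algebra_sel)
  have "gen x \<otimes>\<^bsub>free_algebra\<^esub> gen x \<in> skew_ideal"
    "(gen x \<otimes>\<^bsub>free_algebra\<^esub> gen y) \<oplus>\<^bsub>free_algebra\<^esub> (gen y \<otimes>\<^bsub>free_algebra\<^esub> gen x) \<in> skew_ideal"
    for x y :: "'v \<times> 'm"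
    by (rule rel, unfold skew_relations_def, blast)+
  then show "skew_alg (SkewM :: (int, ('v, 'm) skew) module) skew_letter"
    using cl by unfold_locales
      (simp_all add: SkewM_def skew_letter_def I.coset_mult I.coset_add c I.coset_eq_zero_iff)
  show "carrier SkewM = carrier (Skew :: ('v, 'm) skew ring)" by (rule SkewM_sel)
qed

lemma ring_Skew: "ring Skew"
  by (rule ring_cong[OF Skew.ring_axioms]) (simp_all add: SkewM_sel)

lemma Skew_span: "x \<in> carrier Skew \<Longrightarrow> x \<in> kspan SkewM (range skew_word)"
  using free_quot_span[of x skew_relations]
  unfolding SkewM_def skew_letter_def[abs_def] skew_ideal_def[symmetric]
  by (simp add: quot_alg_sel Skew_def)

text \<open>The two conditions on \<open>f\<close> are the defining relations with arbitrary words
  on either side, which is all that \<open>free_quot_hom\<close> tests.\<close>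

lemma Skew_hom:
  fixes f :: "('v \<times> 'm) list \<Rightarrow> 'b"
  assumes "kmod B" "\<And>w. f w \<in> carrier B"
    and "\<And>u v x. f (u @ x # x # v) = \<zero>\<^bsub>B\<^esub>"
    and "\<And>u v x y. f (u @ x # y # v) \<oplus>\<^bsub>B\<^esub> f (u @ y # x # v) = \<zero>\<^bsub>B\<^esub>"
  obtains L where "klinear SkewM B L" "\<And>w. L (skew_word w) = f w"
proof -
  interpret B: kmod B by fact
  interpret F: kalg "free_algebra :: (int, ('v \<times> 'm) list \<Rightarrow>\<^sub>0 int) module"
    by (rule kalg_free_algebra)
  have f: "f \<in> UNIV \<rightarrow> carrier B" using assms by auto
  have lin: "lin B f (p \<oplus>\<^bsub>free_algebra\<^esub> q) = lin B f p \<oplus>\<^bsub>B\<^esub> lin B f q" for p q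
    using klinear_add[OF klinear_lin_free[OF assms(1) f]] by (simp add: free_algebra_sel)
  have eq: "single u 1 \<otimes>\<^bsub>free_algebra\<^esub> (gen x \<otimes>\<^bsub>free_algebra\<^esub> gen y) \<otimes>\<^bsub>free_algebra\<^esub> single v 1 =
    single (u @ x # y # v) (1 :: int)" for u v :: "('v \<times> 'm) list" and x y
    by (simp add: gen_def free_algebra_mult_single)
  have kill: "lin B f (single u 1 \<otimes>\<^bsub>free_algebra\<^esub> s \<otimes>\<^bsub>free_algebra\<^esub> single v 1) = \<zero>\<^bsub>B\<^esub>"
    if s: "s \<in> skew_relations" for s u v
  proof -
    consider x where "s = gen x \<otimes>\<^bsub>free_algebra\<^esub> gen x"
      | x y where "s = (gen x \<otimes>\<^bsub>free_algebra\<^esub> gen y) \<oplus>\<^bsub>free_algebra\<^esub> (gen y \<otimes>\<^bsub>free_algebra\<^esub> gen x)"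
      using s unfolding skew_relations_def by blast
    then show ?thesis
    proof cases
      case 1
      then show ?thesis using assms(2,3) by (simp add: eq B.lin_single)
    next
      case 2
      have "single u 1 \<otimes>\<^bsub>free_algebra\<^esub> s \<otimes>\<^bsub>free_algebra\<^esub> single v 1 =
        single (u @ x # y # v) 1 \<oplus>\<^bsub>free_algebra\<^esub> single (u @ y # x # v) 1"
        unfolding 2 eq[symmetric] by (simp add: F.l_distr F.r_distr free_algebra_sel(1))
      then show ?thesis using assms(2,4) by (simp add: lin B.lin_single)
    qed
  qed
  show thesis
  proof (rule free_quot_hom[where S = skew_relations and f = f, OF assms(1,2) kill])
    fix L
    assume "klinear (free_quot skew_relations) B L"
      "\<And>w. L (wprod (free_quot skew_relations)
      (free_gen skew_relations) w) = f w"
    then show thesis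
      by (intro that[of L]) (simp_all add: SkewM_def skew_letter_def[abs_def] skew_ideal_def)
  qed
qed

subsection \<open>The letterplace algebra has no torsion\<close>

text \<open>Each letter of \<open>u\<close> forms an inversion with x in exactly one of the two
  positions of x, so the two counts differ by the length of \<open>u\<close> modulo 2.\<close>

lemma inversions_move:
  assumes "x \<notin> set u" "\<And>y. y \<in> set u \<Longrightarrow> r x y \<longleftrightarrow> \<not> r y x"
  shows "even (inversions r (u @ x # v) + length u + inversions r (x # u @ v))"
  using assms
proof (induction u)
  case (Cons y u)
  then have "r x y \<longleftrightarrow> \<not> r y x" by simp
  then show ?case using Cons by (cases "r x y") auto
qed simp

text \<open>Bringing the first letter x of \<open>w\<close> to the front of
  \<open>w' = u @ x # v\<close> costs the sign (-1) to the length of \<open>u\<close> by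
  anticommutation, and the parity of inversions changes by the same length. The signs cancel, and
  the tails are compared by induction.\<close>

lemma (in skew_alg) signed_word_eq:
  assumes order: "\<And>x y. x \<noteq> y \<Longrightarrow> r x y \<longleftrightarrow> \<not> r y x"
    and "distinct w" "distinct w'" "set w = set w'"
  shows "(- 1) ^ inversions r w \<odot> wd w = (- 1) ^ inversions r w' \<odot> wd w'"
  using assms(2-)
proof (induction w arbitrary: w')
  case (Cons x t)
  then obtain u v where w': "w' = u @ x # v" by (metis list.set_intros(1) split_list)
  have uv: "distinct (u @ v)" "set t = set (u @ v)" "x \<notin> set u" using Cons.prems w' by auto
  have "length (filter (\<lambda>y. r y x) t) = card ({y \<in> set t. r y x})"
    using Cons.prems by (simp add: distinct_card[symmetric])
  also have "\<dots> = length (filter (\<lambda>y. r y x) (u @ v))"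
    unfolding uv(2) set_filter[symmetric] by (rule distinct_card[OF distinct_filter[OF uv(1)]])
  finally have len: "length (filter (\<lambda>y. r y x) t) = length (filter (\<lambda>y. r y x) (u @ v))" .
  have "even (inversions r w' + length u + inversions r (x # u @ v))"
    unfolding w' by (rule inversions_move[OF uv(3)]) (use uv(3) order in metis)
  then have sign: "(- 1 :: 'k) ^ inversions r w' = (- 1) ^ (inversions r (x # u @ v) + length u)"
    by (auto simp: minus_one_power_iff)
  have move: "wd w' = (- 1) ^ length u \<odot> wd (x # u @ v)"
  proof -
    have "(- 1) ^ length u \<odot> (g x \<otimes> wd u) = wd u \<otimes> g x"
      unfolding move_letter by (simp add: smult_smult power_mult_distrib[symmetric])
    then have "wd w' = ((- 1) ^ length u \<odot> (g x \<otimes> wd u)) \<otimes> wd v" by (simp add: w' wd_append m_assoc)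
    then show ?thesis by (simp add: wd_append smult_mult_l m_assoc)
  qed
  have "(- 1) ^ inversions r w' \<odot> wd w' =
      (- 1) ^ length (filter (\<lambda>y. r y x) (u @ v)) \<odot> (g x \<otimes> ((- 1) ^ inversions r (u @ v) \<odot> wd
        (u @ v)))"
    unfolding sign move
    by (simp add: smult_smult smult_mult_r power_add mult.assoc power_mult_distrib[symmetric])
  also have "\<dots> = (- 1) ^ length (filter (\<lambda>y. r y x) t) \<odot> (g x \<otimes> ((- 1) ^ inversions r t \<odot> wd t))"
    unfolding len using Cons.IH[of "u @ v"] Cons.prems uv by simp
  also have "\<dots> = (- 1) ^ inversions r (x # t) \<odot> wd (x # t)"
    by (simp add: smult_smult smult_mult_r power_add)
  finally show ?case by simp
qed simp

text \<open>The signed normal form of words defines a linear section \<open>L\<close> of the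
  projection from the free algebra onto \<open>Skew\<close>. From n x = 0 follows n (L x) = 0; the
  coefficients of \<open>L x\<close> are integers, so \<open>L x = 0\<close>, and projecting back
  gives x = 0.\<close>

lemma Skew_torsion_free:
  fixes x :: "('v, 'm) skew"
  assumes "x \<in> carrier Skew" "n \<odot>\<^bsub>SkewM\<^esub> x = \<zero>\<^bsub>SkewM\<^esub>" "n \<noteq> 0"
  shows "x = \<zero>\<^bsub>SkewM\<^esub>"
proof -
  let ?F = "free_algebra :: (int, ('v \<times> 'm) list \<Rightarrow>\<^sub>0 int) module"
  interpret I: kalg_ideal ?F skew_ideal unfolding skew_ideal_def by (rule kalg_ideal_Idl_free)
  obtain R :: "(('v \<times> 'm) \<times> ('v \<times> 'm)) set" where R: "well_order_on UNIV R"
    using well_order_on by blast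
  define r where "r x y \<longleftrightarrow> (x, y) \<in> R \<and> x \<noteq> y" for x y
  have order: "r x y \<longleftrightarrow> \<not> r y x" if "x \<noteq> y" for x y
    using R that unfolding r_def well_order_on_def linear_order_on_def partial_order_on_def
      total_on_def antisym_def by blast
  have irr: "\<not> r x x" for x by (simp add: r_def)
  \<comment> \<open>One arrangement is chosen for each finite set of letters. It need not be sorted,
    since \<open>N\<close> measures signs relative to it.\<close>
  define c where "c S = (SOME l :: ('v \<times> 'm) list. distinct l \<and> set l = S)" for S
  have c: "distinct (c (set w))" "set (c (set w)) = set w" for w
    using someI_ex[of "\<lambda>l. distinct l \<and> set l = set w"] finite_distinct_list[of "set w"]
    by (auto simp: c_def)
  \<comment> \<open>Adding the two inversion counts gives the sign of the rearrangement that takes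
    \<open>w\<close> to the chosen arrangement of its letters.\<close>
  define N where "N w = (if distinct w then
    single (c (set w)) ((- 1) ^ (inversions r w + inversions r (c (set w)))) else
      (0 :: _ \<Rightarrow>\<^sub>0 int))" for w
  have anti: "N (u @ x # y # v) \<oplus>\<^bsub>?F\<^esub> N (u @ y # x # v) = \<zero>\<^bsub>?F\<^esub>" for u v x y
  proof (cases "distinct (u @ x # y # v)")
    case True
    then have "x \<noteq> y" "distinct (u @ y # x # v)" by auto
    moreover have "set (u @ y # x # v) = set (u @ x # y # v)" by auto
    moreover have "(- 1 :: int) ^ inversions r (u @ y # x # v) =
      - ((- 1) ^ inversions r (u @ x # y # v))"
    proof -
      have "Suc (inversions r (u @ x # y # v)) = inversions r (u @ y # x # v) \<or>
        inversions r (u @ x # y # v) = Suc (inversions r (u @ y # x # v))"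
        using inversions_swap[of r u x y v] order[OF \<open>x \<noteq> y\<close>] by (cases "r x y") auto
      then show ?thesis
      proof
        assume "Suc (inversions r (u @ x # y # v)) = inversions r (u @ y # x # v)"
        from this[symmetric] show ?thesis by (simp only: power_Suc mult_minus1)
      next
        assume "inversions r (u @ x # y # v) = Suc (inversions r (u @ y # x # v))"
        then show ?thesis by (simp only: power_Suc mult_minus1 minus_minus)
      qed
    qed
    ultimately have "N (u @ y # x # v) = - N (u @ x # y # v)"
      using True by (simp only: N_def if_True power_add mult_minus_left single_uminus)
    then show ?thesis by (simp add: free_algebra_sel)
  next
    case False
    then have "\<not> distinct (u @ y # x # v)" by auto
    then have "N (u @ x # y # v) = 0" "N (u @ y # x # v) = 0"
      using False unfolding N_def by (simp_all only: if_False)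
    then show ?thesis by (simp add: free_algebra_sel)
  qed
  have sq: "N (u @ x # x # v) = \<zero>\<^bsub>?F\<^esub>" for u v x
    by (simp add: N_def free_algebra_sel)
  obtain L where L: "klinear SkewM ?F L" "\<And>w. L (skew_word w) = N w"
    using Skew_hom[of ?F N, OF I.kmod_axioms _ sq anti] by (auto simp: free_algebra_sel)
  have word: "skew_ideal +>\<^bsub>?F\<^esub> single w 1 = skew_word w" for w
    using ring_hom_wprod[OF I.ring_hom_coset I.monoid_axioms, of w gen]
    by (simp add: free_algebra_sel wprod_gen SkewM_def skew_letter_def[abs_def])
  have smult: "skew_ideal +>\<^bsub>?F\<^esub> (a \<odot>\<^bsub>?F\<^esub> single w 1) = a \<odot>\<^bsub>SkewM\<^esub> skew_word w" for a w
  proof -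
    have "single w 1 \<in> carrier ?F" by (simp add: free_algebra_sel)
    from I.coset_smult[OF this, symmetric] show ?thesis by (simp only: word flip: SkewM_def)
  qed
  have retract: "skew_ideal +>\<^bsub>?F\<^esub> L y = y" if y: "y \<in> carrier Skew" for y
  proof (rule klinear_eq_on_kspan[OF Skew.kmod_axioms Skew.kmod_axioms _ klinear_ident _ _
    Skew_span[OF y]])
    show "klinear SkewM SkewM (\<lambda>y. skew_ideal +>\<^bsub>?F\<^esub> L y)"
      using klinear_compose[OF L(1) I.klinear_coset] by (simp add: SkewM_def)
    show "range skew_word \<subseteq> carrier SkewM" by (auto simp: SkewM_sel)
    fix y :: "('v, 'm) skew" assume "y \<in> range skew_word"
    then obtain w where w: "y = skew_word w" by auto
    show "skew_ideal +>\<^bsub>?F\<^esub> L y = y"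
    proof (cases "distinct w")
      case True
      have N: "N w = (- 1) ^ (inversions r w + inversions r (c (set w))) \<odot>\<^bsub>?F\<^esub> single (c (set w)) 1"
        using True by (simp add: N_def free_algebra_sel scale_single)
      have "skew_ideal +>\<^bsub>?F\<^esub> N w =
        (- 1) ^ inversions r w \<odot>\<^bsub>SkewM\<^esub> ((- 1) ^ inversions r (c (set w)) \<odot>\<^bsub>SkewM\<^esub> skew_word
          (c (set w)))"
        unfolding N smult by (simp add: Skew.smult_smult power_add)
      also have "\<dots> = (- 1) ^ inversions r w \<odot>\<^bsub>SkewM\<^esub> ((- 1) ^ inversions r w \<odot>\<^bsub>SkewM\<^esub> skew_word w)"
        by (rule arg_cong[OF Skew.signed_word_eq[OF order c(1) True c(2)]])
      also have "\<dots> = skew_word w"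
        by (simp add: Skew.smult_smult power_mult_distrib[symmetric])
      finally show ?thesis by (simp add: w L)
    next
      case False
      then obtain xs ys zs a where "w = xs @ [a] @ ys @ [a] @ zs" using not_distinct_decomp by blast
      then have eq: "w = xs @ a # ys @ a # zs" by simp
      \<comment> \<open>The first of the two equal letters is moved next to the second, where the
        square vanishes.\<close>
      have "skew_word (a # ys @ a # zs) = skew_letter a \<otimes>\<^bsub>SkewM\<^esub> skew_word ys \<otimes>\<^bsub>SkewM\<^esub>
        (skew_letter a \<otimes>\<^bsub>SkewM\<^esub> skew_word zs)"
        by (simp add: Skew.wd_append Skew.m_assoc)
      also have "\<dots> = (- 1) ^ length ys \<odot>\<^bsub>SkewM\<^esub> (skew_word ys \<otimes>\<^bsub>SkewM\<^esub>
        ((skew_letter a \<otimes>\<^bsub>SkewM\<^esub> skew_letter a) \<otimes>\<^bsub>SkewM\<^esub> skew_word zs))"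
        unfolding Skew.move_letter[of a ys] by (simp add: Skew.smult_mult_l Skew.m_assoc)
      also have "\<dots> = \<zero>\<^bsub>SkewM\<^esub>" by (simp add: Skew.g_square)
      finally have "skew_word w = \<zero>\<^bsub>SkewM\<^esub>"
        unfolding eq Skew.wd_append by simp
      moreover have "skew_ideal +>\<^bsub>?F\<^esub> N w = \<zero>\<^bsub>SkewM\<^esub>"
        using False I.coset_zero by (simp add: N_def SkewM_def free_algebra_sel)
      ultimately show ?thesis unfolding w L(2) by simp
    qed
  qed
  have "n \<odot>\<^bsub>?F\<^esub> L x = \<zero>\<^bsub>?F\<^esub>"
    using klinear_smult[OF L(1), of x n] klinear_zero[OF Skew.kmod_axioms I.kmod_axioms L(1)] assms
    by (simp add: SkewM_sel)
  then have "L x = 0"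
    using assms(3) by (auto simp: free_algebra_sel poly_mapping_eq_iff lookup_scale fun_eq_iff)
  then show ?thesis using retract[OF assms(1)] I.coset_zero
    by (simp add: free_algebra_sel SkewM_def)
qed

subsection \<open>Place polarizations\<close>

text \<open>The effect of D_{ji} on a letter. The arguments are the source place and then the target
  place, opposite to the order in \<open>polarization j i\<close>.\<close>

definition place_subst :: "'m \<Rightarrow> 'm \<Rightarrow> 'v \<times> 'm \<Rightarrow> ('v \<times> 'm) option" where
  "place_subst i j x = (if snd x = i then Some (fst x, j) else None)"

text \<open>The integers are generated by 1 under addition and negation.
  \<open>additive_endo\<close> and \<open>derivation\<close> ask only for additivity; this turns
  their instances over \<open>Skew\<close> into linear maps.\<close>

lemma additive_int_klinear:
  fixes A :: "(int, 'a) module" and B :: "(int, 'b) module"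
  assumes "kmod A" "kmod B" "f \<in> carrier A \<rightarrow> carrier B"
    and add: "\<And>x y. x \<in> carrier A \<Longrightarrow> y \<in> carrier A \<Longrightarrow> f (x \<oplus>\<^bsub>A\<^esub> y) = f x \<oplus>\<^bsub>B\<^esub> f y"
  shows "klinear A B f"
proof -
  interpret A: kmod A by fact
  interpret B: kmod B by fact
  have cl: "f x \<in> carrier B" if "x \<in> carrier A" for x using assms(3) that by auto
  have "f \<zero>\<^bsub>A\<^esub> = \<zero>\<^bsub>B\<^esub>"
    using add[of "\<zero>\<^bsub>A\<^esub>" "\<zero>\<^bsub>A\<^esub>"] cl[of "\<zero>\<^bsub>A\<^esub>"] by (simp add: B.add.l_cancel_one')
  moreover have "f (c \<odot>\<^bsub>A\<^esub> x) \<oplus>\<^bsub>B\<^esub> f ((- c) \<odot>\<^bsub>A\<^esub> x) = f \<zero>\<^bsub>A\<^esub>" if "x \<in> carrier A" for c x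
    using that add[of "c \<odot>\<^bsub>A\<^esub> x" "(- c) \<odot>\<^bsub>A\<^esub> x"] A.smult_l_distr[of x c "- c"] by simp
  ultimately have neg: "f ((- c) \<odot>\<^bsub>A\<^esub> x) = \<ominus>\<^bsub>B\<^esub> f (c \<odot>\<^bsub>A\<^esub> x)" if "x \<in> carrier A" for c x
    using that cl by (intro B.minus_equality[symmetric]) (auto simp: B.a_comm)
  have nat: "f (int n \<odot>\<^bsub>A\<^esub> x) = int n \<odot>\<^bsub>B\<^esub> f x" if "x \<in> carrier A" for n x
    using that cl \<open>f \<zero>\<^bsub>A\<^esub> = \<zero>\<^bsub>B\<^esub>\<close>
    by (induction n) (simp_all add: A.smult_l_distr B.smult_l_distr add)
  have "f (c \<odot>\<^bsub>A\<^esub> x) = c \<odot>\<^bsub>B\<^esub> f x" if "x \<in> carrier A" for c x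
    using that cl by (cases c rule: int_cases2) (simp_all add: neg nat B.smult_uminus)
  then show ?thesis using cl add by (intro klinearI) auto
qed

text \<open>One operator for every index h and all places, equal ones included, since replacing
  letters involves no division. Index 1 is the polarization; for distinct places the other indices
  give the divided powers.\<close>

lemma Skew_operators:
  obtains E :: "int \<Rightarrow> ('v, 'm) skew \<Rightarrow> ('v, 'm) skew" where "\<And>h. klinear SkewM SkewM (E h)"
    "\<And>h. E h \<in> extensional (carrier Skew)"
    "\<And>h w. E h (skew_word w) = divided_word SkewM skew_letter (place_subst i j) w h"
proof -
  have "\<exists>L :: ('v, 'm) skew \<Rightarrow> ('v, 'm) skew. klinear SkewM SkewM L \<and> (\<forall>w. L (skew_word w) =
    divided_word SkewM skew_letter (place_subst i j) w h)"
    for h :: int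
  proof (rule Skew_hom)
    show "kmod (SkewM :: (int, ('v, 'm) skew) module)" by (rule Skew.kmod_axioms)
    show "divided_word SkewM skew_letter (place_subst i j) w h \<in> carrier SkewM"
      for w :: "('v \<times> 'm) list"
      by (simp add: SkewM_sel)
    show "divided_word SkewM skew_letter (place_subst i j) (u @ x # x # v) h = \<zero>\<^bsub>SkewM\<^esub>" for u v
      and x :: "'v \<times> 'm"
      by (rule Skew.divided_word_square_zero)
    show "divided_word SkewM skew_letter (place_subst i j) (u @ x # y # v) h \<oplus>\<^bsub>SkewM\<^esub>
      divided_word SkewM skew_letter (place_subst i j) (u @ y # x # v) h = \<zero>\<^bsub>SkewM\<^esub>" for u v
        and x y :: "'v \<times> 'm"
      by (rule Skew.divided_word_anti)
  qed (rule exI, rule conjI, assumption, rule allI, simp)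
  then obtain E :: "int \<Rightarrow> ('v, 'm) skew \<Rightarrow> ('v, 'm) skew" where E: "\<And>h :: int. klinear SkewM SkewM
    (E h)"
    "\<And>h w. E h (skew_word w) = divided_word SkewM skew_letter (place_subst i j) w h"
    by metis
  show thesis
  proof (rule that[of "\<lambda>h. restrict (E h) (carrier Skew)"])
    show "klinear SkewM SkewM (restrict (E h) (carrier Skew))" for h
      by (rule klinear_cong[OF E(1) _ Skew.kmod_axioms]) (simp add: SkewM_sel)
  qed (simp_all add: E(2))
qed

lemma Skew_eqI:
  fixes f g :: "('v, 'm) skew \<Rightarrow> ('v, 'm) skew"
  assumes "klinear SkewM SkewM f" "klinear SkewM SkewM g"
    and "f \<in> extensional (carrier Skew)" "g \<in> extensional (carrier Skew)"
    and "\<And>w. f (skew_word w) = g (skew_word w)"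
  shows "f = g"
proof (rule extensionalityI[OF assms(3,4)])
  fix x :: "('v, 'm) skew" assume x: "x \<in> carrier Skew"
  show "f x = g x"
    by (rule klinear_eq_on_kspan[OF Skew.kmod_axioms Skew.kmod_axioms assms(1,2) _ _ Skew_span[OF
      x]])
      (auto simp: assms(5) SkewM_sel)
qed

section \<open>Polarizations and divided powers as the unique operators of their kind\<close>

lemma derivation_SkewM:
  "derivation Skew d \<longleftrightarrow> d \<in> extensional (carrier Skew) \<and> klinear SkewM SkewM d \<and>
    (\<forall>x\<in>carrier Skew. \<forall>y\<in>carrier Skew.
      d (x \<otimes>\<^bsub>SkewM\<^esub> y) = (d x \<otimes>\<^bsub>SkewM\<^esub> y) \<oplus>\<^bsub>SkewM\<^esub> (x \<otimes>\<^bsub>SkewM\<^esub> d y))"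
proof -
  have "additive_endo Skew d \<longleftrightarrow> d \<in> extensional (carrier Skew) \<and> klinear SkewM SkewM d"
    using additive_int_klinear[OF Skew.kmod_axioms Skew.kmod_axioms, of d]
    by (auto simp: additive_endo_def SkewM_sel klinear_def)
  then show ?thesis by (simp add: derivation_def SkewM_sel)
qed

lemma polarization_eqI:
  fixes E :: "('v, 'm) skew \<Rightarrow> ('v, 'm) skew"
  assumes E: "klinear SkewM SkewM E" "E \<in> extensional (carrier Skew)"
    "\<And>w. E (skew_word w) = divided_word SkewM skew_letter (place_subst i j) w 1"
  shows "polarization j i = E"
  unfolding polarization_def
proof (rule the_equality, intro conjI allI)
  show "derivation Skew E"
    unfolding derivation_SkewM using E Skew.Leibniz_of_words[OF Skew_span E(1,3)]
    by (auto simp: SkewM_sel)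
  show "E (lp v k) = (if k = i then lp v j else \<zero>\<^bsub>Skew\<^esub>)" for v k
    using E(3)[of "[(v, k)]"] Skew.g_closed[of "(v, k)"] Skew.g_closed[of "(v, j)"]
    by (simp add: lp_eq_skew_letter place_subst_def SkewM_sel Skew.divided_word_0 flip:
      SkewM_sel(2-))
next
  fix d :: "('v, 'm) skew \<Rightarrow> ('v, 'm) skew"
  assume d: "derivation Skew d \<and> (\<forall>v k. d (lp v k) = (if k = i then lp v j else \<zero>\<^bsub>Skew\<^esub>))"
  then have dd: "d \<in> extensional (carrier Skew)" "klinear SkewM SkewM d"
    "\<And>x y. x \<in> carrier Skew \<Longrightarrow> y \<in> carrier Skew \<Longrightarrow>
      d (x \<otimes>\<^bsub>SkewM\<^esub> y) = (d x \<otimes>\<^bsub>SkewM\<^esub> y) \<oplus>\<^bsub>SkewM\<^esub> (x \<otimes>\<^bsub>SkewM\<^esub> d y)"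
    unfolding derivation_SkewM by auto
  have "d (skew_letter x) = opt_letter SkewM skew_letter (place_subst i j x)" for x
    using d by (cases x) (simp add: lp_eq_skew_letter place_subst_def SkewM_sel)
  from Skew.Leibniz_words[of d, OF _ dd(3) this] klinear_closed[OF dd(2)]
  have "d (skew_word w) = divided_word SkewM skew_letter (place_subst i j) w 1" for w
    by (simp add: SkewM_sel)
  then show "d = E" using Skew_eqI[OF dd(2) E(1) dd(1) E(2)] E(3) by simp
qed

lemma polarization_words:
  fixes i j :: 'm and w :: "('v \<times> 'm) list"
  defines "D \<equiv> (polarization j i :: ('v, 'm) skew \<Rightarrow> ('v, 'm) skew)"
  shows  "klinear SkewM SkewM D" "D \<in> extensional (carrier Skew)"
  "D (skew_word w) = divided_word SkewM skew_letter (place_subst i j) w 1"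
proof -
  obtain E :: "int \<Rightarrow> ('v, 'm) skew \<Rightarrow> ('v, 'm) skew" where E: "\<And>h. klinear SkewM SkewM (E h)"
    "\<And>h. E h \<in> extensional (carrier Skew)"
    "\<And>h w. E h (skew_word w) = divided_word SkewM skew_letter (place_subst i j) w h"
    using Skew_operators[of i j] by blast
  from polarization_eqI[OF E(1,2) E(3)[of 1]] E
  show "klinear SkewM SkewM D" "D \<in> extensional (carrier Skew)"
    "D (skew_word w) = divided_word SkewM skew_letter (place_subst i j) w 1"
    by (auto simp: D_def)
qed

lemma add_pow_SkewM:
  assumes "x \<in> carrier Skew"
  shows "[n] \<cdot>\<^bsub>Skew\<^esub> x = int n \<odot>\<^bsub>SkewM\<^esub> x"
proof -
  interpret S: ring Skew by (rule ring_Skew)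
  show ?thesis
  proof (induction n)
    case 0
    then show ?case using assms by (simp add: SkewM_sel)
  next
    case (Suc n)
    then show ?case using assms Skew.smult_l_distr[of x "int n" 1]
      by (simp add: S.add.nat_pow_Suc SkewM_sel add.commute)
  qed
qed

text \<open>Iterating \<open>derivation_divided_word\<close> from index 0 multiplies by 1, 2, ...,
  h, so D^h is h! times the operator that replaces h letters. That operator is the only quotient by
  h!, because the difference of two such quotients would be a torsion element at every
  argument.\<close>

lemma divided_power_words:
  fixes i j :: 'm and h :: nat
  assumes "i \<noteq> j"
  defines "E \<equiv> (divided_power Skew (polarization j i) h :: ('v, 'm) skew \<Rightarrow> ('v, 'm) skew)"
  shows "klinear SkewM SkewM E" "E \<in> extensional (carrier Skew)"
    "E (skew_word w) = divided_word SkewM skew_letter (place_subst i j) w (int h)"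
proof -
  let ?D = "polarization j i :: ('v, 'm) skew \<Rightarrow> ('v, 'm) skew"
  obtain F :: "int \<Rightarrow> ('v, 'm) skew \<Rightarrow> ('v, 'm) skew" where F: "\<And>h. klinear SkewM SkewM (F h)"
    "\<And>h. F h \<in> extensional (carrier Skew)"
    "\<And>h w. F h (skew_word w) = divided_word SkewM skew_letter (place_subst i j) w h"
    using Skew_operators[of i j] by blast
  note D = polarization_words[of j i]
  have Leib: "?D (x \<otimes>\<^bsub>SkewM\<^esub> y) = (?D x \<otimes>\<^bsub>SkewM\<^esub> y) \<oplus>\<^bsub>SkewM\<^esub> (x \<otimes>\<^bsub>SkewM\<^esub> ?D y)"
    if "x \<in> carrier Skew" "y \<in> carrier Skew" for x y
    by (rule Skew.Leibniz_of_words[OF Skew_span D(1,3) that])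
  have letter: "?D (skew_letter x) = opt_letter SkewM skew_letter (place_subst i j x)" for x
    using D(3)[of "[x]"] by (simp add: Skew.divided_word_0)
  have step: "?D (divided_word SkewM skew_letter (place_subst i j) w h) =
    (h + 1) \<odot>\<^bsub>SkewM\<^esub> divided_word SkewM skew_letter (place_subst i j) w (h + 1)"
    for w h
  proof -
    \<comment> \<open>Because the places differ, a letter already moved to j is not moved
      again.\<close>
    have "place_subst i j y = None" if "place_subst i j x = Some y" for x y :: "'v \<times> 'm"
      using that assms(1) by (auto simp: place_subst_def split: if_splits)
      from Skew.derivation_divided_word[OF D(1) Leib letter this, where w = w
        and h = h] show ?thesis by simp
  qed
  have pow_linear: "klinear SkewM SkewM (?D ^^ n)" for n
    by (induction n) (use klinear_compose[OF _ D(1)] klinear_ident in \<open>auto simp: comp_def id_def\<close>)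
  have pow_word: "(?D ^^ n) (skew_word w) = fact n \<odot>\<^bsub>SkewM\<^esub> divided_word SkewM skew_letter
    (place_subst i j) w (int n)" for n w
  proof (induction n)
    case (Suc n)
    then show ?case using step[of w "int n"]
      by (simp add: klinear_smult[OF D(1)] SkewM_sel(1) Skew.smult_smult algebra_simps)
  qed (simp add: Skew.divided_word_0)
  have pow: "(?D ^^ n) x = fact n \<odot>\<^bsub>SkewM\<^esub> F (int n) x" if "x \<in> carrier Skew" for n x
  proof (rule Skew.klinear_eq_on_words[OF Skew_span pow_linear Skew.klinear_scale[OF F(1)]
    Skew.kmod_axioms _ that])
    show "(?D ^^ n) (skew_word w) = fact n \<odot>\<^bsub>SkewM\<^esub> F (int n) (skew_word w)" for w
      unfolding pow_word F(3) ..
  qed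
  have endo: "additive_endo Skew e \<longleftrightarrow> e \<in> extensional (carrier Skew) \<and> klinear SkewM SkewM e"
    for e :: "('v, 'm) skew \<Rightarrow> ('v, 'm) skew"
    using additive_int_klinear[OF Skew.kmod_axioms Skew.kmod_axioms, of e]
    by (auto simp: additive_endo_def SkewM_sel klinear_def)
  have "E = F (int h)"
    unfolding E_def divided_power_def
  proof (rule the_equality, intro conjI ballI)
    show "additive_endo Skew (F (int h))" using F(1,2) endo by blast
    show "[(fact h :: nat)] \<cdot>\<^bsub>Skew\<^esub> F (int h) x = (?D ^^ h) x" if "x \<in> carrier Skew" for x
      using that klinear_closed[OF F(1), of x] by (simp add: add_pow_SkewM pow SkewM_sel)
  next
    fix e :: "('v, 'm) skew \<Rightarrow> ('v, 'm) skew"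
    assume e: "additive_endo Skew e \<and> (\<forall>x\<in>carrier Skew. [(fact h :: nat)] \<cdot>\<^bsub>Skew\<^esub> e x =
      (?D ^^ h) x)"
    then have el: "e \<in> extensional (carrier Skew)" "klinear SkewM SkewM e" using endo by auto
    show "e = F (int h)"
    proof (rule extensionalityI[OF el(1) F(2)])
      fix x :: "('v, 'm) skew" assume x: "x \<in> carrier Skew"
      then have c: "e x \<in> carrier Skew" "F (int h) x \<in> carrier Skew"
        using klinear_closed[OF el(2), of x] klinear_closed[OF F(1), of x] by (auto simp: SkewM_sel)
      have "fact h \<odot>\<^bsub>SkewM\<^esub> e x = fact h \<odot>\<^bsub>SkewM\<^esub> F (int h) x"
        using bspec[OF conjunct2[OF e] x] add_pow_SkewM[OF c(1), of "fact h"] pow[OF x, of h]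
        by (metis of_nat_fact)
      then have "fact h \<odot>\<^bsub>SkewM\<^esub> (e x \<ominus>\<^bsub>SkewM\<^esub> F (int h) x) = \<zero>\<^bsub>SkewM\<^esub>"
        using c by (simp add: a_minus_def Skew.smult_r_distr Skew.smult_a_inv Skew.r_neg)
      then have "e x \<ominus>\<^bsub>SkewM\<^esub> F (int h) x = \<zero>\<^bsub>SkewM\<^esub>"
        using Skew_torsion_free[of "e x \<ominus>\<^bsub>SkewM\<^esub> F (int h) x" "fact h"] c by simp
      then show "e x = F (int h) x" using Skew.minus_zero_eq c by blast
    qed
  qed
  then show "klinear SkewM SkewM E" "E \<in> extensional (carrier Skew)"
    "E (skew_word w) = divided_word SkewM skew_letter (place_subst i j) w (int h)"
    using F by auto
qed

section \<open>Scalar extension\<close>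

context
  fixes R :: "('r, 'z) ring_scheme" (structure)
  assumes R: "ring R"
begin

interpretation R: ring R by (rule R)

lemma additivity_relations_carrier:
  "{single (x \<oplus> y) 1 - single x 1 - single y 1
    | x y. x \<in> carrier R \<and> y \<in> carrier R} \<subseteq> carrier (monoid_algebra R :: ('k::field, 'r \<Rightarrow>\<^sub>0 'k)
      module)"
  by (auto intro!: monoid_algebra_minus(1) single_in_monoid_algebra)

lemma kalg_ideal_additivity:
  "kalg_ideal (monoid_algebra R :: ('k::field, 'r \<Rightarrow>\<^sub>0 'k) module) (additivity_ideal R)"
proof -
  interpret A: kalg "monoid_algebra R :: ('k, 'r \<Rightarrow>\<^sub>0 'k) module"
    by (rule kalg_monoid_algebra[OF R.monoid_axioms])
  show ?thesis unfolding additivity_ideal_def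
    by (intro kalg_ideal.intro A.kalg_axioms A.genideal_ideal additivity_relations_carrier)
qed

lemma kalg_scalar_ext: "kalg (scalar_ext R :: ('k::field, ('r \<Rightarrow>\<^sub>0 'k) set) module)"
  unfolding scalar_ext_def by (rule kalg_ideal.kalg_quot[OF kalg_ideal_additivity])

lemma scalar_tensor_closed:
  "x \<in> carrier R \<Longrightarrow> scalar_tensor R c x \<in> carrier (scalar_ext R :: ('k::field, ('r \<Rightarrow>\<^sub>0 'k) set)
    module)"
  unfolding scalar_ext_def scalar_tensor_def by (intro coset_in_carrier single_in_monoid_algebra)

lemma scalar_tensor_smult:
  fixes c :: "'k::field"
  assumes "x \<in> carrier R"
  shows "scalar_tensor R c x = c \<odot>\<^bsub>scalar_ext R\<^esub> scalar_tensor R 1 x"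
proof -
  have "single x c = c \<odot>\<^bsub>monoid_algebra R\<^esub> single x 1"
    by (simp add: monoid_algebra_sel scale_single)
  then show ?thesis
    using kalg_ideal.coset_smult[OF kalg_ideal_additivity, of "single x 1" c] assms
    by (simp add: scalar_ext_def scalar_tensor_def single_in_monoid_algebra)
qed

lemma scalar_tensor_add:
  assumes "x \<in> carrier R" "y \<in> carrier R"
  shows "scalar_tensor R (1::'k::field) (x \<oplus> y) = scalar_tensor R 1 x \<oplus>\<^bsub>scalar_ext R\<^esub>
    scalar_tensor R 1 y"
proof -
  interpret I: kalg_ideal "monoid_algebra R :: ('k, 'r \<Rightarrow>\<^sub>0 'k) module" "additivity_ideal R"
    by (rule kalg_ideal_additivity)
  let ?s = "\<lambda>x. single x (1::'k)"
  have c: "?s (x \<oplus> y) \<in> carrier (monoid_algebra R)" "?s x \<in> carrier (monoid_algebra R)"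
    "?s y \<in> carrier (monoid_algebra R)"
    using assms by (auto intro!: single_in_monoid_algebra)
  have "?s (x \<oplus> y) - ?s x - ?s y \<in> additivity_ideal R"
    unfolding additivity_ideal_def
    by (rule subsetD[OF I.genideal_self[OF additivity_relations_carrier]]) (use assms in blast)
  then show ?thesis
    unfolding scalar_tensor_def scalar_ext_def
    using c by (intro I.coset_plusI) (simp_all add: monoid_algebra_minus)
qed

lemma scalar_tensor_hom:
  "scalar_tensor R (1::'k::field) \<in> ring_hom R (scalar_ext R)"
proof -
  interpret I: kalg_ideal "monoid_algebra R :: ('k, 'r \<Rightarrow>\<^sub>0 'k) module" "additivity_ideal R"
    by (rule kalg_ideal_additivity)
  show ?thesis
  proof (rule ring_hom_memI)
    show "scalar_tensor R (1::'k) \<one> = \<one>\<^bsub>scalar_ext R\<^esub>"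
      by (simp add: scalar_tensor_def scalar_ext_def I.coset_one monoid_algebra_sel)
    show "scalar_tensor R (1::'k) (x \<otimes> y) = scalar_tensor R 1 x \<otimes>\<^bsub>scalar_ext R\<^esub> scalar_tensor R 1 y"
      if "x \<in> carrier R" "y \<in> carrier R" for x y
      using I.coset_mult[of "single x 1" "single y 1"] that
      by (simp add: scalar_tensor_def scalar_ext_def single_in_monoid_algebra
        monoid_algebra_mult_single)
  qed (rule scalar_tensor_closed scalar_tensor_add; assumption)+
qed

lemma scalar_ext_span:
  assumes "x \<in> carrier (scalar_ext R :: ('k::field, ('r \<Rightarrow>\<^sub>0 'k) set) module)"
  shows "x \<in> kspan (scalar_ext R) (scalar_tensor R 1 ` carrier R)"
proof -
  interpret I: kalg_ideal "monoid_algebra R :: ('k, 'r \<Rightarrow>\<^sub>0 'k) module" "additivity_ideal R"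
    by (rule kalg_ideal_additivity)
  have "x \<in> kspan (scalar_ext R) ((\<lambda>p. additivity_ideal R +>\<^bsub>monoid_algebra R\<^esub> p) `
    (\<lambda>x. single x 1) ` carrier R)"
    unfolding scalar_ext_def
    by (rule I.kspan_quot[OF _ monoid_algebra_span]) (use assms in \<open>auto simp: scalar_ext_def
      single_in_monoid_algebra\<close>)
  then show ?thesis by (simp add: image_image scalar_tensor_def)
qed

text \<open>The universal property of extension of scalars, for maps that are only additive. The
  product of R enters because the ideal is two-sided, but multiplying an additivity relation by u
  and v yields another additivity relation.\<close>

lemma scalar_ext_lift:
  fixes B :: "('k::field, 'b) module"
  assumes "kmod B" "F \<in> carrier R \<rightarrow> carrier B"
    and add: "\<And>x y. x \<in> carrier R \<Longrightarrow> y \<in> carrier R \<Longrightarrow> F (x \<oplus> y) = F x \<oplus>\<^bsub>B\<^esub> F y"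
  obtains L where "klinear (scalar_ext R) B L" "\<And>x. x \<in> carrier R \<Longrightarrow> L (scalar_tensor R 1 x) = F x"
proof -
  interpret B: kmod B by fact
  interpret I: kalg_ideal "monoid_algebra R :: ('k, 'r \<Rightarrow>\<^sub>0 'k) module" "additivity_ideal R"
    by (rule kalg_ideal_additivity)
  let ?L = "lin B F" and ?s = "\<lambda>x. single x (1::'k)"
  have L: "klinear (monoid_algebra R) B ?L" by (rule klinear_lin[OF assms(1,2)])
  have s: "?L (?s x) = F x" "?s x \<in> carrier (monoid_algebra R)" "F x \<in> carrier B"
    if "x \<in> carrier R" for x
    using that assms(2) by (auto simp: B.lin_single Pi_iff intro!: single_in_monoid_algebra)
  have kill: "?L (?s u \<otimes>\<^bsub>monoid_algebra R\<^esub> p \<otimes>\<^bsub>monoid_algebra R\<^esub> ?s v) = \<zero>\<^bsub>B\<^esub>"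
    if "p = ?s (x \<oplus> y) - ?s x - ?s y" and c: "x \<in> carrier R" "y \<in> carrier R" "u \<in> carrier R"
      "v \<in> carrier R"
    for p x y u v
  proof -
    let ?T = "\<lambda>q. ?L (?s u \<otimes>\<^bsub>monoid_algebra R\<^esub> q \<otimes>\<^bsub>monoid_algebra R\<^esub> ?s v)"
    have T: "klinear (monoid_algebra R) B ?T"
      by (rule klinear_compose[OF I.klinear_mult_r[OF I.klinear_mult_l[OF klinear_ident]] L])
        (use c s in auto)
    have Ts: "?T (?s z) = F (u \<otimes> z \<otimes> v)" if "z \<in> carrier R" for z
      using that c by (simp add: monoid_algebra_mult_single s)
    have p: "p \<in> carrier (monoid_algebra R)"
      by (rule subsetD[OF additivity_relations_carrier]) (use that in blast)
    \<comment> \<open>Solved for the sum, the relation exhibits \<open>?T p\<close> as the term by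
      which two expressions for the same value differ, so it cancels to 0.\<close>
    have sxy: "?s (x \<oplus> y) = p \<oplus>\<^bsub>monoid_algebra R\<^esub> (?s x \<oplus>\<^bsub>monoid_algebra R\<^esub> ?s y)"
      by (simp add: that(1) monoid_algebra_sel)
    have "?T (?s (x \<oplus> y)) = ?T p \<oplus>\<^bsub>B\<^esub> (?T (?s x) \<oplus>\<^bsub>B\<^esub> ?T (?s y))"
      unfolding sxy using p s(2)[OF c(1)] s(2)[OF c(2)] by (simp add: klinear_add[OF T])
    moreover have "?T (?s (x \<oplus> y)) = ?T (?s x) \<oplus>\<^bsub>B\<^esub> ?T (?s y)"
      using c by (simp add: Ts add R.r_distr R.l_distr)
    ultimately show ?thesis
      using klinear_closed[OF T p] klinear_closed[OF T s(2)[OF c(1)]] klinear_closed[OF T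
        s(2)[OF c(2)]]
      by (metis B.add.r_cancel_one' B.add.m_closed)
  qed
  have killI: "?L p = \<zero>\<^bsub>B\<^esub>" if "p \<in> additivity_ideal R" for p
    by (rule I.klinear_kills_Idl[OF assms(1) L additivity_relations_carrier _ monoid_algebra_span
      _ that[unfolded additivity_ideal_def]])
      (auto simp: single_in_monoid_algebra kill)
  show thesis
  proof (rule I.klinear_descend[OF assms(1) L killI])
    fix L' assume "klinear (quot_alg (monoid_algebra R) (additivity_ideal R)) B L'"
      "\<And>x. x \<in> carrier (monoid_algebra R) \<Longrightarrow> L' (additivity_ideal R +>\<^bsub>monoid_algebra R\<^esub> x) = ?L x"
    then show thesis by (intro that[of L']) (simp_all add: scalar_ext_def scalar_tensor_def s)
  qed
qed

lemma extend_op: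
  fixes t :: "'r \<Rightarrow> 'r"
  assumes "t \<in> carrier R \<rightarrow> carrier R"
    and "\<And>x y. x \<in> carrier R \<Longrightarrow> y \<in> carrier R \<Longrightarrow> t (x \<oplus> y) = t x \<oplus> t y"
  defines "E \<equiv> (extend_op R t :: ('r \<Rightarrow>\<^sub>0 'k::field) set \<Rightarrow> _)"
  shows "klinear (scalar_ext R) (scalar_ext R) E" "E \<in> extensional (carrier (scalar_ext R))"
    "\<And>x. x \<in> carrier R \<Longrightarrow> E (scalar_tensor R 1 x) = scalar_tensor R 1 (t x)"
proof -
  interpret S: kalg "scalar_ext R :: ('k, ('r \<Rightarrow>\<^sub>0 'k) set) module" by (rule kalg_scalar_ext)
  obtain L :: "('r \<Rightarrow>\<^sub>0 'k) set \<Rightarrow> ('r \<Rightarrow>\<^sub>0 'k) set" where L: "klinear (scalar_ext R) (scalar_ext R) L"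
    "\<And>x. x \<in> carrier R \<Longrightarrow> L (scalar_tensor R 1 x) = scalar_tensor R 1 (t x)"
    by (rule scalar_ext_lift[OF S.kmod_axioms, of "\<lambda>x. scalar_tensor R 1 (t x)"])
      (use assms(1,2) in \<open>simp_all add: Pi_iff scalar_tensor_closed scalar_tensor_add\<close>)
  define L' where "L' = restrict L (carrier (scalar_ext R))"
  have L': "klinear (scalar_ext R) (scalar_ext R) L'" "L' \<in> extensional (carrier (scalar_ext R))"
    "\<And>x. x \<in> carrier R \<Longrightarrow> L' (scalar_tensor R 1 x) = scalar_tensor R 1 (t x)"
    using L klinear_cong[OF L(1) _ S.kmod_axioms, of L']
    by (simp_all add: L'_def scalar_tensor_closed)
  have "E = L'"
    unfolding E_def extend_op_def
  proof (rule the_equality, intro conjI allI ballI)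
    show "L' (scalar_tensor R c x) = scalar_tensor R c (t x)" if "x \<in> carrier R" for c x
      using that assms(1) L' klinear_smult[OF L'(1) scalar_tensor_closed[OF that]]
      by (simp add: scalar_tensor_smult[of _ c] Pi_iff)
  next
    fix D :: "('r \<Rightarrow>\<^sub>0 'k) set \<Rightarrow> ('r \<Rightarrow>\<^sub>0 'k) set"
    assume D: "D \<in> extensional (carrier (scalar_ext R)) \<and> klinear (scalar_ext R) (scalar_ext R) D \<and>
      (\<forall>c. \<forall>x\<in>carrier R. D (scalar_tensor R c x) = scalar_tensor R c (t x))"
    show "D = L'"
    proof (rule extensionalityI[OF conjunct1[OF D] L'(2)])
      fix x assume x: "x \<in> carrier (scalar_ext R :: ('k, ('r \<Rightarrow>\<^sub>0 'k) set) module)"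
      show "D x = L' x"
        by (rule klinear_eq_on_kspan[OF S.kmod_axioms S.kmod_axioms _ L'(1) _ _ scalar_ext_span[OF
          x]])
          (use D L'(3) in \<open>auto intro: scalar_tensor_closed\<close>)
    qed
  qed (use L' in auto)
  then show "klinear (scalar_ext R) (scalar_ext R) E" "E \<in> extensional (carrier (scalar_ext R))"
    "\<And>x. x \<in> carrier R \<Longrightarrow> E (scalar_tensor R 1 x) = scalar_tensor R 1 (t x)"
    using L' by auto
qed

end

text \<open>Restriction of scalars to \<open>\<int>\<close>, so that additive maps out of \<open>Skew\<close> become linear maps.\<close>

definition zmod :: "('k::comm_ring_1, 'b) module \<Rightarrow> (int, 'b) module" where
  "zmod B = \<lparr>carrier = carrier B, mult = mult B, one = one B, zero = zero B, add = add B,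
    smult = (\<lambda>c x. of_int c \<odot>\<^bsub>B\<^esub> x)\<rparr>"

lemma zmod_sel [simp]:
  "carrier (zmod B) = carrier B" "mult (zmod B) = mult B" "one (zmod B) = one B"
  "zero (zmod B) = zero B" "add (zmod B) = add B" "c \<odot>\<^bsub>zmod B\<^esub> x = of_int c \<odot>\<^bsub>B\<^esub> x"
  by (simp_all add: zmod_def)

lemma kmod_zmod:
  assumes "kmod B"
  shows "kmod (zmod B)"
proof -
  interpret B: kmod B by fact
  have inv: "\<exists>y\<in>carrier B. y \<oplus>\<^bsub>B\<^esub> x = \<zero>\<^bsub>B\<^esub>" if "x \<in> carrier B" for x
    using that B.l_neg[OF that] by (intro bexI[of _ "\<ominus>\<^bsub>B\<^esub> x"]) simp_all
  have "abelian_group (zmod B)"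
    by (rule abelian_groupI) (simp_all add: B.a_ac inv)
  then show ?thesis
    by (intro kmod.intro kmod_axioms.intro)
      (simp_all add: B.smult_l_distr B.smult_r_distr B.smult_smult)
qed

lemma kspan_zmod: "x \<in> kspan (zmod B) W \<Longrightarrow> x \<in> kspan B W"
  by (induction rule: kspan.induct) (auto intro: kspan.intros)

section \<open>The letterplace algebra over the field and its quotient\<close>

definition kskew_letter :: "'v \<times> 'm \<Rightarrow> ('v, 'm, 'k::field) kskew" where
  "kskew_letter x = scalar_tensor Skew 1 (skew_letter x)"

abbreviation "kskew_word \<equiv> wprod KSkew kskew_letter"

lemma klp_eq_kskew_letter: "klp v i = kskew_letter (v, i)"
  by (simp add: klp_def kskew_letter_def lp_eq_skew_letter)

lemma KSkew_tensor_hom: "scalar_tensor Skew 1 \<in> ring_hom SkewM KSkew"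
  using scalar_tensor_hom[OF ring_Skew] unfolding KSkew_def ring_hom_def by (simp add: SkewM_sel)

interpretation KSkew: skew_alg "KSkew :: ('k::field, ('v, 'm, 'k) kskew) module" kskew_letter
proof -
  interpret K: kalg "KSkew :: ('k, ('v, 'm, 'k) kskew) module"
    unfolding KSkew_def by (rule kalg_scalar_ext[OF ring_Skew])
  have hom: "scalar_tensor Skew (1::'k) \<in> ring_hom SkewM (KSkew :: ('k, ('v, 'm, 'k) kskew) module)"
    by (rule KSkew_tensor_hom)
  have m: "kskew_letter x \<otimes>\<^bsub>KSkew\<^esub> kskew_letter y =
    scalar_tensor Skew (1::'k) (skew_letter x \<otimes>\<^bsub>SkewM\<^esub> skew_letter y)" for x y :: "'v \<times> 'm"
    using ring_hom_mult[OF hom, of "skew_letter x" "skew_letter y"]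
    by (simp add: kskew_letter_def SkewM_sel(1))
  have z: "scalar_tensor Skew (1::'k) \<zero>\<^bsub>SkewM\<^esub> = \<zero>\<^bsub>KSkew :: ('k, ('v, 'm, 'k) kskew) module\<^esub>"
    by (rule ring_hom_zero[OF hom Skew.ring_axioms K.ring_axioms])
  show "skew_alg (KSkew :: ('k, ('v, 'm, 'k) kskew) module) kskew_letter"
  proof unfold_locales
    show "kskew_letter x \<in> carrier (KSkew :: ('k, ('v, 'm, 'k) kskew) module)" for x :: "'v \<times> 'm"
      using ring_hom_closed[OF hom, of "skew_letter x"] by (simp add: kskew_letter_def SkewM_sel(1))
    show "kskew_letter x \<otimes>\<^bsub>KSkew\<^esub> kskew_letter x = \<zero>\<^bsub>KSkew :: ('k, ('v, 'm, 'k) kskew) module\<^esub>"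
      for x :: "'v \<times> 'm"
      unfolding m by (simp add: Skew.g_square z)
    show "kskew_letter x \<otimes>\<^bsub>KSkew\<^esub> kskew_letter y \<oplus>\<^bsub>KSkew\<^esub> kskew_letter y \<otimes>\<^bsub>KSkew\<^esub> kskew_letter x =
      \<zero>\<^bsub>KSkew :: ('k, ('v, 'm, 'k) kskew) module\<^esub>"
      for x y :: "'v \<times> 'm"
      unfolding m using ring_hom_add[OF hom, of "skew_letter x \<otimes>\<^bsub>SkewM\<^esub> skew_letter y"
        "skew_letter y \<otimes>\<^bsub>SkewM\<^esub> skew_letter x"]
      by (simp add: Skew.g_anti z SkewM_sel(1))
  qed
qed

lemma KSkew_word: "scalar_tensor Skew 1 (skew_word w) = kskew_word w"
  using ring_hom_wprod[OF KSkew_tensor_hom Skew.monoid_axioms, of w skew_letter]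
  by (simp add: kskew_letter_def[abs_def] SkewM_sel(1))

lemma klinear_KSkew_tensor:
  "klinear SkewM (zmod (KSkew :: ('k::field, ('v, 'm, 'k) kskew) module)) (scalar_tensor Skew 1)"
  using KSkew_tensor_hom
  by (intro additive_int_klinear Skew.kmod_axioms kmod_zmod KSkew.kmod_axioms)
    (auto simp: ring_hom_def)

text \<open>The elements 1 \<otimes> x span over the field, and each of them is an integral
  combination of words, since integers act through their image in the field.\<close>

lemma KSkew_span:
  assumes "x \<in> carrier (KSkew :: ('k::field, ('v, 'm, 'k) kskew) module)"
  shows "x \<in> kspan KSkew (range kskew_word)"
proof (rule kspan_trans)
  show "x \<in> kspan KSkew (scalar_tensor Skew 1 ` carrier Skew)"
    using scalar_ext_span[OF ring_Skew] assms by (simp add: KSkew_def)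
  show "scalar_tensor Skew 1 ` carrier Skew \<subseteq> kspan (KSkew :: ('k, ('v, 'm, 'k) kskew) module)
    (range kskew_word)"
  proof safe
    fix x :: "('v, 'm) skew" assume x: "x \<in> carrier Skew"
    show "scalar_tensor Skew 1 x \<in> kspan (KSkew :: ('k, ('v, 'm, 'k) kskew) module)
      (range kskew_word)"
      by (rule kspan_zmod, rule klinear_kspan[OF Skew.kmod_axioms kmod_zmod[OF KSkew.kmod_axioms]
            klinear_KSkew_tensor _ _ Skew_span[OF x]])
        (auto simp: KSkew_word SkewM_sel intro: kspan.base)
  qed
qed

lemma KSkew_hom:
  fixes f :: "('v \<times> 'm) list \<Rightarrow> 'b" and B :: "('k::field, 'b) module"
  assumes "kmod B" "\<And>w. f w \<in> carrier B"
    and "\<And>u v x. f (u @ x # x # v) = \<zero>\<^bsub>B\<^esub>"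
    and "\<And>u v x y. f (u @ x # y # v) \<oplus>\<^bsub>B\<^esub> f (u @ y # x # v) = \<zero>\<^bsub>B\<^esub>"
  obtains L where "klinear KSkew B L" "\<And>w. L (kskew_word w) = f w"
proof (rule Skew_hom[where B = "zmod B" and f = f, OF kmod_zmod[OF assms(1)]])
  fix F assume F: "klinear SkewM (zmod B) F" "\<And>w. F (skew_word w) = f w"
  show thesis
  proof (rule scalar_ext_lift[OF ring_Skew assms(1), where F = F])
    show "F \<in> carrier Skew \<rightarrow> carrier B"
      using klinear_closed[OF F(1)] by (auto simp: SkewM_sel)
    show "F (x \<oplus>\<^bsub>Skew\<^esub> y) = F x \<oplus>\<^bsub>B\<^esub> F y" if "x \<in> carrier Skew" "y \<in> carrier Skew" for x y
      using klinear_add[OF F(1)] that by (simp add: SkewM_sel)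
    fix L assume L: "klinear (scalar_ext Skew) B L"
      "\<And>x. x \<in> carrier Skew \<Longrightarrow> L (scalar_tensor Skew 1 x) = F x"
    show thesis
    proof (rule that[of L])
      show "klinear KSkew B L" unfolding KSkew_def by (rule L(1))
      show "L (kskew_word w) = f w" for w
        by (simp add: L(2) F(2) flip: KSkew_word)
    qed
  qed
qed (use assms in auto)

section \<open>The quotient by linearity of the letters\<close>

definition quot_letter :: "('k::field \<Rightarrow> 'v::ab_group_add \<Rightarrow> 'v) \<Rightarrow> 'v \<times> 'm \<Rightarrow> ('v, 'm, 'k) kskew set"
  where
  "quot_letter sc x = lp_ideal sc +>\<^bsub>KSkew\<^esub> kskew_letter x"

abbreviation "quot_word sc \<equiv> wprod (lp_quot sc) (quot_letter sc)"

lemma quot_letter_eq: "lp_ideal sc +>\<^bsub>KSkew\<^esub> klp v i = quot_letter sc (v, i)"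
  by (simp add: quot_letter_def klp_eq_kskew_letter)

lemma lp_relations_carrier:
  "{klp (sc a v1 + sc b v2) i \<ominus>\<^bsub>KSkew\<^esub> (a \<odot>\<^bsub>KSkew\<^esub> klp v1 i) \<ominus>\<^bsub>KSkew\<^esub> (b \<odot>\<^bsub>KSkew\<^esub> klp v2 i) | a b
    v1 v2 i. True}
    \<subseteq> carrier (KSkew :: ('k::field, ('v::ab_group_add, 'm, 'k) kskew) module)"
  by (auto simp: klp_eq_kskew_letter)

lemma kalg_ideal_lp_ideal:
  "kalg_ideal (KSkew :: ('k::field, ('v::ab_group_add, 'm, 'k) kskew) module) (lp_ideal sc)"
  unfolding lp_ideal_def
  by (intro kalg_ideal.intro KSkew.kalg_axioms KSkew.genideal_ideal lp_relations_carrier)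

interpretation lp_quot: skew_alg "lp_quot sc :: ('k::field, ('v::ab_group_add, 'm, 'k) kskew set)
  module" "quot_letter sc" for sc
proof -
  interpret lp_ideal: kalg_ideal "KSkew :: ('k, ('v, 'm, 'k) kskew) module" "lp_ideal sc"
    by (rule kalg_ideal_lp_ideal)
  interpret P: kalg "lp_quot sc :: ('k::field, ('v::ab_group_add, 'm, 'k) kskew set) module"
    unfolding lp_quot_def by (rule lp_ideal.kalg_quot)
  show "skew_alg (lp_quot sc :: ('k::field, ('v::ab_group_add, 'm, 'k) kskew set) module)
    (quot_letter sc)"
    by unfold_locales
      (simp_all add: lp_quot_def quot_letter_def coset_in_carrier lp_ideal.coset_mult
        lp_ideal.coset_add
        KSkew.g_square KSkew.g_anti lp_ideal.coset_zero)
qed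

lemma lp_quot_word: "lp_ideal sc +>\<^bsub>KSkew\<^esub> kskew_word w = quot_word sc w"
proof -
  interpret lp_ideal: kalg_ideal KSkew "lp_ideal sc" by (rule kalg_ideal_lp_ideal)
  show ?thesis
    using ring_hom_wprod[OF lp_ideal.ring_hom_coset KSkew.monoid_axioms, of w kskew_letter]
    by (simp add: quot_letter_def[abs_def] lp_quot_def)
qed

lemma lp_quot_span:
  assumes "x \<in> carrier (lp_quot sc :: ('k::field, ('v::ab_group_add, 'm, 'k) kskew set) module)"
  shows "x \<in> kspan (lp_quot sc) (range (quot_word sc))"
proof -
  interpret lp_ideal: kalg_ideal KSkew "lp_ideal sc" by (rule kalg_ideal_lp_ideal)
  show ?thesis
    using lp_ideal.kspan_quot[OF _ KSkew_span assms[unfolded lp_quot_def]]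
    by (simp add: image_subset_iff image_image lp_quot_word flip: lp_quot_def)
qed

lemma quot_letter_linear:
  fixes sc :: "'k::field \<Rightarrow> 'v::ab_group_add \<Rightarrow> 'v" and i :: 'm
  shows "quot_letter sc (sc a u + sc b v, i) =
    a \<odot>\<^bsub>lp_quot sc\<^esub> quot_letter sc (u, i) \<oplus>\<^bsub>lp_quot sc\<^esub> b \<odot>\<^bsub>lp_quot sc\<^esub> quot_letter sc (v, i)"
proof -
  interpret lp_ideal: kalg_ideal "KSkew :: ('k, ('v, 'm, 'k) kskew) module" "lp_ideal sc"
    by (rule kalg_ideal_lp_ideal)
  let ?x = "kskew_letter (sc a u + sc b v, i) :: ('v, 'm, 'k) kskew"
  let ?y = "a \<odot>\<^bsub>KSkew\<^esub> kskew_letter (u, i) :: ('v, 'm, 'k) kskew"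
    and ?z = "b \<odot>\<^bsub>KSkew\<^esub> kskew_letter (v, i) :: ('v, 'm, 'k) kskew"
  have "?x \<ominus>\<^bsub>KSkew\<^esub> ?y \<ominus>\<^bsub>KSkew\<^esub> ?z \<in> lp_ideal sc"
    unfolding lp_ideal_def
    by (rule subsetD[OF KSkew.genideal_self[OF lp_relations_carrier]])
      (unfold klp_eq_kskew_letter[symmetric], blast)
  then have "lp_ideal sc +>\<^bsub>KSkew\<^esub> ?x =
      (lp_ideal sc +>\<^bsub>KSkew\<^esub> ?y) \<oplus>\<^bsub>lp_quot sc\<^esub> (lp_ideal sc +>\<^bsub>KSkew\<^esub> ?z)"
    unfolding lp_quot_def by (intro lp_ideal.coset_plusI) auto
  then show ?thesis
    by (simp add: quot_letter_def lp_quot_def lp_ideal.coset_smult)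
qed

text \<open>Linearity in the vector of one letter, with its place and the rest of the word fixed.
  Alternating word functions with this property are those that descend to the quotient.\<close>

definition letter_linear :: "('k \<Rightarrow> 'v::ab_group_add \<Rightarrow> 'v) \<Rightarrow> ('k, 'b) module \<Rightarrow> (('v \<times> 'm) list \<Rightarrow>
  'b) \<Rightarrow> bool" where
  "letter_linear sc B f \<longleftrightarrow> (\<forall>u w a b v1 v2 i. f (u @ (sc a v1 + sc b v2, i) # w) =
    a \<odot>\<^bsub>B\<^esub> f (u @ (v1, i) # w) \<oplus>\<^bsub>B\<^esub> b \<odot>\<^bsub>B\<^esub> f (u @ (v2, i) # w))"

lemma klinear_kills_lp_ideal:
  fixes L :: "('v::ab_group_add, 'm, 'k::field) kskew \<Rightarrow> 'b"
  assumes "kmod B" "klinear KSkew B L" "letter_linear sc B (\<lambda>w. L (kskew_word w))" "x \<in> lp_ideal sc"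
  shows "L x = \<zero>\<^bsub>B\<^esub>"
proof -
  interpret B: kmod B by fact
  let ?w = "kskew_word :: ('v \<times> 'm) list \<Rightarrow> ('v, 'm, 'k) kskew"
  have kill: "L (?w u \<otimes>\<^bsub>KSkew\<^esub> s \<otimes>\<^bsub>KSkew\<^esub> ?w w) = \<zero>\<^bsub>B\<^esub>"
    if "s = klp (sc a v1 + sc b v2) i \<ominus>\<^bsub>KSkew\<^esub> (a \<odot>\<^bsub>KSkew\<^esub> klp v1 i) \<ominus>\<^bsub>KSkew\<^esub> (b \<odot>\<^bsub>KSkew\<^esub> klp v2 i)"
    for s u w a b v1 v2 and i :: 'm
  proof -
    let ?T = "\<lambda>q. L (?w u \<otimes>\<^bsub>KSkew\<^esub> q \<otimes>\<^bsub>KSkew\<^esub> ?w w)"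
    have T: "klinear KSkew B ?T"
      by (rule klinear_compose[OF KSkew.klinear_mult_r[OF KSkew.klinear_mult_l[OF klinear_ident]]
        assms(2)]) auto
    have Tk: "?T (kskew_letter x) = L (?w (u @ x # w))" for x
      by (simp add: KSkew.wd_append KSkew.m_assoc)
    note [simp] = klinear_closed[OF assms(2)]
    have "?T s = ?T (kskew_letter (sc a v1 + sc b v2, i)) \<ominus>\<^bsub>B\<^esub> a \<odot>\<^bsub>B\<^esub> ?T (kskew_letter (v1, i))
      \<ominus>\<^bsub>B\<^esub> b \<odot>\<^bsub>B\<^esub> ?T (kskew_letter (v2, i))"
      unfolding that klp_eq_kskew_letter
      by (simp only: klinear_minus[OF KSkew.kmod_axioms assms(1) T] klinear_smult[OF T]
          KSkew.g_closed KSkew.smult_closed KSkew.minus_closed)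
    also have "?T (kskew_letter (sc a v1 + sc b v2, i)) = a \<odot>\<^bsub>B\<^esub> ?T (kskew_letter (v1, i)) \<oplus>\<^bsub>B\<^esub>
      b \<odot>\<^bsub>B\<^esub> ?T (kskew_letter (v2, i))"
      using assms(3) unfolding Tk letter_linear_def by blast
    also have "a \<odot>\<^bsub>B\<^esub> ?T (kskew_letter (v1, i)) \<oplus>\<^bsub>B\<^esub> b \<odot>\<^bsub>B\<^esub> ?T (kskew_letter (v2, i)) \<ominus>\<^bsub>B\<^esub>
      a \<odot>\<^bsub>B\<^esub> ?T (kskew_letter (v1, i)) \<ominus>\<^bsub>B\<^esub> b \<odot>\<^bsub>B\<^esub> ?T (kskew_letter (v2, i)) = \<zero>\<^bsub>B\<^esub>"
      by (simp add: Tk B.plus_minus_minus)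
    finally show ?thesis .
  qed
  show ?thesis
    by (rule KSkew.klinear_kills_Idl[OF assms(1,2) lp_relations_carrier _ KSkew_span _
      assms(4)[unfolded lp_ideal_def]])
      (use kill in auto)
qed

lemma lp_quot_hom:
  fixes f :: "('v::ab_group_add \<times> 'm) list \<Rightarrow> 'b" and B :: "('k::field, 'b) module"
  assumes "kmod B" "\<And>w. f w \<in> carrier B"
    and "\<And>u v x. f (u @ x # x # v) = \<zero>\<^bsub>B\<^esub>"
    and "\<And>u v x y. f (u @ x # y # v) \<oplus>\<^bsub>B\<^esub> f (u @ y # x # v) = \<zero>\<^bsub>B\<^esub>"
    and "letter_linear sc B f"
  obtains L where "klinear (lp_quot sc) B L" "\<And>w. L (quot_word sc w) = f w"
proof (rule KSkew_hom[where f = f, OF assms(1-4)])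
  fix F assume F: "klinear KSkew B F" "\<And>w. F (kskew_word w) = f w"
  interpret lp_ideal: kalg_ideal KSkew "lp_ideal sc" by (rule kalg_ideal_lp_ideal)
  have kill: "F x = \<zero>\<^bsub>B\<^esub>" if "x \<in> lp_ideal sc" for x
    by (rule klinear_kills_lp_ideal[OF assms(1) F(1) _ that]) (simp add: F(2) assms(5))
  show thesis
  proof (rule lp_ideal.klinear_descend[OF assms(1) F(1) kill])
    fix L assume L: "klinear (quot_alg KSkew (lp_ideal sc)) B L"
      "\<And>x. x \<in> carrier KSkew \<Longrightarrow> L (lp_ideal sc +>\<^bsub>KSkew\<^esub> x) = F x"
    show thesis
      by (rule that[of L]) (use L F(2) in \<open>simp_all add: lp_quot_def[symmetric] flip: lp_quot_word\<close>)
  qed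
qed

subsection \<open>Operators induced on the quotient\<close>

text \<open>Replacing (v|i) by (v|j) leaves the vector alone, so every summand stays linear in
  v.\<close>

lemma letter_linear_divided_word:
  fixes sc :: "'k::field \<Rightarrow> 'v::ab_group_add \<Rightarrow> 'v" and i j :: 'm
  shows "letter_linear sc (lp_quot sc) (\<lambda>w. divided_word (lp_quot sc) (quot_letter sc)
    (place_subst i j) w h)"
  unfolding letter_linear_def
proof (intro allI)
  fix u w a b v1 v2 and k :: 'm
  note distr = lp_quot.l_distr lp_quot.r_distr lp_quot.smult_mult_l lp_quot.smult_mult_r
    lp_quot.smult_r_distr
  have opt: "opt_letter (lp_quot sc) (quot_letter sc) (place_subst i j (sc a v1 + sc b v2, k)) =
    a \<odot>\<^bsub>lp_quot sc\<^esub> opt_letter (lp_quot sc) (quot_letter sc) (place_subst i j (v1, k)) \<oplus>\<^bsub>lp_quot sc\<^esub>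
    b \<odot>\<^bsub>lp_quot sc\<^esub> opt_letter (lp_quot sc) (quot_letter sc) (place_subst i j (v2, k))"
    by (simp add: place_subst_def quot_letter_linear)
  show "divided_word (lp_quot sc) (quot_letter sc) (place_subst i j) (u @ (sc a v1 + sc b v2, k) #
    w) h =
    a \<odot>\<^bsub>lp_quot sc\<^esub> divided_word (lp_quot sc) (quot_letter sc) (place_subst i j) (u @ (v1, k) # w)
      h \<oplus>\<^bsub>lp_quot sc\<^esub>
    b \<odot>\<^bsub>lp_quot sc\<^esub> divided_word (lp_quot sc) (quot_letter sc) (place_subst i j) (u @ (v2, k) # w)
      h"
  proof (induction u arbitrary: h)
    case Nil
    show ?case by (simp add: opt quot_letter_linear distr) (simp add: lp_quot.a_ac)
  next
    case (Cons x u)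
    then show ?case by (simp add: distr) (simp add: lp_quot.a_ac)
  qed
qed

text \<open>The common form of polarizations (h = 1, any places) and divided powers (distinct
  places). Invariance of the ideal and the action on the quotient follow from the formula on words
  alone.\<close>

locale letterplace_operator =
  fixes sc :: "'k::field \<Rightarrow> 'v::ab_group_add \<Rightarrow> 'v" and i j :: 'm and h :: int
    and E :: "('v, 'm, 'k) kskew \<Rightarrow> ('v, 'm, 'k) kskew"
  assumes E_linear: "klinear KSkew KSkew E"
    and E_word: "E (kskew_word w) = divided_word KSkew kskew_letter (place_subst i j) w h"
begin

interpretation lp_ideal: kalg_ideal "KSkew :: ('k, ('v, 'm, 'k) kskew) module" "lp_ideal sc"
  by (rule kalg_ideal_lp_ideal)

text \<open>For h > 1 the operator is not a derivation, so looking at ideal generators alone is not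
  enough. Followed by the projection, it is a linear map whose values on words are linear in each
  letter, and such a map kills the whole ideal.\<close>

lemma lp_ideal_invariant: "E ` lp_ideal sc \<subseteq> lp_ideal sc"
proof safe
  fix x :: "('v, 'm, 'k) kskew" assume x: "x \<in> lp_ideal sc"
  have lin: "klinear KSkew (lp_quot sc) (\<lambda>x. lp_ideal sc +>\<^bsub>KSkew\<^esub> E x)"
    unfolding lp_quot_def by (rule klinear_compose[OF E_linear lp_ideal.klinear_coset])
  have "lp_ideal sc +>\<^bsub>KSkew\<^esub> divided_word KSkew kskew_letter (place_subst i j) w h =
    divided_word (lp_quot sc) (quot_letter sc) (place_subst i j) w h" for w
    using KSkew.ring_hom_divided_word[OF lp_quot.ring_axioms, of "\<lambda>x. lp_ideal sc +>\<^bsub>KSkew\<^esub> x" sc]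
      lp_ideal.ring_hom_coset by (simp add: lp_quot_def quot_letter_def[abs_def])
  then have "letter_linear sc (lp_quot sc) (\<lambda>w. lp_ideal sc +>\<^bsub>KSkew\<^esub> E (kskew_word w))"
    using letter_linear_divided_word by (simp add: E_word)
  from klinear_kills_lp_ideal[where L = "\<lambda>x. lp_ideal sc +>\<^bsub>KSkew\<^esub> E x", OF lp_quot.kmod_axioms
    lin this x]
  show "E x \<in> lp_ideal sc"
    using lp_ideal.a_Hcarr[OF x] klinear_closed[OF E_linear]
    by (simp add: lp_quot_def lp_ideal.coset_eq_zero_iff)
qed

lemma induced_coset:
  assumes "x \<in> carrier KSkew"
  shows "induced KSkew (lp_ideal sc) E (lp_ideal sc +>\<^bsub>KSkew\<^esub> x) = lp_ideal sc +>\<^bsub>KSkew\<^esub> E x"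
proof -
  have "lp_ideal sc +>\<^bsub>KSkew\<^esub> E y = lp_ideal sc +>\<^bsub>KSkew\<^esub> E x" if "y \<in> lp_ideal sc +>\<^bsub>KSkew\<^esub> x"
    for y
  proof -
    have y: "y \<in> carrier KSkew" "y \<ominus>\<^bsub>KSkew\<^esub> x \<in> lp_ideal sc"
      using that lp_ideal.mem_coset_iff[OF assms] by auto
    then have "E y \<ominus>\<^bsub>KSkew\<^esub> E x \<in> lp_ideal sc"
      using lp_ideal_invariant klinear_minus[OF KSkew.kmod_axioms KSkew.kmod_axioms E_linear y(1)
        assms]
      by auto
    then show ?thesis
      using klinear_closed[OF E_linear] y assms by (simp add: lp_ideal.coset_eq_iff)
  qed
  then have "(\<Union>y\<in>lp_ideal sc +>\<^bsub>KSkew\<^esub> x. lp_ideal sc +>\<^bsub>KSkew\<^esub> E y) = lp_ideal sc +>\<^bsub>KSkew\<^esub> E x"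
    using assms by (intro lp_ideal.UN_coset klinear_closed[OF E_linear]) auto
  then show ?thesis using coset_in_carrier[OF assms, of "lp_ideal sc"] by (simp add: induced_def)
qed

lemma klinear_induced: "klinear (lp_quot sc) (lp_quot sc) (induced KSkew (lp_ideal sc) E)"
  by (intro klinearI)
    (auto simp: lp_quot_def carrier_quot_alg induced_coset lp_ideal.coset_add lp_ideal.coset_smult
      klinear_closed[OF E_linear] klinear_add[OF E_linear] klinear_smult[OF E_linear])

lemma induced_word: "induced KSkew (lp_ideal sc) E (quot_word sc w) =
    divided_word (lp_quot sc) (quot_letter sc) (place_subst i j) w h"
proof -
  have "lp_ideal sc +>\<^bsub>KSkew\<^esub> divided_word KSkew kskew_letter (place_subst i j) w h =
    divided_word (lp_quot sc) (quot_letter sc) (place_subst i j) w h"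
    using KSkew.ring_hom_divided_word[OF lp_quot.ring_axioms, of "\<lambda>x. lp_ideal sc +>\<^bsub>KSkew\<^esub> x" sc]
      lp_ideal.ring_hom_coset by (simp add: lp_quot_def quot_letter_def[abs_def])
  then show ?thesis by (simp add: induced_coset E_word flip: lp_quot_word)
qed

end

lemma extend_op_Skew:
  fixes t :: "('v::ab_group_add, 'm) skew \<Rightarrow> ('v, 'm) skew"
  assumes "klinear SkewM SkewM t" "\<And>w. t (skew_word w) = divided_word SkewM skew_letter
    (place_subst i j) w h"
  shows "letterplace_operator i j h (extend_op Skew t :: ('v, 'm, 'k::field) kskew \<Rightarrow> ('v, 'm, 'k)
    kskew)"
proof
  have t: "t \<in> carrier Skew \<rightarrow> carrier Skew"
    "\<And>x y. x \<in> carrier Skew \<Longrightarrow> y \<in> carrier Skew \<Longrightarrow> t (x \<oplus>\<^bsub>Skew\<^esub> y) = t x \<oplus>\<^bsub>Skew\<^esub> t y"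
    using klinear_closed[OF assms(1)] klinear_add[OF assms(1)] by (auto simp: SkewM_sel)
  note e = extend_op[OF ring_Skew t]
  show "klinear KSkew KSkew (extend_op Skew t :: ('v, 'm, 'k) kskew \<Rightarrow> ('v, 'm, 'k) kskew)"
    unfolding KSkew_def by (rule e(1))
  show "extend_op Skew t (kskew_word w) = (divided_word KSkew kskew_letter (place_subst i j) w h
    :: ('v, 'm, 'k) kskew)" for w
  proof -
    have "extend_op Skew t (kskew_word w :: ('v, 'm, 'k) kskew) =
      scalar_tensor Skew 1 (t (skew_word w))"
      unfolding KSkew_word[symmetric] by (rule e(3)[OF _ _ Skew.wd_closed])
    also have "\<dots> = divided_word KSkew kskew_letter (place_subst i j) w h"
      unfolding assms(2) kskew_letter_def[abs_def]
      by (rule Skew.ring_hom_divided_word[OF KSkew.ring_axioms KSkew_tensor_hom])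
    finally show ?thesis .
  qed
qed

lemma kpolarization_operator: "letterplace_operator i j 1 (kpolarization j i)"
  unfolding kpolarization_def by (intro extend_op_Skew polarization_words)

lemma kdivided_polarization_operator:
  "i \<noteq> j \<Longrightarrow> letterplace_operator i j (int h) (kdivided_polarization j i h)"
  unfolding kdivided_polarization_def by (intro extend_op_Skew divided_power_words)

section \<open>Tensor powers\<close>

context
  fixes L :: "('k::field, 'a) module"
  assumes L: "kalg L"
begin

interpretation L: kalg L by (rule L)

lemma monoid_tuple: "Group.monoid (tuple_monoid L)"
  by (rule monoidI) (auto simp: tuple_monoid_def L.m_assoc)

lemma tuple_monoid_sel:
  "A \<in> carrier (tuple_monoid L) \<longleftrightarrow> (\<forall>k. A k \<in> carrier L)"
  "A \<otimes>\<^bsub>tuple_monoid L\<^esub> B = (\<lambda>k. A k \<otimes>\<^bsub>L\<^esub> B k)"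
  "\<one>\<^bsub>tuple_monoid L\<^esub> = (\<lambda>k. \<one>\<^bsub>L\<^esub>)"
  by (auto simp: tuple_monoid_def)

lemma single_tuple:
  "A \<in> carrier (tuple_monoid L) \<Longrightarrow> single A c \<in> carrier (monoid_algebra (tuple_monoid L))"
  by (rule single_in_monoid_algebra)

lemma multilinear_relations_carrier:
  "multilinear_relations L \<subseteq> carrier (monoid_algebra (tuple_monoid L) :: ('k, ('m \<Rightarrow> 'a) \<Rightarrow>\<^sub>0 'k)
    module)"
  unfolding multilinear_relations_def
  by (auto intro!: monoid_algebra_minus single_tuple simp: tuple_monoid_sel)

lemma kalg_ideal_multilinear:
  "kalg_ideal (monoid_algebra (tuple_monoid L) :: ('k, ('m \<Rightarrow> 'a) \<Rightarrow>\<^sub>0 'k) module)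
    (multilinear_ideal L)"
proof -
  interpret A: kalg "monoid_algebra (tuple_monoid L) :: ('k, ('m \<Rightarrow> 'a) \<Rightarrow>\<^sub>0 'k) module"
    by (rule kalg_monoid_algebra[OF monoid_tuple])
  show ?thesis unfolding multilinear_ideal_def
    by (intro kalg_ideal.intro A.kalg_axioms A.genideal_ideal multilinear_relations_carrier)
qed

lemma kalg_tensor_power: "kalg (tensor_power L :: ('k, (('m \<Rightarrow> 'a) \<Rightarrow>\<^sub>0 'k) set) module)"
  unfolding tensor_power_def by (rule kalg_ideal.kalg_quot[OF kalg_ideal_multilinear])

lemma pure_tensor_closed:
  "(\<And>k. A k \<in> carrier L) \<Longrightarrow> pure_tensor L A \<in> carrier (tensor_power L)"
  unfolding pure_tensor_def tensor_power_def
  by (intro coset_in_carrier single_tuple) (simp add: tuple_monoid_sel)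

lemma pure_tensor_one: "\<one>\<^bsub>tensor_power L\<^esub> = pure_tensor L (\<lambda>k :: 'm. \<one>\<^bsub>L\<^esub>)"
  using kalg_ideal.coset_one[OF kalg_ideal_multilinear]
  by (simp add: pure_tensor_def tensor_power_def monoid_algebra_sel tuple_monoid_sel)

lemma pure_tensor_add:
  fixes A :: "'m \<Rightarrow> 'a"
  assumes "\<And>k. A k \<in> carrier L" "x \<in> carrier L" "y \<in> carrier L"
  shows "pure_tensor L (A(k := x \<oplus>\<^bsub>L\<^esub> y)) = pure_tensor L (A(k := x)) \<oplus>\<^bsub>tensor_power L\<^esub>
    pure_tensor L (A(k := y))"
proof -
  let ?M = "monoid_algebra (tuple_monoid L) :: ('k, ('m \<Rightarrow> 'a) \<Rightarrow>\<^sub>0 'k) module"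
  let ?s = "\<lambda>A :: 'm \<Rightarrow> 'a. single A (1 :: 'k)"
  interpret I: kalg_ideal ?M "multilinear_ideal L" by (rule kalg_ideal_multilinear)
  have c: "?s (A(k := x \<oplus>\<^bsub>L\<^esub> y)) \<in> carrier ?M" "?s (A(k := x)) \<in> carrier ?M"
    "?s (A(k := y)) \<in> carrier ?M"
    using assms by (auto intro!: single_tuple simp: tuple_monoid_sel)
  have "?s (A(k := x \<oplus>\<^bsub>L\<^esub> y)) - ?s (A(k := x)) - ?s (A(k := y)) \<in> multilinear_ideal L"
    unfolding multilinear_ideal_def
    by (rule subsetD[OF I.genideal_self[OF multilinear_relations_carrier]])
      (use assms in \<open>auto simp: multilinear_relations_def tuple_monoid_sel\<close>)
  then show ?thesis
    unfolding pure_tensor_def tensor_power_def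
    using c by (intro I.coset_plusI) (simp_all add: monoid_algebra_minus)
qed

lemma pure_tensor_smult:
  fixes A :: "'m \<Rightarrow> 'a"
  assumes "\<And>k. A k \<in> carrier L" "x \<in> carrier L"
  shows "pure_tensor L (A(k := c \<odot>\<^bsub>L\<^esub> x)) = c \<odot>\<^bsub>tensor_power L\<^esub> pure_tensor L (A(k := x))"
proof -
  let ?M = "monoid_algebra (tuple_monoid L) :: ('k, ('m \<Rightarrow> 'a) \<Rightarrow>\<^sub>0 'k) module"
  let ?s = "\<lambda>A :: 'm \<Rightarrow> 'a. single A (1 :: 'k)"
  interpret I: kalg_ideal ?M "multilinear_ideal L" by (rule kalg_ideal_multilinear)
  have c: "?s (A(k := c \<odot>\<^bsub>L\<^esub> x)) \<in> carrier ?M" "?s (A(k := x)) \<in> carrier ?M"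
    using assms by (auto intro!: single_tuple simp: tuple_monoid_sel)
  have s: "c \<odot>\<^bsub>?M\<^esub> ?s (A(k := x)) = single (A(k := x)) c"
    by (simp add: monoid_algebra_sel(5) scale_single)
  then have "?s (A(k := c \<odot>\<^bsub>L\<^esub> x)) \<ominus>\<^bsub>?M\<^esub> (c \<odot>\<^bsub>?M\<^esub> ?s (A(k := x))) =
      ?s (A(k := c \<odot>\<^bsub>L\<^esub> x)) - single (A(k := x)) c"
    using monoid_algebra_minus(2)[OF c(1) I.smult_closed[OF c(2), of c]] by simp
  also have "\<dots> \<in> multilinear_ideal L"
    unfolding multilinear_ideal_def
    by (rule subsetD[OF I.genideal_self[OF multilinear_relations_carrier]], unfold
      multilinear_relations_def, rule UnI2)
      (use assms in \<open>auto simp: tuple_monoid_sel\<close>)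
  finally show ?thesis
    using c I.coset_smult[OF c(2)] by (simp add: pure_tensor_def tensor_power_def I.coset_eq_iff)
qed

lemma tensor_power_span:
  assumes "x \<in> carrier (tensor_power L :: ('k, (('m \<Rightarrow> 'a) \<Rightarrow>\<^sub>0 'k) set) module)"
  shows "x \<in> kspan (tensor_power L) (pure_tensor L ` {A. \<forall>k. A k \<in> carrier L})"
proof -
  have "x \<in> kspan (tensor_power L) ((\<lambda>p. multilinear_ideal L +>\<^bsub>monoid_algebra (tuple_monoid L)\<^esub>
    p) `
    (\<lambda>A. single A 1) ` carrier (tuple_monoid L))"
    unfolding tensor_power_def
    by (rule kalg_ideal.kspan_quot[OF kalg_ideal_multilinear _ monoid_algebra_span])
      (use assms in \<open>auto simp: tensor_power_def intro: single_tuple\<close>)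
  moreover have "carrier (tuple_monoid L) = {A :: 'm \<Rightarrow> 'a. \<forall>k. A k \<in> carrier L}"
    by (simp add: tuple_monoid_def)
  ultimately show ?thesis by (simp add: image_image pure_tensor_def[abs_def])
qed

text \<open>Entries are expanded in the spanning set one place at a time: \<open>S\<close> collects
  the places whose entry is still arbitrary. The finitely many places allow \<open>S\<close> to
  reach all of them.\<close>

lemma tensor_power_span_generators:
  assumes W: "W \<subseteq> carrier L" "\<And>x. x \<in> carrier L \<Longrightarrow> x \<in> kspan L W"
    and "x \<in> carrier (tensor_power L :: ('k, (('m::finite \<Rightarrow> 'a) \<Rightarrow>\<^sub>0 'k) set) module)"
  shows "x \<in> kspan (tensor_power L) (pure_tensor L ` {A. \<forall>k. A k \<in> W})"
proof (rule kspan_trans[OF _ tensor_power_span[OF assms(3)]], safe)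
  fix A :: "'m \<Rightarrow> 'a" assume A: "\<forall>k. A k \<in> carrier L"
  interpret T: kalg "tensor_power L :: ('k, (('m \<Rightarrow> 'a) \<Rightarrow>\<^sub>0 'k) set) module"
    by (rule kalg_tensor_power)
  let ?K = "kspan (tensor_power L) (pure_tensor L ` {A :: 'm \<Rightarrow> 'a. \<forall>k. A k \<in> W})"
  have "\<forall>A. (\<forall>k. A k \<in> carrier L) \<and> (\<forall>k. k \<notin> S \<longrightarrow> A k \<in> W) \<longrightarrow> pure_tensor L A \<in> ?K" if "finite S"
    for S
    using that
  proof (induction S)
    case empty
    then show ?case by (auto intro: kspan.base)
  next
    case (insert s S)
    show ?case
    proof safe
      fix A assume A: "\<forall>k. A k \<in> carrier L" "\<forall>k. k \<notin> insert s S \<longrightarrow> A k \<in> W"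
      \<comment> \<open>Membership in the carrier is carried along because additivity and
        homogeneity at place \<open>s\<close> require it of both entries.\<close>
      have "pure_tensor L (A(s := x)) \<in> ?K \<and> x \<in> carrier L" if "x \<in> kspan L W" for x
        using that
      proof induction
        case (base w)
        then show ?case using insert.IH A W(1) by (auto simp: subset_iff)
      next
        case zero
        have "pure_tensor L (A(s := \<zero>\<^bsub>L\<^esub>)) = 0 \<odot>\<^bsub>tensor_power L\<^esub> pure_tensor L (A(s := \<zero>\<^bsub>L\<^esub>))"
          using pure_tensor_smult[of A "\<zero>\<^bsub>L\<^esub>" s 0] A by simp
        also have "\<dots> = \<zero>\<^bsub>tensor_power L\<^esub>"
          using A by (intro T.smult_0 pure_tensor_closed) auto
        finally show ?case by (simp only: kspan.zero L.zero_closed simp_thms)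
      next
        case (add x y)
        then have "x \<in> carrier L" "y \<in> carrier L" by auto
        moreover from this have "pure_tensor L (A(s := x \<oplus>\<^bsub>L\<^esub> y)) =
            pure_tensor L (A(s := x)) \<oplus>\<^bsub>tensor_power L\<^esub> pure_tensor L (A(s := y))"
          by (rule pure_tensor_add[OF A(1)[rule_format]])
        ultimately show ?case using add
          by (simp only: kspan.add L.add.m_closed simp_thms)
      next
        case (smult x c)
        then have "x \<in> carrier L" by auto
        moreover from this have "pure_tensor L (A(s := c \<odot>\<^bsub>L\<^esub> x)) =
            c \<odot>\<^bsub>tensor_power L\<^esub> pure_tensor L (A(s := x))"
          by (rule pure_tensor_smult[OF A(1)[rule_format]])
        ultimately show ?case using smult
          by (simp only: kspan.smult L.smult_closed simp_thms)
      qed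
      from this[of "A s"] show "pure_tensor L A \<in> ?K" using W(2) A(1) by auto
    qed
  qed
  from this[of UNIV] A show "pure_tensor L A \<in> ?K" by auto
qed

text \<open>A multilinear relation at place k, multiplied componentwise by tuples on both sides, is
  again a multilinear relation at place k. A multilinear \<open>F\<close> therefore kills the
  two-sided ideal and not just its generators.\<close>

lemma tensor_power_lift:
  fixes F :: "('m \<Rightarrow> 'a) \<Rightarrow> 'b"
  assumes "kmod B" and F: "\<And>A. (\<And>k. A k \<in> carrier L) \<Longrightarrow> F A \<in> carrier B"
    and add: "\<And>A k x y. (\<And>k. A k \<in> carrier L) \<Longrightarrow> x \<in> carrier L \<Longrightarrow> y \<in> carrier L \<Longrightarrow>
      F (A(k := x \<oplus>\<^bsub>L\<^esub> y)) = F (A(k := x)) \<oplus>\<^bsub>B\<^esub> F (A(k := y))"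
    and smult: "\<And>A k c x. (\<And>k. A k \<in> carrier L) \<Longrightarrow> x \<in> carrier L \<Longrightarrow>
      F (A(k := c \<odot>\<^bsub>L\<^esub> x)) = c \<odot>\<^bsub>B\<^esub> F (A(k := x))"
  obtains G where "klinear (tensor_power L) B G"
    "\<And>A. (\<And>k. A k \<in> carrier L) \<Longrightarrow> G (pure_tensor L A) = F A"
proof -
  let ?M = "monoid_algebra (tuple_monoid L) :: ('k, ('m \<Rightarrow> 'a) \<Rightarrow>\<^sub>0 'k) module"
  let ?s = "\<lambda>A :: 'm \<Rightarrow> 'a. single A (1 :: 'k)"
  interpret B: kmod B by fact
  interpret I: kalg_ideal ?M "multilinear_ideal L" by (rule kalg_ideal_multilinear)
  have lin: "klinear ?M B (lin B F)"
    by (rule klinear_lin[OF assms(1)]) (auto simp: tuple_monoid_sel F)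
  have linF: "lin B F (single A c) = c \<odot>\<^bsub>B\<^esub> F A" if "\<And>k. A k \<in> carrier L" for A c
    by (rule B.lin_single, rule F, rule that)
  have kill: "lin B F (?s C \<otimes>\<^bsub>?M\<^esub> p \<otimes>\<^bsub>?M\<^esub> ?s D) = \<zero>\<^bsub>B\<^esub>"
    if p: "p \<in> multilinear_relations L" and C: "C \<in> carrier (tuple_monoid L)"
      and D: "D \<in> carrier (tuple_monoid L)" for p C D
  proof -
    let ?T = "\<lambda>q. lin B F (?s C \<otimes>\<^bsub>?M\<^esub> q \<otimes>\<^bsub>?M\<^esub> ?s D)"
    have T: "klinear ?M B ?T"
      by (rule klinear_compose[OF I.klinear_mult_r[OF I.klinear_mult_l[OF klinear_ident]] lin])
        (use C D in \<open>auto intro: single_tuple\<close>)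
    have Tk: "?T (single (A(k := z)) c) =
      c \<odot>\<^bsub>B\<^esub> F ((\<lambda>l. C l \<otimes>\<^bsub>L\<^esub> A l \<otimes>\<^bsub>L\<^esub> D l)(k := C k \<otimes>\<^bsub>L\<^esub> z \<otimes>\<^bsub>L\<^esub> D k))"
      if "\<And>k. A k \<in> carrier L" "z \<in> carrier L" for A k z c
    proof -
      have "(\<lambda>l. C l \<otimes>\<^bsub>L\<^esub> (A(k := z)) l \<otimes>\<^bsub>L\<^esub> D l) =
        (\<lambda>l. C l \<otimes>\<^bsub>L\<^esub> A l \<otimes>\<^bsub>L\<^esub> D l)(k := C k \<otimes>\<^bsub>L\<^esub> z \<otimes>\<^bsub>L\<^esub> D k)" by auto
      moreover have "lin B F (single (\<lambda>l. C l \<otimes>\<^bsub>L\<^esub> (A(k := z)) l \<otimes>\<^bsub>L\<^esub> D l) c) =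
        c \<odot>\<^bsub>B\<^esub> F (\<lambda>l. C l \<otimes>\<^bsub>L\<^esub> (A(k := z)) l \<otimes>\<^bsub>L\<^esub> D l)"
        by (rule linF) (use that C D in \<open>auto simp: tuple_monoid_sel\<close>)
      ultimately show ?thesis by (simp add: monoid_algebra_mult_single tuple_monoid_sel(2))
    qed
    have CAD: "C l \<otimes>\<^bsub>L\<^esub> A l \<otimes>\<^bsub>L\<^esub> D l \<in> carrier L" if "\<And>k. A k \<in> carrier L" for A l
      using that C D by (auto simp: tuple_monoid_sel)
    have Cl: "C l \<in> carrier L" "D l \<in> carrier L" for l
      using C D by (auto simp: tuple_monoid_sel)
    have sc: "single (A(k := z)) c \<in> carrier ?M"
      if "\<And>k. A k \<in> carrier L" "z \<in> carrier L" for A k z c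
      using that by (intro single_tuple) (simp add: tuple_monoid_sel)
    consider A k x y where "p = ?s (A(k := x \<oplus>\<^bsub>L\<^esub> y)) - ?s (A(k := x)) - ?s (A(k := y))"
        "\<And>k. A k \<in> carrier L" "x \<in> carrier L" "y \<in> carrier L"
      | A k c x where "p = ?s (A(k := c \<odot>\<^bsub>L\<^esub> x)) - single (A(k := x)) c"
        "\<And>k. A k \<in> carrier L" "x \<in> carrier L"
      using p unfolding multilinear_relations_def tuple_monoid_sel by blast
    then show ?thesis
    proof cases
      case 1
      then have s: "?s (A(k := x \<oplus>\<^bsub>L\<^esub> y)) \<in> carrier ?M" "?s (A(k := x)) \<in> carrier ?M"
        "?s (A(k := y)) \<in> carrier ?M"
        by (auto intro!: sc)
      have "p = ?s (A(k := x \<oplus>\<^bsub>L\<^esub> y)) \<ominus>\<^bsub>?M\<^esub> ?s (A(k := x)) \<ominus>\<^bsub>?M\<^esub> ?s (A(k := y))"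
        using s 1(1) monoid_algebra_minus by metis
      then have "?T p = ?T (?s (A(k := x \<oplus>\<^bsub>L\<^esub> y))) \<ominus>\<^bsub>B\<^esub> ?T (?s (A(k := x))) \<ominus>\<^bsub>B\<^esub> ?T
        (?s (A(k := y)))"
        using s I.minus_closed[OF s(1,2)] by (simp add: klinear_minus[OF I.kmod_axioms assms(1) T])
      moreover have "?T (?s (A(k := x \<oplus>\<^bsub>L\<^esub> y))) = ?T (?s (A(k := x))) \<oplus>\<^bsub>B\<^esub> ?T (?s (A(k := y)))"
        using 1 Cl CAD[OF 1(2)] by (simp add: Tk L.r_distr L.l_distr add F)
      moreover have "?T (?s (A(k := x))) \<in> carrier B" "?T (?s (A(k := y))) \<in> carrier B"
        using klinear_closed[OF T] s by auto
      ultimately show ?thesis by (simp add: B.plus_minus_minus)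
    next
      case 2
      then have s: "?s (A(k := c \<odot>\<^bsub>L\<^esub> x)) \<in> carrier ?M" "single (A(k := x)) c \<in> carrier ?M"
        by (auto intro!: sc)
      have "p = ?s (A(k := c \<odot>\<^bsub>L\<^esub> x)) \<ominus>\<^bsub>?M\<^esub> single (A(k := x)) c"
        using s 2(1) monoid_algebra_minus by metis
      then have "?T p = ?T (?s (A(k := c \<odot>\<^bsub>L\<^esub> x))) \<ominus>\<^bsub>B\<^esub> ?T (single (A(k := x)) c)"
        using s by (simp add: klinear_minus[OF I.kmod_axioms assms(1) T])
      moreover have "?T (?s (A(k := c \<odot>\<^bsub>L\<^esub> x))) = ?T (single (A(k := x)) c)"
        using 2 Cl CAD[OF 2(2)] by (simp add: Tk L.smult_mult_r L.smult_mult_l smult F)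
      moreover have "?T (single (A(k := x)) c) \<in> carrier B"
        using klinear_closed[OF T] s by auto
      ultimately show ?thesis by (simp add: a_minus_def B.r_neg)
    qed
  qed
  have killI: "lin B F p = \<zero>\<^bsub>B\<^esub>" if "p \<in> multilinear_ideal L" for p
    by (rule I.klinear_kills_Idl[OF assms(1) lin multilinear_relations_carrier _
      monoid_algebra_span _
          that[unfolded multilinear_ideal_def]])
      (use kill in \<open>auto intro: single_tuple\<close>)
  show thesis
  proof (rule I.klinear_descend[OF assms(1) lin killI])
    fix G assume G: "klinear (quot_alg ?M (multilinear_ideal L)) B G"
      "\<And>x. x \<in> carrier ?M \<Longrightarrow> G (multilinear_ideal L +>\<^bsub>?M\<^esub> x) = lin B F x"
    show thesis
    proof (rule that[of G])
      show "klinear (tensor_power L) B G" unfolding tensor_power_def by (rule G(1))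
      show "G (pure_tensor L A) = F A" if "\<And>k. A k \<in> carrier L" for A
        unfolding pure_tensor_def using that G(2)[OF single_tuple, of A 1] linF[of A 1] F[of A]
        by (simp add: tuple_monoid_sel)
    qed
  qed
qed

end

section \<open>The exterior algebra\<close>

lemma extensor_eq: "extensor sc w = wprod (exterior sc) (ext_vec sc) w"
  by (simp add: extensor_def wprod_def)

lemma kalg_exterior: "kalg (exterior sc)"
  unfolding exterior_def ext_ideal_def by (rule kalg_ideal.kalg_quot[OF kalg_ideal_Idl_free])

lemma kalg_ideal_ext: "kalg_ideal free_algebra (ext_ideal sc)"
  unfolding ext_ideal_def by (rule kalg_ideal_Idl_free)

lemma ext_ideal_self: "ext_relations sc \<subseteq> ext_ideal sc"
proof -
  interpret kalg free_algebra by (rule kalg_free_algebra)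
  show ?thesis unfolding ext_ideal_def by (rule genideal_self) (simp add: free_algebra_sel)
qed

lemma ext_vec_closed: "ext_vec sc v \<in> carrier (exterior sc)"
  unfolding exterior_def ext_vec_def by (rule coset_in_carrier) (simp add: free_algebra_sel)

lemma ext_vec_linear:
  "ext_vec sc (sc a u + sc b v) =
    a \<odot>\<^bsub>exterior sc\<^esub> ext_vec sc u \<oplus>\<^bsub>exterior sc\<^esub> b \<odot>\<^bsub>exterior sc\<^esub> ext_vec sc v"
proof -
  interpret I: kalg_ideal free_algebra "ext_ideal sc" by (rule kalg_ideal_ext)
  have c: "x \<in> carrier free_algebra" for x by (simp add: free_algebra_sel)
  let ?x = "gen (sc a u + sc b v)" and ?y = "a \<odot>\<^bsub>free_algebra\<^esub> gen u"
    and ?z = "b \<odot>\<^bsub>free_algebra\<^esub> gen v"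
  have "?x \<ominus>\<^bsub>free_algebra\<^esub> ?y \<ominus>\<^bsub>free_algebra\<^esub> ?z \<in> ext_ideal sc"
    by (rule subsetD[OF ext_ideal_self], unfold ext_relations_def) blast
  then have "ext_ideal sc +>\<^bsub>free_algebra\<^esub> ?x =
      (ext_ideal sc +>\<^bsub>free_algebra\<^esub> ?y) \<oplus>\<^bsub>exterior sc\<^esub> (ext_ideal sc +>\<^bsub>free_algebra\<^esub> ?z)"
    unfolding exterior_def by (intro I.coset_plusI c)
  then show ?thesis
    by (simp add: ext_vec_def exterior_def I.coset_smult[OF c])
qed

interpretation exterior: skew_alg "exterior sc" "ext_vec sc"
  for sc :: "'k::field \<Rightarrow> 'v::ab_group_add \<Rightarrow> 'v"
proof -
  interpret I: kalg_ideal free_algebra "ext_ideal sc" by (rule kalg_ideal_ext)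
  interpret E: kalg "exterior sc" by (rule kalg_exterior)
  have c: "x \<in> carrier free_algebra" for x by (simp add: free_algebra_sel)
  note cl = ext_vec_closed[of sc]
  have sq: "ext_vec sc v \<otimes>\<^bsub>exterior sc\<^esub> ext_vec sc v = \<zero>\<^bsub>exterior sc\<^esub>" for v
  proof -
    have "gen v \<otimes>\<^bsub>free_algebra\<^esub> gen v \<in> ext_ideal sc"
      by (rule subsetD[OF ext_ideal_self], unfold ext_relations_def) blast
    then show ?thesis
      by (simp add: ext_vec_def exterior_def I.coset_mult[OF c c] I.coset_eq_zero_iff[OF c])
  qed
  have "ext_vec sc u \<otimes>\<^bsub>exterior sc\<^esub> ext_vec sc v \<oplus>\<^bsub>exterior sc\<^esub> ext_vec sc v \<otimes>\<^bsub>exterior sc\<^esub>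
    ext_vec sc u = \<zero>\<^bsub>exterior sc\<^esub>"
    for u v
    \<comment> \<open>Expanding the square of u + v; the sum is written in the shape to which
      \<open>ext_vec_linear\<close> applies.\<close>
    using sq[of "sc 1 u + sc 1 v"] unfolding ext_vec_linear
    by (simp add: cl E.l_distr E.r_distr sq E.a_comm)
  then show "skew_alg (exterior sc) (ext_vec sc)"
    using cl sq by unfold_locales auto
qed

lemma extensor_coset: "ext_ideal sc +>\<^bsub>free_algebra\<^esub> single w 1 = extensor sc w"
proof -
  interpret I: kalg_ideal free_algebra "ext_ideal sc" by (rule kalg_ideal_ext)
  show ?thesis
    using ring_hom_wprod[OF I.ring_hom_coset I.monoid_axioms, of w gen]
    by (simp add: free_algebra_sel wprod_gen extensor_eq ext_vec_def[abs_def] exterior_def)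
qed

lemma extensor_closed [simp, intro]: "extensor sc w \<in> carrier (exterior sc)"
  by (simp add: extensor_eq)

lemma exterior_span: "x \<in> carrier (exterior sc) \<Longrightarrow> x \<in> kspan (exterior sc) (range (extensor sc))"
  using free_quot_span[of x "ext_relations sc"]
  unfolding extensor_eq[abs_def] ext_vec_def[abs_def] exterior_def ext_ideal_def by simp

lemma exterior_lift:
  fixes sc :: "'k::field \<Rightarrow> 'v::ab_group_add \<Rightarrow> 'v"
  assumes "kalg B" "\<And>v. f v \<in> carrier B" "\<And>v. f v \<otimes>\<^bsub>B\<^esub> f v = \<zero>\<^bsub>B\<^esub>"
    and lin: "\<And>a b u v. f (sc a u + sc b v) = a \<odot>\<^bsub>B\<^esub> f u \<oplus>\<^bsub>B\<^esub> b \<odot>\<^bsub>B\<^esub> f v"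
  obtains L where "klinear (exterior sc) B L" "\<And>w. L (extensor sc w) = wprod B f w"
proof -
  interpret B: kalg B by fact
  interpret F: kalg "free_algebra :: ('k, 'v list \<Rightarrow>\<^sub>0 'k) module" by (rule kalg_free_algebra)
  let ?F = "free_algebra :: ('k, 'v list \<Rightarrow>\<^sub>0 'k) module"
  interpret W: word_alg B f by unfold_locales (rule assms(2))
  have wcl: "wprod B f w \<in> carrier B" for w by simp
  have L: "klinear ?F B (lin B (wprod B f))" by (rule klinear_lin_free[OF B.kmod_axioms]) simp
  have c: "x \<in> carrier ?F" for x by (simp add: free_algebra_sel)
  have kill: "lin B (wprod B f) (single u 1 \<otimes>\<^bsub>?F\<^esub> s \<otimes>\<^bsub>?F\<^esub> single v 1) = \<zero>\<^bsub>B\<^esub>"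
    if s: "s \<in> ext_relations sc" for s u v
  proof -
    let ?T = "\<lambda>q. lin B (wprod B f) (single u 1 \<otimes>\<^bsub>?F\<^esub> q \<otimes>\<^bsub>?F\<^esub> single v 1)"
    have T: "klinear ?F B ?T"
      by (rule klinear_compose[OF F.klinear_mult_r[OF F.klinear_mult_l[OF klinear_ident c] c] L])
    have Tw: "?T (single w 1) = wprod B f u \<otimes>\<^bsub>B\<^esub> wprod B f w \<otimes>\<^bsub>B\<^esub> wprod B f v" for w
      by (simp add: free_algebra_mult_single B.lin_single W.wd_append B.m_assoc)
    consider a b x y where "s = gen (sc a x + sc b y) \<ominus>\<^bsub>?F\<^esub> (a \<odot>\<^bsub>?F\<^esub> gen x) \<ominus>\<^bsub>?F\<^esub> (b \<odot>\<^bsub>?F\<^esub> gen y)"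
      | x where "s = gen x \<otimes>\<^bsub>?F\<^esub> gen x"
      using s unfolding ext_relations_def by blast
    then show ?thesis
    proof cases
      case 1
      have "?T s = ?T (gen (sc a x + sc b y)) \<ominus>\<^bsub>B\<^esub> a \<odot>\<^bsub>B\<^esub> ?T (gen x) \<ominus>\<^bsub>B\<^esub> b \<odot>\<^bsub>B\<^esub> ?T (gen y)"
        unfolding 1 by (simp only: klinear_minus[OF F.kmod_axioms B.kmod_axioms T c c]
          klinear_smult[OF T c])
      also have "?T (gen (sc a x + sc b y)) = a \<odot>\<^bsub>B\<^esub> ?T (gen x) \<oplus>\<^bsub>B\<^esub> b \<odot>\<^bsub>B\<^esub> ?T (gen y)"
        unfolding gen_def Tw
        by (simp add: lin assms(2) B.l_distr B.r_distr B.smult_mult_l B.smult_mult_r)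
      also have "\<dots> \<ominus>\<^bsub>B\<^esub> a \<odot>\<^bsub>B\<^esub> ?T (gen x) \<ominus>\<^bsub>B\<^esub> b \<odot>\<^bsub>B\<^esub> ?T (gen y) = \<zero>\<^bsub>B\<^esub>"
        using klinear_closed[OF T c] by (intro B.plus_minus_minus) auto
      finally show ?thesis .
    next
      case 2
      have "s = single [x, x] 1" by (simp add: 2 gen_def free_algebra_mult_single)
      then have "?T s = wprod B f u \<otimes>\<^bsub>B\<^esub> wprod B f [x, x] \<otimes>\<^bsub>B\<^esub> wprod B f v" by (simp only: Tw)
      then show ?thesis using assms(2,3) by simp
    qed
  qed
  show thesis
  proof (rule free_quot_hom[where S = "ext_relations sc"
    and f = "wprod B f", OF B.kmod_axioms wcl kill])
    fix L assume "klinear (free_quot (ext_relations sc)) B L"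
      "\<And>w. L (wprod (free_quot (ext_relations sc))
        (free_gen (ext_relations sc)) w) = wprod B f w"
    then show thesis
      by (intro that[of L]) (simp_all add: exterior_def extensor_eq ext_vec_def[abs_def]
        ext_ideal_def)
  qed
qed

lemma ext_component_span:
  assumes "A \<in> ext_component sc a"
  shows "A \<in> kspan (exterior sc) (extensor sc ` {w. length w = a})"
proof -
  interpret I: kalg_ideal free_algebra "ext_ideal sc" by (rule kalg_ideal_ext)
  obtain f where f: "A = ext_ideal sc +>\<^bsub>free_algebra\<^esub> f" "keys f \<subseteq> {w. length w = a}"
    using assms by (auto simp: ext_component_def)
  have c: "x \<in> carrier free_algebra" for x by (simp add: free_algebra_sel)
  show ?thesis unfolding f(1) using f(2)
  proof (induction rule: poly_mapping_support_induct)
    case zero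
    then show ?case
      using I.coset_zero kspan.zero[of "exterior sc"] by (simp add: exterior_def free_algebra_sel)
  next
    case (single w x)
    have "ext_ideal sc +>\<^bsub>free_algebra\<^esub> single w x = x \<odot>\<^bsub>exterior sc\<^esub> extensor sc w"
      using I.coset_smult[OF c, of x "single w 1"]
      by (simp add: extensor_coset exterior_def free_algebra_sel(5) scale_single)
    then show ?case using single by (auto intro: kspan.smult kspan.base)
  next
    case (add p q)
    then show ?case
      using I.coset_add[OF c c, of p q] kspan.add[of _ "exterior sc"]
      by (metis exterior_def free_algebra_sel(4))
  qed
qed

lemma extensor_in_component: "extensor sc w \<in> ext_component sc (length w)"
  unfolding ext_component_def extensor_coset[symmetric] by force

section \<open>The isomorphism\<close>

definition place_list :: "'m::{finite,linorder} list" where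
  "place_list = sorted_list_of_set UNIV"

lemma place_list: "sorted place_list" "distinct place_list" "set place_list = UNIV"
  by (simp_all add: place_list_def)

lemma wprod_concat:
  assumes "Group.monoid R" "\<And>x. g x \<in> carrier R"
  shows "wprod R g (concat (map f ks)) = wprod R (\<lambda>k. wprod R g (f k)) ks"
proof -
  interpret Group.monoid R by fact
  show ?thesis using assms(2) by (induction ks) (simp_all add: wprod_append)
qed

text \<open>Isolates the factor at place i, so that an ordered product can be recognised as linear
  in that factor.\<close>

lemma wprod_upd:
  assumes "Group.monoid R" "\<And>k. X k \<in> carrier R" "y \<in> carrier R" "distinct (k1 @ i # k2)"
  shows "wprod R (X(i := y)) (k1 @ i # k2) = wprod R X k1 \<otimes>\<^bsub>R\<^esub> (y \<otimes>\<^bsub>R\<^esub> wprod R X k2)"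
proof -
  interpret Group.monoid R by fact
  have "wprod R (X(i := y)) (k1 @ i # k2) = wprod R (X(i := y)) k1 \<otimes>\<^bsub>R\<^esub> wprod R (X(i := y))
    (i # k2)"
    by (rule wprod_append) (use assms in auto)
  moreover have "wprod R (X(i := y)) k1 = wprod R X k1" "wprod R (X(i := y)) k2 = wprod R X k2"
    using assms(4) by (auto intro!: wprod_cong)
  ultimately show ?thesis by simp
qed

lemma inversions_zero: "sorted_wrt (\<lambda>x y. \<not> r y x) w \<Longrightarrow> inversions r w = 0"
  by (induction w) (auto simp: filter_empty_conv)

definition places :: "('v \<times> 'm) list \<Rightarrow> 'm \<Rightarrow> 'v list" where
  "places u k = map fst (filter (\<lambda>p. snd p = k) u)"

text \<open>The section of \<open>places\<close> whose words are sorted by place and so have no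
  inversions of places.\<close>

definition place_word :: "('m::{finite,linorder} \<Rightarrow> 'v list) \<Rightarrow> ('v \<times> 'm) list" where
  "place_word w = concat (map (\<lambda>k. map (\<lambda>v. (v, k)) (w k)) place_list)"

lemma places_append: "places (u @ v) k = places u k @ places v k"
  by (simp add: places_def)

lemma places_Cons: "places (x # v) = (\<lambda>k. if k = snd x then fst x # places v k else places v k)"
  by (auto simp: places_def)

lemma places_place_word: "places (place_word w) = w"
proof
  fix k
  have "places (concat (map (\<lambda>k. map (\<lambda>v. (v, k)) (w k)) ks)) k = (if k \<in> set ks then w k else [])"
    if "distinct ks" for ks
    using that by (induction ks) (auto simp: places_def filter_map comp_def filter_empty_conv)
  then show "places (place_word w) k = w k" by (simp add: place_word_def place_list)
qed

lemma inversions_place_word: "inversions (\<lambda>y x. snd y < snd x) (place_word w) = 0"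
proof (rule inversions_zero)
  have "sorted_wrt (\<lambda>x y. \<not> snd y < snd x) (concat (map (\<lambda>k. map (\<lambda>v. (v, k)) (w k)) ks))"
    if "sorted ks" for ks
    using that by (induction ks) (auto simp: sorted_wrt_append sorted_wrt_map not_less)
  then show "sorted_wrt (\<lambda>x y. \<not> snd y < snd x) (place_word w)"
    by (simp add: place_word_def place_list)
qed

text \<open>The algebra map from \<Lambda>(V) that sends v to (v|k). It is chosen as a linear map
  with given values on extensors; \<open>iota_mult\<close> supplies the multiplicativity.\<close>

definition iota :: "('k::field \<Rightarrow> 'v::ab_group_add \<Rightarrow> 'v) \<Rightarrow> 'm \<Rightarrow> ('v, 'k) ext \<Rightarrow> ('v, 'm, 'k) kskew
  set" where
  "iota sc k = (SOME L. klinear (exterior sc) (lp_quot sc) L \<and>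
    (\<forall>w. L (extensor sc w) = quot_word sc (map (\<lambda>v. (v, k)) w)))"

context
  fixes sc :: "'k::field \<Rightarrow> 'v::ab_group_add \<Rightarrow> 'v"
begin

lemma iota:
  fixes k :: 'm
  shows "klinear (exterior sc) (lp_quot sc) (iota sc k)"
    "iota sc k (extensor sc w) = quot_word sc (map (\<lambda>v. (v, k)) w)"
proof -
  have "\<exists>L. klinear (exterior sc) (lp_quot sc) L \<and>
    (\<forall>w. L (extensor sc w) = quot_word sc (map (\<lambda>v. (v, k)) w))"
  proof (rule exterior_lift[of "lp_quot sc" "\<lambda>v. quot_letter sc (v, k)" sc, OF lp_quot.kalg_axioms])
    fix L assume "klinear (exterior sc) (lp_quot sc) L"
      "\<And>w. L (extensor sc w) = wprod (lp_quot sc) (\<lambda>v. quot_letter sc (v, k)) w"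
    then show ?thesis by (intro exI[of _ L]) (simp add: wprod_map)
  qed (simp_all add: lp_quot.g_square quot_letter_linear)
  from someI_ex[OF this]
  show "klinear (exterior sc) (lp_quot sc) (iota sc k)"
    "iota sc k (extensor sc w) = quot_word sc (map (\<lambda>v. (v, k)) w)"
    unfolding iota_def by auto
qed

lemma iota_closed: "x \<in> carrier (exterior sc) \<Longrightarrow> iota sc k x \<in> carrier (lp_quot sc)"
  by (rule klinear_closed[OF iota(1)])

lemma iota_one: "iota sc k \<one>\<^bsub>exterior sc\<^esub> = \<one>\<^bsub>lp_quot sc\<^esub>"
  using iota(2)[of k "[]"] by (simp add: extensor_eq)

lemma iota_mult:
  fixes k :: 'm
  assumes "x \<in> carrier (exterior sc)" "y \<in> carrier (exterior sc)"
  shows "iota sc k (x \<otimes>\<^bsub>exterior sc\<^esub> y) = iota sc k x \<otimes>\<^bsub>lp_quot sc\<^esub> iota sc k y"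
proof (rule exterior.bilinear_eq_on_words[OF exterior_span[unfolded extensor_eq[abs_def]]
  lp_quot.kmod_axioms,
      where f = "\<lambda>x y. iota sc k (x \<otimes>\<^bsub>exterior sc\<^esub> y)"
        and f' = "\<lambda>x y. iota sc k x \<otimes>\<^bsub>lp_quot sc\<^esub> iota sc k y"])
  note l = iota(1)[of k]
  show "klinear (exterior sc) (lp_quot sc) (\<lambda>x. iota sc k (x \<otimes>\<^bsub>exterior sc\<^esub> y))"
    if "y \<in> carrier (exterior sc)" for y
    by (rule klinear_compose[OF exterior.klinear_mult_r[OF klinear_ident that] l])
  show "klinear (exterior sc) (lp_quot sc) (\<lambda>x. iota sc k x \<otimes>\<^bsub>lp_quot sc\<^esub> iota sc k y)"
    if "y \<in> carrier (exterior sc)" for y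
    by (rule lp_quot.klinear_mult_r[OF l iota_closed[OF that]])
  show "klinear (exterior sc) (lp_quot sc) (\<lambda>y. iota sc k (wprod (exterior sc) (ext_vec sc) u
    \<otimes>\<^bsub>exterior sc\<^esub> y))" for u
    by (rule klinear_compose[OF exterior.klinear_mult_l[OF klinear_ident exterior.wd_closed] l])
  show "klinear (exterior sc) (lp_quot sc) (\<lambda>y. iota sc k (wprod (exterior sc) (ext_vec sc) u)
    \<otimes>\<^bsub>lp_quot sc\<^esub> iota sc k y)" for u
    by (rule lp_quot.klinear_mult_l[OF l iota_closed[OF exterior.wd_closed]])
  show "iota sc k (wprod (exterior sc) (ext_vec sc) u \<otimes>\<^bsub>exterior sc\<^esub> wprod (exterior sc)
    (ext_vec sc) v) =
    iota sc k (wprod (exterior sc) (ext_vec sc) u) \<otimes>\<^bsub>lp_quot sc\<^esub> iota sc k (wprod (exterior sc)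
      (ext_vec sc) v)" for u v
    unfolding exterior.wd_append[symmetric]
    by (simp add: iota(2)[unfolded extensor_eq] lp_quot.wd_append)
qed (use assms in \<open>auto simp: extensor_eq[abs_def]\<close>)

text \<open>On extensors this is the exchange of two words in anticommuting letters. Homogeneous
  elements are combinations of extensors of one step, so a single sign serves all terms. The places
  may coincide.\<close>

lemma iota_supercommute:
  fixes k l :: 'm
  assumes "x \<in> ext_component sc a" "y \<in> ext_component sc b"
  shows "iota sc k x \<otimes>\<^bsub>lp_quot sc\<^esub> iota sc l y =
    (- 1) ^ (a * b) \<odot>\<^bsub>lp_quot sc\<^esub> (iota sc l y \<otimes>\<^bsub>lp_quot sc\<^esub> iota sc k x)"
proof -
  let ?P = "lp_quot sc" and ?E = "exterior sc"
  let ?W = "\<lambda>a. extensor sc ` {w. length w = a}"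
  have W: "?W a \<subseteq> carrier ?E" for a by auto
  have xy: "x \<in> kspan ?E (?W a)" "y \<in> kspan ?E (?W b)" using assms ext_component_span by auto
  have xc: "x \<in> carrier ?E" "y \<in> carrier ?E"
    using xy exterior.kspan_closed[OF W] by auto
  have 1: "iota sc k x \<otimes>\<^bsub>?P\<^esub> iota sc l y = (- 1) ^ (a * b) \<odot>\<^bsub>?P\<^esub> (iota sc l y \<otimes>\<^bsub>?P\<^esub> iota sc k x)"
    if x: "x \<in> ?W a" for x
  proof (rule klinear_eq_on_kspan[OF exterior.kmod_axioms lp_quot.kmod_axioms _ _ W _ xy(2)])
    have c: "iota sc k x \<in> carrier ?P" using x W by (intro iota_closed) auto
    show "klinear ?E ?P (\<lambda>y. iota sc k x \<otimes>\<^bsub>?P\<^esub> iota sc l y)"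
      by (rule lp_quot.klinear_mult_l[OF iota(1) c])
    show "klinear ?E ?P (\<lambda>y. (- 1) ^ (a * b) \<odot>\<^bsub>?P\<^esub> (iota sc l y \<otimes>\<^bsub>?P\<^esub> iota sc k x))"
      by (rule lp_quot.klinear_scale[OF lp_quot.klinear_mult_r[OF iota(1) c]])
    fix y assume "y \<in> ?W b"
    with x obtain u v where "x = extensor sc u" "length u = a" "y = extensor sc v" "length v = b"
      by auto
    then show "iota sc k x \<otimes>\<^bsub>?P\<^esub> iota sc l y = (- 1) ^ (a * b) \<odot>\<^bsub>?P\<^esub> (iota sc l y \<otimes>\<^bsub>?P\<^esub> iota sc k
      x)"
      using lp_quot.move_word[of sc "map (\<lambda>v. (v, k)) u" "map (\<lambda>v. (v, l)) v"]
      by (simp add: iota(2))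
  qed
  have c: "iota sc l y \<in> carrier ?P" by (rule iota_closed[OF xc(2)])
  show ?thesis
    by (rule klinear_eq_on_kspan[OF exterior.kmod_axioms lp_quot.kmod_axioms
          lp_quot.klinear_mult_r[OF iota(1) c]
          lp_quot.klinear_scale[OF lp_quot.klinear_mult_l[OF iota(1) c]] W 1 xy(1)])
qed

abbreviation tp :: "('k, ('m::{finite,linorder}, 'v, 'k) ext_power) module" where
  "tp \<equiv> tensor_power (exterior sc)"

abbreviation extensor_tensor :: "('m::{finite,linorder} \<Rightarrow> 'v list) \<Rightarrow> ('m, 'v, 'k) ext_power" where
  "extensor_tensor w \<equiv> ext_tensor sc (\<lambda>k. extensor sc (w k))"

interpretation T: kalg "tp :: ('k, ('m::{finite,linorder}, 'v, 'k) ext_power) module"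
  by (rule kalg_tensor_power[OF kalg_exterior])

lemma ext_tensor_closed: "(\<And>k. A k \<in> carrier (exterior sc)) \<Longrightarrow> ext_tensor sc A \<in> carrier tp"
  unfolding ext_tensor_def by (rule pure_tensor_closed[OF kalg_exterior])

lemma extensor_tensor_closed [simp]: "extensor_tensor w \<in> carrier tp"
  by (rule ext_tensor_closed) simp

lemma extensor_tensor_span:
  assumes "x \<in> carrier (tp :: ('k, ('m::{finite,linorder}, 'v, 'k) ext_power) module)"
  shows "x \<in> kspan tp (range extensor_tensor)"
proof -
  have "pure_tensor (exterior sc) ` {A :: 'm \<Rightarrow> _. \<forall>k. A k \<in> range (extensor sc)} \<subseteq> range
    extensor_tensor"
  proof safe
    fix A :: "'m \<Rightarrow> ('v, 'k) ext" assume "\<forall>k. A k \<in> range (extensor sc)"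
    then have "\<forall>k. \<exists>w. A k = extensor sc w" by auto
    then obtain w where "\<And>k. A k = extensor sc (w k)" by metis
    then have "A = (\<lambda>k. extensor sc (w k))" by auto
    then show "pure_tensor (exterior sc) A \<in> range extensor_tensor" by (auto simp: ext_tensor_def)
  qed
  moreover have "x \<in> kspan tp (pure_tensor (exterior sc) ` {A. \<forall>k. A k \<in> range (extensor sc)})"
    by (rule tensor_power_span_generators[OF kalg_exterior _ exterior_span assms]) auto
  ultimately show ?thesis by (metis (no_types, lifting) kspan.base kspan_trans subset_iff)
qed

subsection \<open>From the tensor power to the quotient\<close>

lemma ordered_product_linear:
  fixes A :: "'m::{finite,linorder} \<Rightarrow> ('v, 'k) ext" and i :: 'm
  assumes A: "\<And>k. A k \<in> carrier (exterior sc)"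
  shows "klinear (exterior sc) (lp_quot sc) (\<lambda>x. wprod (lp_quot sc) (\<lambda>k. iota sc k
    ((A(i := x)) k)) place_list)"
proof -
  obtain k1 k2 where k: "place_list = k1 @ i # k2"
    using split_list[of i place_list] place_list(3) by auto
  let ?X = "\<lambda>k. iota sc k (A k)"
  have X: "?X k \<in> carrier (lp_quot sc)" for k by (rule iota_closed[OF A])
  have eq: "wprod (lp_quot sc) (\<lambda>k. iota sc k ((A(i := x)) k)) place_list =
    wprod (lp_quot sc) ?X k1 \<otimes>\<^bsub>lp_quot sc\<^esub> (iota sc i x \<otimes>\<^bsub>lp_quot sc\<^esub> wprod (lp_quot sc) ?X k2)"
    if "x \<in> carrier (exterior sc)" for x
  proof -
    have "(\<lambda>k. iota sc k ((A(i := x)) k)) = ?X(i := iota sc i x)" by (rule ext) simp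
    moreover have "distinct (k1 @ i # k2)" unfolding k[symmetric] by (rule place_list(2))
    ultimately show ?thesis
      using wprod_upd[OF lp_quot.monoid_axioms X iota_closed[OF that], of k1 i k2] k by simp
  qed
  have "klinear (exterior sc) (lp_quot sc)
    (\<lambda>x. wprod (lp_quot sc) ?X k1 \<otimes>\<^bsub>lp_quot sc\<^esub> (iota sc i x \<otimes>\<^bsub>lp_quot sc\<^esub> wprod (lp_quot sc) ?X
      k2))"
    by (intro lp_quot.klinear_mult_l lp_quot.klinear_mult_r iota(1) lp_quot.wprod_closed X)
  then show ?thesis by (rule klinear_cong[OF _ eq[symmetric] exterior.kmod_axioms])
qed

lemma ex_Psi:
  "\<exists>G. klinear (tp :: ('k, ('m::{finite,linorder}, 'v, 'k) ext_power) module) (lp_quot sc) G \<and>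
    (\<forall>A. (\<forall>k. A k \<in> carrier (exterior sc)) \<longrightarrow>
      G (ext_tensor sc A) = wprod (lp_quot sc) (\<lambda>k. iota sc k (A k)) place_list)"
proof (rule tensor_power_lift[OF kalg_exterior, where B = "lp_quot sc" and
      F = "\<lambda>A. wprod (lp_quot sc) (\<lambda>k :: 'm. iota sc k (A k)) place_list"])
  show "kmod (lp_quot sc)" by (rule lp_quot.kmod_axioms)
  show "wprod (lp_quot sc) (\<lambda>k :: 'm. iota sc k (A k)) place_list \<in> carrier (lp_quot sc)"
    if "\<And>k. A k \<in> carrier (exterior sc)" for A
    by (intro lp_quot.wprod_closed iota_closed that)
qed (auto simp: ext_tensor_def klinear_add[OF ordered_product_linear] klinear_smult[OF
  ordered_product_linear] simp del: fun_upd_apply)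

definition Psi :: "('m::{finite,linorder}, 'v, 'k) ext_power \<Rightarrow> ('v, 'm, 'k) kskew set" where
  "Psi = (SOME G. klinear tp (lp_quot sc) G \<and>
    (\<forall>A. (\<forall>k. A k \<in> carrier (exterior sc)) \<longrightarrow>
      G (ext_tensor sc A) = wprod (lp_quot sc) (\<lambda>k. iota sc k (A k)) place_list))"

lemma Psi_linear: "klinear tp (lp_quot sc) Psi"
  and Psi_tensor: "(\<And>k. A k \<in> carrier (exterior sc)) \<Longrightarrow>
    Psi (ext_tensor sc A) = wprod (lp_quot sc) (\<lambda>k. iota sc k (A k)) place_list"
  using someI_ex[OF ex_Psi] unfolding Psi_def by auto

lemma Psi_extensor_tensor: "Psi (extensor_tensor w) = quot_word sc (place_word w)"
  by (simp add: Psi_tensor iota(2) place_word_def wprod_concat[OF lp_quot.monoid_axioms])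

text \<open>A new first letter moves right across the blocks of all smaller places, to the front of
  its own block. The exponent may stay unspecified, since only the surjectivity of
  \<open>Psi\<close> is at stake.\<close>

lemma word_is_sorted_word:
  fixes u :: "('v \<times> 'm::{finite,linorder}) list"
  shows "\<exists>n. quot_word sc u = (- 1) ^ n \<odot>\<^bsub>lp_quot sc\<^esub> quot_word sc (place_word (places u))"
proof (induction u)
  case Nil
  have "place_word (places []) = ([] :: ('v \<times> 'm) list)" by (simp add: place_word_def places_def)
  then show ?case by (intro exI[of _ 0]) simp
next
  case (Cons x u)
  let ?P = "lp_quot sc" and ?wd = "quot_word sc :: ('v \<times> 'm) list \<Rightarrow> _"
  obtain n where n: "?wd u = (- 1) ^ n \<odot>\<^bsub>?P\<^esub> ?wd (place_word (places u))" using Cons by auto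
  obtain k1 k2 where k: "place_list = k1 @ snd x # k2"
    using split_list[of "snd x" place_list] place_list(3) by auto
  let ?c = "\<lambda>w ks. concat (map (\<lambda>k :: 'm. map (\<lambda>v :: 'v. (v, k)) (w k)) ks)"
  have "distinct (k1 @ snd x # k2)" unfolding k[symmetric] by (rule place_list(2))
  then have notin: "snd x \<notin> set k1" "snd x \<notin> set k2" by auto
  have same: "?c (places (x # u)) ks = ?c (places u) ks" if "snd x \<notin> set ks" for ks
    using that by (intro arg_cong[where f = concat] map_cong refl) (auto simp: places_Cons)
  define B where "B = map (\<lambda>v. (v, snd x)) (places u (snd x)) @ ?c (places u) k2"
  have 1: "place_word (places u) = ?c (places u) k1 @ B"
    by (simp add: place_word_def k B_def)
  have 2: "place_word (places (x # u)) = ?c (places u) k1 @ x # B"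
    unfolding place_word_def k B_def using same[OF notin(1)] same[OF notin(2)]
    by (simp add: places_Cons)
  have "?wd (x # u) = (- 1) ^ n \<odot>\<^bsub>?P\<^esub> ((quot_letter sc x \<otimes>\<^bsub>?P\<^esub> ?wd (?c (places u) k1)) \<otimes>\<^bsub>?P\<^esub> ?wd B)"
    by (simp add: n 1 lp_quot.wd_append lp_quot.smult_mult_r lp_quot.m_assoc)
  also have "\<dots> = (- 1) ^ (n + length (?c (places u) k1)) \<odot>\<^bsub>?P\<^esub> ?wd (place_word (places (x # u)))"
    unfolding 2 lp_quot.move_letter
    by (simp add: lp_quot.wd_append lp_quot.smult_mult_l lp_quot.smult_smult lp_quot.m_assoc
      power_add)
  finally show ?case by blast
qed

subsection \<open>From the quotient to the tensor power\<close>

lemma ext_tensor_linear: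
  assumes "\<And>k. A k \<in> carrier (exterior sc)"
  shows "klinear (exterior sc) tp (\<lambda>x. ext_tensor sc (A(i := x)))"
  unfolding ext_tensor_def
  by (intro klinearI pure_tensor_closed[OF kalg_exterior] pure_tensor_add[OF kalg_exterior]
      pure_tensor_smult[OF kalg_exterior]) (use assms in auto)

lemma extensor_tensor_insert_letter:
  "extensor_tensor (places (u @ x # w)) = ext_tensor sc ((\<lambda>k. extensor sc (places (u @ w) k))
    (snd x := extensor sc (places u (snd x) @ fst x # places w (snd x))))"
  by (rule arg_cong[where f = "ext_tensor sc"], rule ext) (simp add: places_append places_Cons)

lemma extensor_tensor_insert_two:
  assumes "snd x = snd y"
  shows "extensor_tensor (places (u @ x # y # w)) =
    ext_tensor sc ((\<lambda>k. extensor sc (places (u @ w) k))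
    (snd x := extensor sc (places u (snd x) @ fst x # fst y # places w (snd x))))"
  by (rule arg_cong[where f = "ext_tensor sc"], rule ext) (simp add: assms places_append
    places_Cons)

abbreviation place_inv :: "('v \<times> 'm::{finite,linorder}) list \<Rightarrow> nat" where
  "place_inv u \<equiv> inversions (\<lambda>y x. snd y < snd x) u"

text \<open>Exchanging neighbours at the same place leaves the inversions alone and reverses the
  sign of one tensor factor; at different places the tensor stays the same and the number of
  inversions changes by one. Either way the value changes sign, so it is alternating.\<close>

lemma ex_Phi:
  "\<exists>G. klinear (lp_quot sc) (tp :: ('k, ('m::{finite,linorder}, 'v, 'k) ext_power) module) G \<and>
    (\<forall>u. G (quot_word sc u) = (- 1) ^ place_inv u \<odot>\<^bsub>tp\<^esub> extensor_tensor (places u))"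
proof -
  let ?T = "tp :: ('k, ('m, 'v, 'k) ext_power) module"
  let ?f = "\<lambda>u :: ('v \<times> 'm) list. (- 1) ^ place_inv u \<odot>\<^bsub>?T\<^esub> extensor_tensor (places u)"
  let ?E = "exterior sc"
  note lin = ext_tensor_linear[of "\<lambda>k :: 'm. extensor sc (places u k)" for u, OF extensor_closed]
  have inv: "place_inv (u @ x # y # v) = place_inv (u @ y # x # v)" if "snd x = snd y"
    for u v and x y :: "'v \<times> 'm"
    using inversions_swap[of "\<lambda>y x. snd y < snd x" u x y v] that by simp
  have cl: "extensor sc (u @ v1 # v) \<in> carrier ?E" for u v v1 by simp
  have anti_same: "extensor_tensor (places (u @ x # y # v)) \<oplus>\<^bsub>?T\<^esub> extensor_tensor
    (places (u @ y # x # v)) = \<zero>\<^bsub>?T\<^esub>"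
    if "snd x = snd y" for u v and x y :: "'v \<times> 'm"
  proof -
    let ?a = "fst x" and ?b = "fst y" and ?u = "places u (snd x)" and ?v = "places v (snd x)"
    have "extensor sc (?u @ ?a # ?b # ?v) \<oplus>\<^bsub>?E\<^esub> extensor sc (?u @ ?b # ?a # ?v) =
      extensor sc ?u \<otimes>\<^bsub>?E\<^esub> ((ext_vec sc ?a \<otimes>\<^bsub>?E\<^esub> ext_vec sc ?b \<oplus>\<^bsub>?E\<^esub> ext_vec sc ?b \<otimes>\<^bsub>?E\<^esub> ext_vec
        sc ?a) \<otimes>\<^bsub>?E\<^esub> extensor sc ?v)"
      by (simp add: extensor_eq exterior.wd_append exterior.l_distr exterior.r_distr
        exterior.m_assoc)
    then have z: "extensor sc (?u @ ?a # ?b # ?v) \<oplus>\<^bsub>?E\<^esub> extensor sc (?u @ ?b # ?a # ?v) = \<zero>\<^bsub>?E\<^esub>"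
      by (simp add: exterior.g_anti)
    have "extensor_tensor (places (u @ x # y # v)) \<oplus>\<^bsub>?T\<^esub> extensor_tensor (places (u @ y # x # v)) =
      ext_tensor sc ((\<lambda>k. extensor sc (places (u @ v) k))(snd x :=
        extensor sc (?u @ ?a # ?b # ?v) \<oplus>\<^bsub>?E\<^esub> extensor sc (?u @ ?b # ?a # ?v)))"
      unfolding extensor_tensor_insert_two[OF that] extensor_tensor_insert_two[OF that[symmetric]]
        that[symmetric]
      by (rule klinear_add[OF lin, symmetric]) simp_all
    also have "\<dots> = \<zero>\<^bsub>?T\<^esub>"
      unfolding z by (rule klinear_zero[OF exterior.kmod_axioms T.kmod_axioms lin])
    finally show ?thesis .
  qed
  show ?thesis
  proof (rule lp_quot_hom[where f = ?f and B = ?T and sc = sc])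
    show "kmod ?T" by (rule T.kmod_axioms)
    show "?f u \<in> carrier ?T" for u by simp
    show "?f (u @ x # x # v) = \<zero>\<^bsub>?T\<^esub>" for u x v
    proof -
      let ?u = "places u (snd x)" and ?v = "places v (snd x)"
      have "extensor sc (?u @ fst x # fst x # ?v) =
        extensor sc ?u \<otimes>\<^bsub>?E\<^esub> ((ext_vec sc (fst x) \<otimes>\<^bsub>?E\<^esub> ext_vec sc (fst x)) \<otimes>\<^bsub>?E\<^esub> extensor sc ?v)"
        by (simp add: extensor_eq exterior.wd_append exterior.m_assoc)
      then have "extensor sc (?u @ fst x # fst x # ?v) = \<zero>\<^bsub>?E\<^esub>" by (simp add: exterior.g_square)
      then have "extensor_tensor (places (u @ x # x # v)) = \<zero>\<^bsub>?T\<^esub>"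
        unfolding extensor_tensor_insert_two[OF refl]
        using klinear_zero[OF exterior.kmod_axioms T.kmod_axioms lin[of "u @ v"], of "snd x"]
        by simp
      then show ?thesis by simp
    qed
    show "?f (u @ x # y # v) \<oplus>\<^bsub>?T\<^esub> ?f (u @ y # x # v) = \<zero>\<^bsub>?T\<^esub>" for u x y v
    proof (cases "snd x = snd y")
      case True
      then show ?thesis
        using inv[OF True, of u v] anti_same[OF True, of u v] T.smult_r_distr[of "extensor_tensor
          (places (u @ x # y # v))" "extensor_tensor (places (u @ y # x # v))"]
        by (metis T.smult_zero extensor_tensor_closed)
    next
      case False
      then have same: "places (u @ y # x # v) = places (u @ x # y # v)"
        by (auto simp: places_append places_Cons)
      have "Suc (place_inv (u @ x # y # v)) = place_inv (u @ y # x # v) \<or>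
        place_inv (u @ x # y # v) = Suc (place_inv (u @ y # x # v))"
        using inversions_swap[of "\<lambda>y x. snd y < snd x" u x y v] False
        by (cases "snd x < snd y") auto
      then have "(- 1 :: 'k) ^ place_inv (u @ x # y # v) + (- 1) ^ place_inv (u @ y # x # v) = 0"
      proof
        assume "Suc (place_inv (u @ x # y # v)) = place_inv (u @ y # x # v)"
        from this[symmetric] show ?thesis by (simp only: power_Suc mult_minus1 add.right_inverse)
      next
        assume "place_inv (u @ x # y # v) = Suc (place_inv (u @ y # x # v))"
        then show ?thesis by (simp only: power_Suc mult_minus1 add.left_inverse)
      qed
      moreover have "?f (u @ x # y # v) \<oplus>\<^bsub>?T\<^esub> ?f (u @ y # x # v) =
        ((- 1) ^ place_inv (u @ x # y # v) + (- 1) ^ place_inv (u @ y # x # v)) \<odot>\<^bsub>?T\<^esub>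
          extensor_tensor (places (u @ x # y # v))"
        unfolding same by (rule T.smult_l_distr[OF extensor_tensor_closed, symmetric])
      ultimately show ?thesis by simp
    qed
    show "letter_linear sc ?T ?f"
      unfolding letter_linear_def
    proof (intro allI)
      fix u w a b v1 v2 and i :: 'm
      let ?e = "\<lambda>v. extensor sc (places u i @ v # places w i)"
      have e: "?e (sc a v1 + sc b v2) = a \<odot>\<^bsub>?E\<^esub> ?e v1 \<oplus>\<^bsub>?E\<^esub> b \<odot>\<^bsub>?E\<^esub> ?e v2"
        by (simp add: extensor_eq exterior.wd_append ext_vec_linear exterior.l_distr
          exterior.r_distr
            exterior.smult_mult_l exterior.smult_mult_r)
      have i: "place_inv (u @ (v, i) # w) = place_inv (u @ (v', i) # w)" for v v'
        by (induction u) auto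
      have "extensor_tensor (places (u @ (sc a v1 + sc b v2, i) # w)) =
        a \<odot>\<^bsub>?T\<^esub> extensor_tensor (places (u @ (v1, i) # w)) \<oplus>\<^bsub>?T\<^esub> b \<odot>\<^bsub>?T\<^esub> extensor_tensor
          (places (u @ (v2, i) # w))"
        unfolding extensor_tensor_insert_letter fst_conv snd_conv e
        by (simp only: klinear_add[OF lin] klinear_smult[OF lin] exterior.smult_closed
          extensor_closed)
      then show "?f (u @ (sc a v1 + sc b v2, i) # w) =
        a \<odot>\<^bsub>?T\<^esub> ?f (u @ (v1, i) # w) \<oplus>\<^bsub>?T\<^esub> b \<odot>\<^bsub>?T\<^esub> ?f (u @ (v2, i) # w)"
        using i[of "sc a v1 + sc b v2" v1] i[of v2 v1]
        by (simp add: T.smult_r_distr T.smult_smult mult.commute)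
    qed
  qed blast
qed

definition Phi :: "('v, 'm::{finite,linorder}, 'k) kskew set \<Rightarrow> ('m, 'v, 'k) ext_power" where
  "Phi = (SOME G. klinear (lp_quot sc) tp G \<and>
    (\<forall>u. G (quot_word sc u) = (- 1) ^ place_inv u \<odot>\<^bsub>tp\<^esub> extensor_tensor (places u)))"

lemma Phi_linear: "klinear (lp_quot sc) tp Phi"
  and Phi_word: "Phi (quot_word sc u) = (- 1) ^ place_inv u \<odot>\<^bsub>tp\<^esub> extensor_tensor (places u)"
  using someI_ex[OF ex_Phi] unfolding Phi_def by auto

lemma Phi_Psi:
  assumes "t \<in> carrier tp"
  shows "Phi (Psi t) = t"
  by (rule klinear_eq_on_kspan[OF T.kmod_axioms T.kmod_axioms klinear_compose[OF Psi_linear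
    Phi_linear]
        klinear_ident _ _ extensor_tensor_span[OF assms]])
    (auto simp: Psi_extensor_tensor Phi_word inversions_place_word places_place_word)

text \<open>Every word is \<open>Psi\<close> of a tensor, and \<open>Phi\<close> undoes
  \<open>Psi\<close>. The unspecified sign of the sorted word thus never has to be compared with the
  inversions counted by \<open>Phi\<close>.\<close>

lemma Psi_Phi:
  fixes p :: "('v, 'm::{finite,linorder}, 'k) kskew set"
  assumes "p \<in> carrier (lp_quot sc)"
  shows "Psi (Phi p) = p"
proof (rule klinear_eq_on_kspan[OF lp_quot.kmod_axioms lp_quot.kmod_axioms klinear_compose[OF
  Phi_linear Psi_linear]
        klinear_ident _ _ lp_quot_span[OF assms]])
  fix q assume "q \<in> range (quot_word sc :: ('v \<times> 'm) list \<Rightarrow> _)"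
  then obtain u where u: "q = quot_word sc u" by auto
  obtain n where n: "q = (- 1) ^ n \<odot>\<^bsub>lp_quot sc\<^esub> Psi (extensor_tensor (places u))"
    using word_is_sorted_word[of u] unfolding u Psi_extensor_tensor by auto
  have "q = Psi ((- 1) ^ n \<odot>\<^bsub>tp\<^esub> extensor_tensor (places u))"
    unfolding n by (simp add: klinear_smult[OF Psi_linear])
  moreover have "Phi (Psi ((- 1) ^ n \<odot>\<^bsub>tp\<^esub> extensor_tensor (places u))) =
    (- 1) ^ n \<odot>\<^bsub>tp\<^esub> extensor_tensor (places u)"
    by (rule Phi_Psi) simp
  ultimately show "Psi (Phi q) = q" by simp
qed auto

lemma Phi_closed: "p \<in> carrier (lp_quot sc) \<Longrightarrow> Phi p \<in> carrier tp"
  and Psi_closed: "t \<in> carrier tp \<Longrightarrow> Psi t \<in> carrier (lp_quot sc)"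
  by (rule klinear_closed[OF Phi_linear], assumption, rule klinear_closed[OF Psi_linear])

subsection \<open>The graded product\<close>

end

text \<open>The exponent collected when the ordered products of the X and of the Y are merged place
  by place: the factor Y of degree b k moves left across the X of all later places in the
  list.\<close>

primrec crossings :: "('m \<Rightarrow> nat) \<Rightarrow> ('m \<Rightarrow> nat) \<Rightarrow> 'm list \<Rightarrow> nat" where
  "crossings a b [] = 0"
| "crossings a b (k # ks) = sum_list (map a ks) * b k + crossings a b ks"

lemma crossings_eq:
  fixes ks :: "'m::linorder list"
  assumes "sorted ks" "distinct ks"
  shows "crossings a b ks = (\<Sum>k\<in>set ks. \<Sum>l\<in>{l\<in>set ks. l < k}. a k * b l)"
  using assms
proof (induction ks)
  case (Cons k ks)
  have k: "k < l" if "l \<in> set ks" for l using Cons.prems that by (auto simp: order.order_iff_strict)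
  have "(\<Sum>j\<in>set (k # ks). \<Sum>l\<in>{l \<in> set (k # ks). l < j}. a j * b l) =
    (\<Sum>l\<in>{l \<in> set (k # ks). l < k}. a k * b l) + (\<Sum>j\<in>set ks. \<Sum>l\<in>{l \<in> set (k # ks). l < j}. a j * b
      l)"
    using Cons.prems by simp
  also have "{l \<in> set (k # ks). l < k} = {}" using k by force
  also have "(\<Sum>j\<in>set ks. \<Sum>l\<in>{l \<in> set (k # ks). l < j}. a j * b l) =
    (\<Sum>j\<in>set ks. a j * b k + (\<Sum>l\<in>{l \<in> set ks. l < j}. a j * b l))"
  proof (rule sum.cong[OF refl])
    fix j assume "j \<in> set ks"
    then have "{l \<in> set (k # ks). l < j} = insert k {l \<in> set ks. l < j}" using k by auto
    moreover have "k \<notin> {l \<in> set ks. l < j}" using Cons.prems by auto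
    ultimately show "(\<Sum>l\<in>{l \<in> set (k # ks). l < j}. a j * b l) =
      a j * b k + (\<Sum>l\<in>{l \<in> set ks. l < j}. a j * b l)"
      by simp
  qed
  also have "\<dots> = (\<Sum>j\<in>set ks. a j * b k) + crossings a b ks"
    using Cons by (simp add: sum.distrib)
  also have "(\<Sum>j\<in>set ks. a j * b k) = sum_list (map a ks) * b k"
    using Cons.prems by (simp add: sum_list_distinct_conv_sum_set sum_distrib_right)
  finally show ?case by simp
qed simp

lemma (in kalg) supercommute_product:
  assumes "\<And>k. X k \<in> carrier A" "y \<in> carrier A"
    and "\<And>k. k \<in> set ks \<Longrightarrow> X k \<otimes> y = (- 1) ^ (a k * b) \<odot> (y \<otimes> X k)"
  shows "wprod A X ks \<otimes> y = (- 1) ^ (sum_list (map a ks) * b) \<odot> (y \<otimes> wprod A X ks)"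
  using assms(3)
proof (induction ks)
  case (Cons k ks)
  have c: "wprod A X ks \<in> carrier A" using assms(1) by auto
  have "wprod A X (k # ks) \<otimes> y = (- 1) ^ (sum_list (map a ks) * b) \<odot> ((X k \<otimes> y) \<otimes> wprod A X ks)"
  proof -
    have "wprod A X ks \<otimes> y = (- 1) ^ (sum_list (map a ks) * b) \<odot> (y \<otimes> wprod A X ks)"
      by (rule Cons.IH) (use Cons.prems in auto)
    then show ?thesis using c assms(1,2) by (simp add: m_assoc smult_mult_r)
  qed
  also have "\<dots> = (- 1) ^ (sum_list (map a (k # ks)) * b) \<odot> (y \<otimes> wprod A X (k # ks))"
  proof -
    have "X k \<otimes> y = (- 1) ^ (a k * b) \<odot> (y \<otimes> X k)" by (rule Cons.prems) simp
    then show ?thesis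
      using c assms(1,2) by (simp only:)
        (simp add: smult_mult_l smult_smult m_assoc power_add distrib_left mult.commute)
  qed
  finally show ?case .
qed (use assms in auto)

text \<open>The first Y passes the remaining X and joins the first X; the two remaining ordered
  products are then merged by induction.\<close>

lemma (in kalg) graded_product:
  assumes X: "\<And>k. X k \<in> carrier A" and Y: "\<And>k. Y k \<in> carrier A"
    and comm: "\<And>k l. X k \<otimes> Y l = (- 1) ^ (a k * b l) \<odot> (Y l \<otimes> X k)"
  shows "wprod A X ks \<otimes> wprod A Y ks = (- 1) ^ crossings a b ks \<odot> wprod A (\<lambda>k. X k \<otimes> Y k) ks"
proof (induction ks)
  case (Cons k ks)
  have c: "wprod A X ks \<in> carrier A" "wprod A Y ks \<in> carrier A"
    "wprod A (\<lambda>k. X k \<otimes> Y k) ks \<in> carrier A"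
    using X Y by auto
  have "wprod A X (k # ks) \<otimes> wprod A Y (k # ks) = X k \<otimes> ((wprod A X ks \<otimes> Y k) \<otimes> wprod A Y ks)"
    using c X Y by (simp add: m_assoc)
  also have "\<dots> = (- 1) ^ (sum_list (map a ks) * b k) \<odot> ((X k \<otimes> Y k) \<otimes> (wprod A X ks \<otimes> wprod A Y
    ks))"
  proof -
    have "wprod A X ks \<otimes> Y k = (- 1) ^ (sum_list (map a ks) * b k) \<odot> (Y k \<otimes> wprod A X ks)"
      by (rule supercommute_product[OF X Y comm])
    then show ?thesis
      using c X Y by (simp only:) (simp add: m_assoc smult_mult_l smult_mult_r)
  qed
  also have "\<dots> = (- 1) ^ crossings a b (k # ks) \<odot> wprod A (\<lambda>k. X k \<otimes> Y k) (k # ks)"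
    unfolding Cons using c X Y by (simp add: smult_mult_r smult_smult power_add)
  finally show ?case .
qed simp

section \<open>The graded product as a transported product\<close>

context
  fixes sc :: "'k::field \<Rightarrow> 'v::ab_group_add \<Rightarrow> 'v"
begin

interpretation T: kalg "tensor_power (exterior sc) :: ('k, ('m::{finite,linorder}, 'v, 'k)
  ext_power) module"
  by (rule kalg_tensor_power[OF kalg_exterior])

text \<open>The sign rule of graded tensor products, verified inside the quotient. It shows that the
  transported product satisfies the description in \<open>graded_mult\<close>.\<close>

lemma Psi_homogeneous:
  fixes A B :: "'m::{finite,linorder} \<Rightarrow> ('v, 'k) ext"
  assumes "\<And>k. A k \<in> ext_component sc (a k)" "\<And>k. B k \<in> ext_component sc (b k)"
  shows "Psi sc (ext_tensor sc A) \<otimes>\<^bsub>lp_quot sc\<^esub> Psi sc (ext_tensor sc B) =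
    (- 1) ^ (\<Sum>k\<in>UNIV. \<Sum>l\<in>{..<k}. a k * b l) \<odot>\<^bsub>lp_quot sc\<^esub>
      Psi sc (ext_tensor sc (\<lambda>k. A k \<otimes>\<^bsub>exterior sc\<^esub> B k))"
proof -
  have c: "x \<in> carrier (exterior sc)" if "x \<in> ext_component sc n" for x n
    using exterior.kspan_closed[OF _ ext_component_span[OF that]] by auto
  have A: "A k \<in> carrier (exterior sc)" and B: "B k \<in> carrier (exterior sc)" for k
    using assms c by auto
  have e: "crossings a b place_list = (\<Sum>k\<in>UNIV. \<Sum>l\<in>{..<k}. a k * b l)"
    using crossings_eq[OF place_list(1,2), of a b] by (simp add: place_list lessThan_def)
  have "wprod (lp_quot sc) (\<lambda>k. iota sc k (A k)) place_list \<otimes>\<^bsub>lp_quot sc\<^esub>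
      wprod (lp_quot sc) (\<lambda>k. iota sc k (B k)) place_list =
    (- 1) ^ crossings a b place_list \<odot>\<^bsub>lp_quot sc\<^esub>
      wprod (lp_quot sc) (\<lambda>k. iota sc k (A k) \<otimes>\<^bsub>lp_quot sc\<^esub> iota sc k (B k)) place_list"
    by (rule lp_quot.graded_product) (rule iota_closed A B iota_supercommute[OF assms])+
  then show ?thesis
    by (simp add: Psi_tensor A B iota_mult e)
qed

lemma graded_mult_eq:
  fixes x y :: "('m::{finite,linorder}, 'v, 'k) ext_power"
  assumes "x \<in> carrier (tensor_power (exterior sc))" "y \<in> carrier (tensor_power (exterior sc))"
  shows "graded_mult (exterior sc) (ext_component sc) x y =
    Phi sc (Psi sc x \<otimes>\<^bsub>lp_quot sc\<^esub> Psi sc y)"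
proof -
  let ?T = "tensor_power (exterior sc) :: ('k, ('m, 'v, 'k) ext_power) module" and ?P = "lp_quot sc"
  let ?extensor_tensor = "\<lambda>w :: 'm \<Rightarrow> 'v list. ext_tensor sc (\<lambda>k. extensor sc (w k))"
  \<comment> \<open>The value outside the carrier is the one prescribed in
    \<open>graded_mult\<close>, so that the two functions agree everywhere.\<close>
  define \<nu> :: "('m, 'v, 'k) ext_power \<Rightarrow> ('m, 'v, 'k) ext_power \<Rightarrow> ('m, 'v, 'k) ext_power" where
    "\<nu> x y = (if x \<in> carrier ?T \<and> y \<in> carrier ?T then Phi sc (Psi sc x \<otimes>\<^bsub>?P\<^esub> Psi sc y) else
      undefined)" for x y
  have c: "x \<in> carrier (exterior sc)" if "x \<in> ext_component sc n" for x n
    using exterior.kspan_closed[OF _ ext_component_span[OF that]] by auto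
  have \<nu>1: "klinear ?T ?T (\<nu> x)" if "x \<in> carrier ?T" for x
    by (rule klinear_cong[OF klinear_compose[OF lp_quot.klinear_mult_l[OF Psi_linear Psi_closed[OF
      that]] Phi_linear] _ T.kmod_axioms])
      (simp add: \<nu>_def that)
  have \<nu>2: "klinear ?T ?T (\<lambda>x. \<nu> x y)" if "y \<in> carrier ?T" for y
    by (rule klinear_cong[OF klinear_compose[OF lp_quot.klinear_mult_r[OF Psi_linear Psi_closed[OF
      that]] Phi_linear] _ T.kmod_axioms])
      (simp add: \<nu>_def that)
  have \<nu>3: "\<nu> (ext_tensor sc A) (ext_tensor sc B) =
      (- 1) ^ (\<Sum>k\<in>UNIV. \<Sum>l\<in>{..<k}. a k * b l) \<odot>\<^bsub>?T\<^esub> ext_tensor sc (\<lambda>k. A k \<otimes>\<^bsub>exterior sc\<^esub> B k)"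
    if AB: "\<forall>k. A k \<in> ext_component sc (a k) \<and> B k \<in> ext_component sc (b k)" for a b A B
  proof -
    have cl: "ext_tensor sc A \<in> carrier ?T" "ext_tensor sc B \<in> carrier ?T"
      "ext_tensor sc (\<lambda>k. A k \<otimes>\<^bsub>exterior sc\<^esub> B k) \<in> carrier ?T"
      using AB c by (auto intro!: ext_tensor_closed)
    then show ?thesis
      using Psi_homogeneous[of A a B b] AB
      by (simp add: \<nu>_def klinear_smult[OF Phi_linear] Psi_closed Phi_Psi)
  qed
  have "graded_mult (exterior sc) (ext_component sc) = \<nu>"
    unfolding graded_mult_def Let_def
  proof (rule the_equality, intro conjI allI impI ballI)
    show "\<nu> x y = undefined" if "x \<notin> carrier ?T \<or> y \<notin> carrier ?T" for x y
      using that by (auto simp: \<nu>_def)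
    show "klinear ?T ?T (\<nu> x)" if "x \<in> carrier ?T" for x using that by (rule \<nu>1)
    show "klinear ?T ?T (\<lambda>x. \<nu> x y)" if "y \<in> carrier ?T" for y using that by (rule \<nu>2)
    show "\<nu> (pure_tensor (exterior sc) A) (pure_tensor (exterior sc) B) =
      (- 1) ^ (\<Sum>k\<in>UNIV. \<Sum>l\<in>{..<k}. a k * b l) \<odot>\<^bsub>?T\<^esub> pure_tensor (exterior sc) (\<lambda>k. A k \<otimes>\<^bsub>exterior
        sc\<^esub> B k)"
      if "\<forall>k. A k \<in> ext_component sc (a k) \<and> B k \<in> ext_component sc (b k)" for a b A B
      using \<nu>3[OF that] by (simp add: ext_tensor_def)
  next
    fix \<mu> :: "('m, 'v, 'k) ext_power \<Rightarrow> ('m, 'v, 'k) ext_power \<Rightarrow> ('m, 'v, 'k) ext_power"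
    assume m: "(\<forall>x y. x \<notin> carrier ?T \<or> y \<notin> carrier ?T \<longrightarrow> \<mu> x y = undefined) \<and>
       (\<forall>x\<in>carrier ?T. klinear ?T ?T (\<mu> x)) \<and>
       (\<forall>y\<in>carrier ?T. klinear ?T ?T (\<lambda>x. \<mu> x y)) \<and>
       (\<forall>a b A B. (\<forall>k. A k \<in> ext_component sc (a k) \<and> B k \<in> ext_component sc (b k)) \<longrightarrow>
          \<mu> (pure_tensor (exterior sc) A) (pure_tensor (exterior sc) B) =
            (-1) ^ (\<Sum>k\<in>UNIV. \<Sum>l\<in>{..<k}. a k * b l) \<odot>\<^bsub>?T\<^esub> pure_tensor (exterior sc)
              (\<lambda>k. A k \<otimes>\<^bsub>exterior sc\<^esub> B k))"
    have words: "\<mu> (?extensor_tensor u) (?extensor_tensor w) =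
      \<nu> (?extensor_tensor u) (?extensor_tensor w)" for u w
    proof -
      \<comment> \<open>Extensors are homogeneous of their step, so the prescribed values already
        fix any candidate on a spanning set.\<close>
      have h: "\<forall>k. extensor sc (u k) \<in> ext_component sc (length (u k)) \<and>
        extensor sc (w k) \<in> ext_component sc (length (w k))" by (simp add: extensor_in_component)
      from m[THEN conjunct2, THEN conjunct2, THEN conjunct2, rule_format, OF h[rule_format]]
        \<nu>3[OF h]
      show ?thesis by (simp add: ext_tensor_def)
    qed
    have r: "range ?extensor_tensor \<subseteq> carrier ?T" by auto
    have half: "\<mu> (?extensor_tensor u) y = \<nu> (?extensor_tensor u) y" if y: "y \<in> carrier ?T" for u y
      by (rule klinear_eq_on_kspan[OF T.kmod_axioms T.kmod_axioms _ \<nu>1 r _ extensor_tensor_span[OF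
        y]])
        (use m words in auto)
    have "\<mu> x y = \<nu> x y" if x: "x \<in> carrier ?T" and y: "y \<in> carrier ?T" for x y
      by (rule klinear_eq_on_kspan[OF T.kmod_axioms T.kmod_axioms _ \<nu>2[OF y] r _
        extensor_tensor_span[OF x]])
        (use m half y in auto)
    then show "\<mu> = \<nu>" using m by (intro ext) (auto simp: \<nu>_def)
  qed
  then show ?thesis by (simp add: \<nu>_def assms)
qed

lemma ext_power_sel:
  "carrier (ext_power sc) = carrier (tensor_power (exterior sc))" "one (ext_power sc) =
    one (tensor_power (exterior sc))"
  "zero (ext_power sc) = zero (tensor_power (exterior sc))" "add (ext_power sc) =
    add (tensor_power (exterior sc))"
  "smult (ext_power sc) = smult (tensor_power (exterior sc))"
  "mult (ext_power sc) = graded_mult (exterior sc) (ext_component sc)"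
  by (simp_all add: ext_power_def)

lemma klinear_ext_power:
  "klinear (ext_power sc) B f \<longleftrightarrow> klinear (tensor_power (exterior sc)) B f"
  "klinear A (ext_power sc) g \<longleftrightarrow> klinear A (tensor_power (exterior sc)) g"
  by (simp_all add: klinear_def ext_power_sel)

text \<open>By \<open>graded_mult_eq\<close> the product of the target is the product of the
  quotient carried along \<open>Phi\<close>, so multiplicativity is automatic. For the unit,
  \<open>Psi\<close> sends the tensor of ones to an ordered product of ones.\<close>

lemma Phi_iso: "(Phi sc :: ('v, 'm::{finite,linorder}, 'k) kskew set \<Rightarrow> _) \<in> alg_iso (lp_quot sc)
  (ext_power sc)"
proof -
  have "Psi sc \<one>\<^bsub>ext_power sc\<^esub> = (\<one>\<^bsub>lp_quot sc\<^esub> :: ('v, 'm, 'k) kskew set)"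
  proof -
    have "wprod (lp_quot sc) (\<lambda>k :: 'm. \<one>\<^bsub>lp_quot sc\<^esub>) ks =
      (\<one>\<^bsub>lp_quot sc\<^esub> :: ('v, 'm, 'k) kskew set)" for ks
      by (induction ks) simp_all
    then show ?thesis
      by (simp add: ext_power_sel pure_tensor_one[OF kalg_exterior] Psi_tensor iota_one flip:
        ext_tensor_def)
  qed
  then have one: "Phi sc (\<one>\<^bsub>lp_quot sc\<^esub> :: ('v, 'm, 'k) kskew set) = \<one>\<^bsub>ext_power sc\<^esub>"
    by (metis ext_power_sel(2) Phi_Psi T.one_closed)
  have "(Phi sc :: ('v, 'm, 'k) kskew set \<Rightarrow> _) \<in> ring_hom (lp_quot sc) (ext_power sc)"
  proof (rule ring_hom_memI)
    fix x y :: "('v, 'm, 'k) kskew set"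
    assume xy: "x \<in> carrier (lp_quot sc)" "y \<in> carrier (lp_quot sc)"
    then show "Phi sc x \<in> carrier (ext_power sc)" by (simp add: ext_power_sel Phi_closed)
    show "Phi sc (x \<otimes>\<^bsub>lp_quot sc\<^esub> y) = Phi sc x \<otimes>\<^bsub>ext_power sc\<^esub> Phi sc y"
      using xy by (simp add: ext_power_sel graded_mult_eq Phi_closed Psi_Phi)
    show "Phi sc (x \<oplus>\<^bsub>lp_quot sc\<^esub> y) = Phi sc x \<oplus>\<^bsub>ext_power sc\<^esub> Phi sc y"
      using xy by (simp add: ext_power_sel klinear_add[OF Phi_linear])
  qed (rule one)
  moreover have "bij_betw (Phi sc :: ('v, 'm, 'k) kskew set \<Rightarrow> _) (carrier (lp_quot sc))
    (carrier (ext_power sc))"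
    by (rule bij_betw_byWitness[of _ "Psi sc"]) (auto simp: ext_power_sel Phi_Psi Psi_Phi
      Phi_closed Psi_closed)
  ultimately show ?thesis
    by (simp add: alg_iso_def ring_iso_def klinear_ext_power Phi_linear)
qed

lemma Phi_letter:
  "Phi sc (quot_letter sc (v, i)) = ext_tensor sc (\<lambda>k :: 'm::{finite,linorder}.
    if k = i then ext_vec sc v else \<one>\<^bsub>exterior sc\<^esub>)"
proof -
  have "(\<lambda>k. extensor sc (places [(v, i)] k)) =
    (\<lambda>k. if k = i then ext_vec sc v else \<one>\<^bsub>exterior sc\<^esub>)"
    by (rule ext) (simp add: places_def extensor_eq)
  then show ?thesis
    using Phi_word[of sc "[(v, i)]"] extensor_tensor_closed[of sc "places [(v, i)]"] by simp
qed

end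

section \<open>Geometric products\<close>

lemma filter_upt_eq: "filter (\<lambda>p. p \<in> I) [0..<n] = sorted_list_of_set (I \<inter> {..<n})"
proof -
  have "sorted (filter (\<lambda>p. p \<in> I) [0..<n])" "distinct (filter (\<lambda>p. p \<in> I) [0..<n])"
    by (auto intro: sorted_wrt_filter)
  from sorted_list_of_set.idem_if_sorted_distinct[OF this] show ?thesis
    by (simp add: Int_def conj_commute lessThan_def)
qed

text \<open>Increasing lists of positions are the form in which \<open>slice_perm\<close> presents a
  slice.\<close>

lemma nths_eq: "nths w I = map ((!) w) (sorted_list_of_set (I \<inter> {..<length w}))"
proof -
  have z: "zip w [0..<length w] = map (\<lambda>p. (w ! p, p)) [0..<length w]"
    by (rule nth_equalityI) auto
  show ?thesis unfolding nths_def z filter_upt_eq[symmetric] by (simp add: filter_map comp_def)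
qed

lemma slice_perm_permutes:
  assumes "I \<subseteq> {..<n}"
  shows "slice_perm n I permutes {..<n}"
proof -
  let ?l = "sorted_list_of_set I @ sorted_list_of_set ({..<n} - I)"
  have fin: "finite I" using assms finite_subset by auto
  then have l: "distinct ?l" "set ?l = {..<n}" using assms by auto
  then have len: "length ?l = n" using distinct_card[OF l(1)] by simp
  have "bij_betw (\<lambda>p. ?l ! p) {..<n} {..<n}"
    using bij_betw_nth[OF l(1), of "{..<n}" "{..<n}"] l(2) len by simp
  then have "bij_betw (slice_perm n I) {..<n} {..<n}"
    by (rule bij_betw_cong[THEN iffD1, rotated]) (simp add: slice_perm_def)
  then show ?thesis by (rule bij_imp_permutes) (simp add: slice_perm_def)
qed

lemma map_slice_perm:
  assumes "I \<subseteq> {..<n}"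
  shows "map (\<lambda>p. y (slice_perm n I p)) [0..<n] =
    map y (sorted_list_of_set I) @ map y (sorted_list_of_set ({..<n} - I))"
proof -
  let ?l = "sorted_list_of_set I @ sorted_list_of_set ({..<n} - I)"
  have fin: "finite I" using assms finite_subset by auto
  then have "card I + card ({..<n} - I) = n"
    using assms card_Diff_subset[OF fin assms] card_mono[OF _ assms] by simp
  then have "length ?l = n" by simp
  then have "map (\<lambda>p. y (slice_perm n I p)) [0..<n] = map (\<lambda>p. y (?l ! p)) [0..<length ?l]"
    by (auto simp: slice_perm_def)
  also have "\<dots> = map y (map ((!) ?l) [0..<length ?l])" by (simp only: map_map comp_def)
  also have "\<dots> = map y ?l" by (simp only: map_nth)
  finally show ?thesis by simp
qed

text \<open>\<open>wd_permutes\<close> for the slice permutation puts the sign on the other side; a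
  sign is its own inverse.\<close>

lemma (in skew_alg) word_slice:
  assumes "I \<subseteq> {..<n}"
  shows "wd (map y [0..<n]) = of_int (sign (slice_perm n I)) \<odot>
    (wd (map y (sorted_list_of_set I)) \<otimes> wd (map y (sorted_list_of_set ({..<n} - I))))"
proof -
  let ?s = "of_int (sign (slice_perm n I)) :: 'k"
  have "wd (map y (sorted_list_of_set I)) \<otimes> wd (map y (sorted_list_of_set ({..<n} - I))) =
    ?s \<odot> wd (map y [0..<n])"
    using wd_permutes[OF slice_perm_permutes[OF assms], of y] unfolding map_slice_perm[OF assms]
    by (simp add: wd_append)
  moreover have "?s * ?s = 1" by (simp flip: of_int_mult)
  ultimately show ?thesis by (simp add: smult_smult)
qed

section \<open>Cutting the sorted word at two places\<close>

lemma place_list_between: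
  assumes "place_list = k1 @ a # k2 @ b # k3"
  shows "set k2 = {a<..<b}" "a < b"
proof -
  have s: "sorted (k1 @ a # k2 @ b # k3)" "distinct (k1 @ a # k2 @ b # k3)"
    unfolding assms[symmetric] by (rule place_list)+
  have u: "set (k1 @ a # k2 @ b # k3) = UNIV" unfolding assms[symmetric] by (rule place_list)
  show "a < b" using s by (auto simp: sorted_append order.order_iff_strict)
  have "x \<in> set k2" if "a < x" "x < b" for x
  proof -
    have "x \<in> set (k1 @ a # k2 @ b # k3)" using u by simp
    then show ?thesis using s that by (auto simp: sorted_append)
  qed
  then show "set k2 = {a<..<b}" using s by (auto simp: sorted_append order.order_iff_strict)
qed

lemma place_list_split:
  assumes "a < b"
  obtains k1 k2 k3 where "place_list = k1 @ a # k2 @ b # k3"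
proof -
  obtain k1 k where k: "place_list = k1 @ a # k" using split_list[of a place_list] place_list(3)
    by auto
  have "sorted (k1 @ a # k)" unfolding k[symmetric] by (rule place_list)
  moreover have "b \<in> set (k1 @ a # k)" unfolding k[symmetric] place_list by simp
  ultimately have "b \<in> set k" using assms by (auto simp: sorted_append)
  then obtain k2 k3 where "k = k2 @ b # k3" using split_list by fast
  then show thesis using k that by blast
qed

text \<open>\<open>place_word\<close> for a segment of the places, so that a sorted word can be cut
  at i and j.\<close>

definition block :: "('m \<Rightarrow> 'v list) \<Rightarrow> 'm list \<Rightarrow> ('v \<times> 'm) list" where
  "block w ks = concat (map (\<lambda>k. map (\<lambda>v. (v, k)) (w k)) ks)"

lemma block_append: "block w (k1 @ k2) = block w k1 @ block w k2"
  and block_Cons: "block w (k # k2) = map (\<lambda>v. (v, k)) (w k) @ block w k2"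
  and block_Nil: "block w [] = []"
  by (simp_all add: block_def)

lemma place_word_eq_block: "place_word w = block w place_list"
  by (simp add: place_word_def block_def)

lemma block_cong: "(\<And>k. k \<in> set ks \<Longrightarrow> w k = w' k) \<Longrightarrow> block w ks = block w' ks"
  by (auto simp: block_def intro!: arg_cong[where f = concat])

lemma block_places: "x \<in> set (block w ks) \<Longrightarrow> snd x \<in> set ks"
  by (auto simp: block_def)

lemma length_block: "distinct ks \<Longrightarrow> length (block w ks) = (\<Sum>k\<in>set ks. length (w k))"
  by (simp add: block_def length_concat comp_def sum_list_distinct_conv_sum_set)

lemma finsum_ext_power: "finsum (ext_power sc) f S = finsum (tensor_power (exterior sc)) f S"
  by (simp add: finsum_def ext_power_sel)

context
  fixes sc :: "'k::field \<Rightarrow> 'v::ab_group_add \<Rightarrow> 'v"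
begin

interpretation T: kalg "tensor_power (exterior sc) :: ('k, ('m::{finite,linorder}, 'v, 'k)
  ext_power) module"
  by (rule kalg_tensor_power[OF kalg_exterior])

text \<open>All replaceable letters of a sorted word lie in its block at place i. The blocks around
  it are fixed factors, and the sum runs over sets of positions inside that block.\<close>

lemma divided_word_place_word:
  fixes i j :: "'m::{finite,linorder}"
  assumes "place_list = k1 @ i # k2"
  shows "divided_word (lp_quot sc) (quot_letter sc) (place_subst i j) (place_word w) h =
    finsum (lp_quot sc) (\<lambda>J. quot_word sc (block w k1 @
        map (\<lambda>p. (w i ! p, if p \<in> J then j else i)) [0..<length (w i)] @ block w k2))
      {J. J \<subseteq> {..<length (w i)} \<and> int (card J) = h}"
proof -
  let ?B = "map (\<lambda>v. (v, i)) (w i)" and ?d = "divided_word (lp_quot sc) (quot_letter sc)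
    (place_subst i j)"
  let ?S = "{J. J \<subseteq> {..<length (w i)} \<and> int (card J) = h}"
  let ?r = "lp_quot.replace_at (\<lambda>x. (fst x, j)) ?B"
  let ?f = "\<lambda>x. quot_word sc (block w k1) \<otimes>\<^bsub>lp_quot sc\<^esub> (x \<otimes>\<^bsub>lp_quot sc\<^esub> quot_word sc (block w k2))"
  have d: "distinct (k1 @ i # k2)" unfolding assms[symmetric] by (rule place_list)
  have none: "\<forall>x\<in>set (block w k1). place_subst i j x = None"
    "\<forall>x\<in>set (block w k2). place_subst i j x = None"
    using d block_places by (fastforce simp: place_subst_def)+
  have "?d (place_word w) h = ?f (?d ?B h)"
    by (simp add: place_word_eq_block assms block_append block_Cons
        lp_quot.divided_word_prefix_fixed[OF none(1)] lp_quot.divided_word_suffix_fixed[OF none(2)])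
  also have "?d ?B h = finsum (lp_quot sc) (\<lambda>J. quot_word sc (?r J)) ?S"
    by (subst lp_quot.divided_word_eq_sum[where \<tau> = "\<lambda>x. (fst x, j)"]) (auto simp: place_subst_def)
  also have "?f \<dots> = finsum (lp_quot sc) (\<lambda>J. ?f (quot_word sc (?r J))) ?S"
    by (rule klinear_finsum[OF lp_quot.kmod_axioms lp_quot.kmod_axioms
          lp_quot.klinear_mult_l[OF lp_quot.klinear_mult_r[OF klinear_ident]]]) auto
  finally have sum: "?d (place_word w) h = finsum (lp_quot sc) (\<lambda>J. ?f (quot_word sc (?r J))) ?S" .
  have "?r J = map (\<lambda>p. (w i ! p, if p \<in> J then j else i)) [0..<length (w i)]" for J
    by (auto simp: lp_quot.replace_at_def)
  then show ?thesis unfolding sum by (simp only: lp_quot.wd_append)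
qed

text \<open>Listing the letters at the positions in I first, within a block whose letters sit at two
  places, is the slice permutation; its sign is the sign in the coproduct.\<close>

lemma quot_word_slice:
  assumes "I \<subseteq> {..<length v}"
  shows "quot_word sc (map (\<lambda>p. (v ! p, if p \<in> I then k else l)) [0..<length v]) =
    slice_sign (length v) I \<odot>\<^bsub>lp_quot sc\<^esub>
      quot_word sc (map (\<lambda>x. (x, k)) (nths v I) @ map (\<lambda>x. (x, l)) (nths v (- I)))"
proof -
  let ?y = "\<lambda>p. (v ! p, if p \<in> I then k else l)"
  have "finite I" "- I \<inter> {..<length v} = {..<length v} - I" using assms finite_subset by auto
  then have "map ?y (sorted_list_of_set I) = map (\<lambda>x. (x, k)) (nths v I)"
    "map ?y (sorted_list_of_set ({..<length v} - I)) = map (\<lambda>x. (x, l)) (nths v (- I))"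
    using assms by (simp_all add: nths_eq Int_absorb2)
  then show ?thesis
    using lp_quot.word_slice[OF assms, of sc ?y] by (simp add: slice_sign_def lp_quot.wd_append)
qed

text \<open>In each summand the block of i is separated into letters that stay and letters moved to
  j, with the coproduct sign. The h moved letters then cross the blocks strictly between i and j,
  which gives the sign in front of the geometric product. For i < j they arrive to the left of the
  block of j, and for j < i to its right, as in the two formulas.\<close>

lemma Psi_geom_value:
  fixes i j :: "'m::{finite,linorder}" and w :: "'m \<Rightarrow> 'v list"
  assumes "i \<noteq> j"
  shows "geom_value sc j i h w \<in> carrier (ext_power sc)" (is ?carrier)
    "Psi sc (geom_value sc j i h w) =
      divided_word (lp_quot sc) (quot_letter sc) (place_subst i j) (place_word w) (int h)"
        (is ?value)
proof -
  let ?P = "lp_quot sc" and ?E = "exterior sc" and ?n = "length (w i)"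
  let ?T = "tensor_power (exterior sc) :: ('k, ('m, 'v, 'k) ext_power) module"
  let ?t = "\<lambda>w :: 'm \<Rightarrow> 'v list. ext_tensor sc (\<lambda>k. extensor sc (w k))"
  let ?S = "{J. J \<subseteq> {..<?n} \<and> int (card J) = int h}"
  let ?y = "\<lambda>k l I. map (\<lambda>p. (w i ! p, if p \<in> I then k else l)) [0..<?n]"
  let ?a = "\<lambda>k I. map (\<lambda>v. (v, k)) (nths (w i) I)"
  \<comment> \<open>The part common to both orders of i and j: once single summands match, linearity
    of \<open>Psi\<close> matches the sums.\<close>
  have concl: "?carrier \<and> ?value"
    if gv: "geom_value sc j i h w = (- 1) ^ N \<odot>\<^bsub>?T\<^esub>
        finsum ?T (\<lambda>I. slice_sign ?n I \<odot>\<^bsub>?T\<^esub> ?t (W I)) (slice_sets ?n r s)"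
      and sum: "divided_word ?P (quot_letter sc) (place_subst i j) (place_word w) (int h) =
        finsum ?P (\<lambda>I. quot_word sc (w' I)) (slice_sets ?n r s)"
      and summand: "\<And>I. I \<in> slice_sets ?n r s \<Longrightarrow> quot_word sc (w' I) =
        slice_sign ?n I \<odot>\<^bsub>?P\<^esub> ((- 1) ^ N \<odot>\<^bsub>?P\<^esub> quot_word sc (place_word (W I)))"
    for N W r s w'
  proof -
    have "Psi sc (geom_value sc j i h w) =
      finsum ?P (\<lambda>I. (- 1) ^ N \<odot>\<^bsub>?P\<^esub> (slice_sign ?n I \<odot>\<^bsub>?P\<^esub> Psi sc (?t (W I)))) (slice_sets ?n r s)"
      unfolding gv
      by (subst klinear_smult[OF Psi_linear], (rule T.finsum_closed, simp)?,
          subst klinear_finsum[OF T.kmod_axioms lp_quot.kmod_axioms Psi_linear], simp)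
        (auto simp: klinear_smult[OF Psi_linear] Psi_closed lp_quot.smult_finsum)
    also have "\<dots> = finsum ?P (\<lambda>I. quot_word sc (w' I)) (slice_sets ?n r s)"
      by (rule lp_quot.finsum_cong'[OF refl])
        (simp_all add: summand Psi_extensor_tensor lp_quot.smult_smult mult.commute)
    finally show ?thesis
      unfolding ext_power_sel(1) sum by (auto simp: gv intro!: T.smult_closed T.finsum_closed)
  qed
  have fixed: "block (w(i := x, j := y)) ks = block w ks" "block (w(j := y, i := x)) ks =
    block w ks"
    if "i \<notin> set ks" "j \<notin> set ks" for ks x y
    using that by (auto intro!: block_cong)
  have "?carrier \<and> ?value"
  proof (cases "i < j")
    case True
    obtain k1 k2 k3 where k: "place_list = k1 @ i # k2 @ j # k3" by (rule place_list_split[OF True])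
    have d: "distinct (k1 @ i # k2 @ j # k3)" unfolding k[symmetric] by (rule place_list)
    define W where "W I = w(i := nths (w i) I, j := nths (w i) (- I) @ w j)" for I
    let ?e = "\<Sum>k\<in>{i<..<j}. length (w k)" and ?SI = "slice_sets ?n (int ?n - int h) (int h)"
    \<comment> \<open>For i < j the slice index I lists the letters that stay at place i; the
      replaced ones form the complement.\<close>
    let ?w = "\<lambda>I. block w k1 @ ?y j i ({..<?n} - I) @ block w (k2 @ j # k3)"
    have "(\<lambda>k. extensor sc (w k))(i := extensor sc (nths (w i) I),
        j := extensor sc (nths (w i) (- I)) \<otimes>\<^bsub>?E\<^esub> extensor sc (w j)) = (\<lambda>k. extensor sc (W I k))"
          for I
      by (rule ext) (simp add: W_def extensor_eq exterior.wd_append)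
    then have gv: "geom_value sc j i h w = (- 1) ^ (h * ?e) \<odot>\<^bsub>?T\<^esub>
        finsum ?T (\<lambda>I. slice_sign ?n I \<odot>\<^bsub>?T\<^esub> ?t (W I)) ?SI"
      using True by (simp add: geom_value_def finsum_ext_power ext_power_sel(5))
    have PW: "place_word (W I) = block w k1 @ ?a i I @ block w k2 @ ?a j (- I) @
        map (\<lambda>v. (v, j)) (w j) @ block w k3" for I
      using d assms by (simp add: place_word_eq_block k block_append block_Cons W_def fixed)
    have summand: "quot_word sc (?w I) =
      slice_sign ?n I \<odot>\<^bsub>?P\<^esub> ((- 1) ^ (h * ?e) \<odot>\<^bsub>?P\<^esub> quot_word sc (place_word (W I)))"
        if I: "I \<in> ?SI" for I
    proof -
      have sub: "I \<subseteq> {..<?n}" and card: "card ({..<?n} - I) = h" using I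
        by (auto simp: slice_sets_def)
      have y: "?y j i ({..<?n} - I) = ?y i j I" by auto
      have "quot_word sc (?w I) =
        slice_sign ?n I \<odot>\<^bsub>?P\<^esub> quot_word sc (block w k1 @ (?a i I @ ?a j (- I)) @ block w
          (k2 @ j # k3))"
        unfolding y by (rule lp_quot.wd_replace[OF quot_word_slice[OF sub]])
      also have "block w k1 @ (?a i I @ ?a j (- I)) @ block w (k2 @ j # k3) =
        (block w k1 @ ?a i I) @ ?a j (- I) @ block w k2 @ map (\<lambda>v. (v, j)) (w j) @ block w k3"
        by (simp add: block_append block_Cons)
      also have "quot_word sc \<dots> = (- 1) ^ (length (?a j (- I)) * length (block w k2)) \<odot>\<^bsub>?P\<^esub>
        quot_word sc ((block w k1 @ ?a i I) @ block w k2 @ ?a j (- I) @ map (\<lambda>v. (v, j)) (w j)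
          @ block w k3)"
        by (rule lp_quot.swap_blocks)
      also have "length (?a j (- I)) = h"
        using card by (simp add: nths_eq Int_commute Diff_eq)
      also have "length (block w k2) = ?e"
        using d place_list_between[OF k] by (simp add: length_block)
      finally show ?thesis by (simp only: PW append_assoc)
    qed
    \<comment> \<open>Complementation matches the sets of replaced positions with the slice indices.
      For h > n both families are empty; otherwise the integer difference n - h is the natural
      one.\<close>
    have SI: "(\<lambda>J. {..<?n} - J) ` ?SI = ?S"
    proof (intro Set.equalityI subsetI)
      fix J assume J: "J \<in> ?S"
      have "card ({..<?n} - J) = ?n - h" "h \<le> ?n"
        using J card_Diff_subset[of J "{..<?n}"] finite_subset[of J "{..<?n}"] card_mono[of
          "{..<?n}" J] by auto
      then have "{..<?n} - J \<in> ?SI" using J by (auto simp: slice_sets_def double_diff)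
      moreover have "J = {..<?n} - ({..<?n} - J)" using J by auto
      ultimately show "J \<in> (\<lambda>J. {..<?n} - J) ` ?SI" by blast
    qed (auto simp: slice_sets_def)
    have inj: "inj_on (\<lambda>J. {..<?n} - J) ?SI"
      by (rule inj_onI) (auto simp: slice_sets_def)
    have "finsum ?P (\<lambda>J. quot_word sc (block w k1 @ ?y j i J @ block w (k2 @ j # k3))) ?S =
        finsum ?P (\<lambda>I. quot_word sc (?w I)) ?SI"
      unfolding SI[symmetric] by (rule lp_quot.finsum_reindex[OF _ inj]) auto
    then show ?thesis by (intro concl[OF gv _ summand]) (simp_all only: divided_word_place_word[OF
      k])
  next
    case False
    then have ji: "j < i" using assms by auto
    obtain k1 k2 k3 where k: "place_list = k1 @ j # k2 @ i # k3" by (rule place_list_split[OF ji])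
    have d: "distinct (k1 @ j # k2 @ i # k3)" unfolding k[symmetric] by (rule place_list)
    define W where "W I = w(j := w j @ nths (w i) I, i := nths (w i) (- I))" for I
    let ?e = "\<Sum>k\<in>{j<..<i}. length (w k)" and ?SI = "slice_sets ?n (int h) (int ?n - int h)"
    let ?w = "\<lambda>I. block w (k1 @ j # k2) @ ?y j i I @ block w k3"
    let ?b = "block w k1 @ map (\<lambda>v. (v, j)) (w j)"
    have "(\<lambda>k. extensor sc (w k))(j := extensor sc (w j) \<otimes>\<^bsub>?E\<^esub> extensor sc (nths (w i) I),
        i := extensor sc (nths (w i) (- I))) = (\<lambda>k. extensor sc (W I k))" for I
      by (rule ext) (simp add: W_def extensor_eq exterior.wd_append)
    then have gv: "geom_value sc j i h w = (- 1) ^ (h * ?e) \<odot>\<^bsub>?T\<^esub>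
        finsum ?T (\<lambda>I. slice_sign ?n I \<odot>\<^bsub>?T\<^esub> ?t (W I)) ?SI"
      using False by (simp add: geom_value_def finsum_ext_power ext_power_sel(5))
    have PW: "place_word (W I) = ?b @ ?a j I @ block w k2 @ ?a i (- I) @ block w k3" for I
      using d assms by (simp add: place_word_eq_block k block_append block_Cons W_def fixed)
    have SI: "?SI = ?S"
    proof -
      have "int (card ({..<?n} - I)) = int ?n - int h" if "I \<subseteq> {..<?n}" "card I = h" for I
        using that card_Diff_subset[of I "{..<?n}"] finite_subset[of I "{..<?n}"] card_mono[of
          "{..<?n}" I] by auto
      then show ?thesis by (auto simp: slice_sets_def)
    qed
    have summand: "quot_word sc (?w I) =
      slice_sign ?n I \<odot>\<^bsub>?P\<^esub> ((- 1) ^ (h * ?e) \<odot>\<^bsub>?P\<^esub> quot_word sc (place_word (W I)))"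
        if I: "I \<in> ?SI" for I
    proof -
      have sub: "I \<subseteq> {..<?n}" and card: "card I = h" using I unfolding SI by auto
      have "quot_word sc (?w I) =
        slice_sign ?n I \<odot>\<^bsub>?P\<^esub> quot_word sc (block w (k1 @ j # k2) @ (?a j I @ ?a i (- I))
          @ block w k3)"
        by (rule lp_quot.wd_replace[OF quot_word_slice[OF sub]])
      also have "block w (k1 @ j # k2) @ (?a j I @ ?a i (- I)) @ block w k3 =
        ?b @ block w k2 @ ?a j I @ ?a i (- I) @ block w k3"
        by (simp add: block_append block_Cons)
      also have "quot_word sc \<dots> = (- 1) ^ (length (block w k2) * length (?a j I)) \<odot>\<^bsub>?P\<^esub>
        quot_word sc (?b @ ?a j I @ block w k2 @ ?a i (- I) @ block w k3)"
        by (rule lp_quot.swap_blocks)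
      also have "length (?a j I) = h"
        using card sub by (simp add: nths_eq Int_absorb2)
      also have "length (block w k2) = ?e"
        using d place_list_between[OF k] by (simp add: length_block)
      finally show ?thesis by (simp only: PW mult.commute[of h])
    qed
    have k': "place_list = (k1 @ j # k2) @ i # k3" by (simp add: k)
    show ?thesis
      by (intro concl[OF gv _ summand]) (simp_all only: divided_word_place_word[OF k'] SI)
  qed
  then show ?carrier ?value by auto
qed

end

section \<open>Operators carried along the isomorphism\<close>

lemma transport_Phi:
  fixes sc :: "'k::field \<Rightarrow> 'v::ab_group_add \<Rightarrow> 'v"
    and t :: "('m::{finite,linorder}, 'v, 'k) ext_power"
  assumes "t \<in> carrier (ext_power sc)"
  shows "transport (lp_quot sc) (ext_power sc) (Phi sc) D t = Phi sc (D (Psi sc t))"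
proof -
  have t: "t \<in> carrier (tensor_power (exterior sc))" using assms by (simp add: ext_power_sel)
  have "inj_on (Phi sc :: ('v, 'm, 'k) kskew set \<Rightarrow> _) (carrier (lp_quot sc))"
    by (rule inj_on_inverseI[of _ "Psi sc"]) (rule Psi_Phi)
  then have "inv_into (carrier (lp_quot sc)) (Phi sc) t = Psi sc t"
    using t by (intro inv_into_f_eq) (simp_all add: Psi_closed Phi_Psi)
  then show ?thesis using assms by (simp add: transport_def)
qed

lemma transport_extensional: "transport A B \<Phi> D \<in> extensional (carrier B)"
  by (simp add: transport_def)

text \<open>The transported operator is linear and has the prescribed values on tensors of
  extensors, because \<open>Psi\<close> takes both these values and the action on the sorted word to
  the same element.\<close>

lemma geom_product_transport:
  fixes sc :: "'k::field \<Rightarrow> 'v::ab_group_add \<Rightarrow> 'v" and i j :: "'m::{finite,linorder}"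
  assumes "i \<noteq> j"
  shows "geom_product sc j i h = transport (lp_quot sc) (ext_power sc) (Phi sc)
    (induced KSkew (lp_ideal sc) (kdivided_polarization j i h))"
proof -
  let ?D = "induced KSkew (lp_ideal sc) (kdivided_polarization j i h :: ('v, 'm, 'k) kskew \<Rightarrow> _)"
  let ?G = "transport (lp_quot sc) (ext_power sc) (Phi sc) ?D"
  interpret letterplace_operator sc i j "int h" "kdivided_polarization j i h"
    by (rule kdivided_polarization_operator[OF assms])
  interpret T: kalg "tensor_power (exterior sc) :: ('k, ('m, 'v, 'k) ext_power) module"
    by (rule kalg_tensor_power[OF kalg_exterior])
  note comp = klinear_compose[OF klinear_compose[OF Psi_linear klinear_induced] Phi_linear]
  have lin: "klinear (ext_power sc) (ext_power sc) ?G"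
    unfolding klinear_ext_power
    by (rule klinear_cong[OF comp _ T.kmod_axioms]) (simp add: transport_Phi ext_power_sel)
  have val: "?G (ext_tensor sc (\<lambda>k. extensor sc (w k))) = geom_value sc j i h w" for w
  proof -
    have "?G (ext_tensor sc (\<lambda>k. extensor sc (w k))) = Phi sc (Psi sc (geom_value sc j i h w))"
      unfolding Psi_geom_value(2)[OF assms]
      by (simp add: transport_Phi ext_power_sel Psi_extensor_tensor induced_word)
    then show ?thesis
      using Psi_geom_value(1)[OF assms, of sc h w] by (simp add: Phi_Psi ext_power_sel)
  qed
  show ?thesis
    unfolding geom_product_def
  proof (rule the_equality, intro conjI allI)
    fix G :: "('m, 'v, 'k) ext_power \<Rightarrow> ('m, 'v, 'k) ext_power"
    assume G: "G \<in> extensional (carrier (ext_power sc)) \<and> klinear (ext_power sc) (ext_power sc) G \<and>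
      (\<forall>w. G (ext_tensor sc (\<lambda>k. extensor sc (w k))) = geom_value sc j i h w)"
    show "G = ?G"
    proof (rule extensionalityI[OF conjunct1[OF G] transport_extensional])
      fix t :: "('m, 'v, 'k) ext_power" assume t: "t \<in> carrier (ext_power sc)"
      show "G t = ?G t"
        by (rule klinear_eq_on_kspan[OF T.kmod_axioms T.kmod_axioms _ lin[unfolded
          klinear_ext_power]
              _ _ extensor_tensor_span[OF t[unfolded ext_power_sel]]])
          (use G val in \<open>auto simp: klinear_ext_power\<close>)
    qed
  qed (use lin val in \<open>auto simp: transport_extensional\<close>)
qed

section \<open>The representation of the general linear Lie algebra\<close>

context word_alg
begin

text \<open>Unlike \<open>derivation\<close>, this puts no condition outside the carrier, so sums,
  multiples and commutators can be taken pointwise without restricting them.\<close>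

definition der :: "('a \<Rightarrow> 'a) \<Rightarrow> bool" where
  "der f \<longleftrightarrow> klinear A A f \<and>
    (\<forall>x\<in>carrier A. \<forall>y\<in>carrier A. f (x \<otimes> y) = f x \<otimes> y \<oplus> x \<otimes> f y)"

lemma der_linear: "der f \<Longrightarrow> klinear A A f"
  and der_Leibniz: "der f \<Longrightarrow> x \<in> carrier A \<Longrightarrow> y \<in> carrier A \<Longrightarrow> f (x \<otimes> y) = f x \<otimes> y \<oplus> x \<otimes> f y"
  by (simp_all add: der_def)

lemma der_plus: "der f \<Longrightarrow> der f' \<Longrightarrow> der (\<lambda>x. f x \<oplus> f' x)"
  using klinear_closed[of A A f] klinear_closed[of A A f'] unfolding der_def
  by (auto simp: klinear_plus l_distr r_distr a_ac)

lemma der_zero: "der (\<lambda>x. \<zero>)"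
  unfolding der_def by (auto simp: klinear_const_zero)

lemma der_scale: "der f \<Longrightarrow> der (\<lambda>x. c \<odot> f x)"
  using klinear_closed[of A A f] unfolding der_def
  by (auto simp: klinear_scale smult_r_distr smult_mult_l smult_mult_r)

lemma der_cong: "der f \<Longrightarrow> (\<And>x. x \<in> carrier A \<Longrightarrow> f x = f' x) \<Longrightarrow> der f'"
  using klinear_cong[of A A f f'] kmod_axioms unfolding der_def by auto

lemma der_finsum:
  assumes "\<And>s. s \<in> S \<Longrightarrow> der (f s)"
  shows "der (\<lambda>x. finsum A (\<lambda>s. f s x) S)"
  using assms
proof (induction S rule: infinite_finite_induct)
  case (insert s F)
  have "der (\<lambda>x. f s x \<oplus> finsum A (\<lambda>s. f s x) F)"
    using insert by (intro der_plus) auto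
  then show ?case
  proof (rule der_cong)
    fix x assume x: "x \<in> carrier A"
    have "f s' x \<in> carrier A" if "s' \<in> insert s F" for s'
      using klinear_closed[OF der_linear[OF insert.prems[OF that]] x] .
    then show "f s x \<oplus> finsum A (\<lambda>s. f s x) F = finsum A (\<lambda>s. f s x) (insert s F)"
      using insert.hyps by (subst finsum_insert) auto
  qed
qed (auto simp: finsum_infinite der_zero)

text \<open>The mixed terms \<open>?a\<close> and \<open>?b\<close> occur in both composites and
  cancel.\<close>

lemma der_commutator:
  assumes f: "der f" and f': "der f'"
  shows "der (\<lambda>x. f (f' x) \<ominus> f' (f x))"
  unfolding der_def
proof (intro conjI ballI)
  note c = klinear_closed[OF der_linear[OF f]] klinear_closed[OF der_linear[OF f']]
  have l: "klinear A A (\<lambda>x. f (f' x))" "klinear A A (\<lambda>x. f' (f x))"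
    by (rule klinear_compose[OF der_linear[OF f'] der_linear[OF f]],
        rule klinear_compose[OF der_linear[OF f] der_linear[OF f']])
  show "klinear A A (\<lambda>x. f (f' x) \<ominus> f' (f x))"
    by (rule klinear_cong[OF klinear_plus[OF l(1) klinear_scale[OF l(2), of "- 1"]] _ kmod_axioms])
      (simp add: c smult_minus_one a_minus_def)
  fix x y assume xy: "x \<in> carrier A" "y \<in> carrier A"
  note ff = klinear_add[OF der_linear[OF f]] klinear_add[OF der_linear[OF f']]
    der_Leibniz[OF f] der_Leibniz[OF f']
  let ?a = "f x \<otimes> f' y" and ?b = "f' x \<otimes> f y"
  have 1: "f (f' (x \<otimes> y)) = (f (f' x) \<otimes> y \<oplus> x \<otimes> f (f' y)) \<oplus> (?b \<oplus> ?a)"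
    using xy c by (simp add: ff a_ac)
  have 2: "f' (f (x \<otimes> y)) = (f' (f x) \<otimes> y \<oplus> x \<otimes> f' (f y)) \<oplus> (?b \<oplus> ?a)"
    using xy c by (simp add: ff a_ac)
  have cancel: "(p \<oplus> r) \<ominus> (q \<oplus> r) = p \<ominus> q" if "p \<in> carrier A" "q \<in> carrier A" "r \<in> carrier A"
    for p q r
  proof -
    have "(p \<oplus> r) \<ominus> (q \<oplus> r) = p \<oplus> \<ominus> q \<oplus> (r \<oplus> \<ominus> r)"
      using that by (simp add: a_minus_def minus_add a_ac)
    then show ?thesis using that by (simp add: r_neg a_minus_def)
  qed
  show "f (f' (x \<otimes> y)) \<ominus> f' (f (x \<otimes> y)) = (f (f' x) \<ominus> f' (f x)) \<otimes> y \<oplus> x \<otimes> (f (f' y) \<ominus> f' (f y))"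
  proof -
    have regroup: "(p \<otimes> y \<oplus> x \<otimes> q) \<ominus> (p' \<otimes> y \<oplus> x \<otimes> q') = (p \<ominus> p') \<otimes> y \<oplus> x \<otimes> (q \<ominus> q')"
      if "p \<in> carrier A" "q \<in> carrier A" "p' \<in> carrier A" "q' \<in> carrier A" for p q p' q'
      using that xy by (simp add: a_minus_def l_distr r_distr l_minus r_minus minus_add a_ac)
    have "f (f' (x \<otimes> y)) \<ominus> f' (f (x \<otimes> y)) =
      (f (f' x) \<otimes> y \<oplus> x \<otimes> f (f' y)) \<ominus> (f' (f x) \<otimes> y \<oplus> x \<otimes> f' (f y))"
      unfolding 1 2 by (rule cancel) (use xy c in simp_all)
    also have "\<dots> = (f (f' x) \<ominus> f' (f x)) \<otimes> y \<oplus> x \<otimes> (f (f' y) \<ominus> f' (f y))"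
      by (rule regroup; intro c xy)
    finally show ?thesis .
  qed
qed

lemma der_eq:
  assumes span: "\<And>x. x \<in> carrier A \<Longrightarrow> x \<in> kspan A (range wd)"
    and f: "der f" and f': "der f'" and letters: "\<And>x. f (g x) = f' (g x)" and "x \<in> carrier A"
  shows "f x = f' x"
proof (rule klinear_eq_on_words[OF span der_linear[OF f] der_linear[OF f'] kmod_axioms _ assms(5)])
  fix w
  show "f (wd w) = f' (wd w)"
  proof (induction w)
    case Nil
    have "e \<one> = \<zero>" if "der e" for e
      by (rule Leibniz_one) (rule klinear_closed[OF der_linear[OF that] one_closed],
          rule der_Leibniz[OF that one_closed one_closed])
    from this[OF f] this[OF f'] show ?case by simp
  next
    case (Cons x w)
    then show ?case by (simp add: der_Leibniz[OF f] der_Leibniz[OF f'] letters)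
  qed
qed

end

section \<open>Matrices acting through polarizations\<close>

context
  fixes sc :: "'k::field \<Rightarrow> 'v::ab_group_add \<Rightarrow> 'v"
begin

abbreviation polar :: "'m \<Rightarrow> 'm \<Rightarrow> ('v, 'm, 'k) kskew set \<Rightarrow> ('v, 'm, 'k) kskew set" where
  "polar i j \<equiv> induced KSkew (lp_ideal sc) (kpolarization i j)"

lemma polar_operator:
  "letterplace_operator j i 1 (kpolarization i j :: ('v, 'm, 'k) kskew \<Rightarrow> ('v, 'm, 'k) kskew)"
  by (rule kpolarization_operator)

lemma der_polar: "lp_quot.der sc (polar i j)"
proof -
  interpret letterplace_operator sc j i 1 "kpolarization i j :: ('v, _, 'k) kskew \<Rightarrow> _"
    by (rule polar_operator)
  show ?thesis
    unfolding lp_quot.der_def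
    using klinear_induced lp_quot.Leibniz_of_words[OF lp_quot_span klinear_induced induced_word]
    by blast
qed

lemma polar_letter: "polar i j (quot_letter sc (v, k)) =
  (if k = j then quot_letter sc (v, i) else \<zero>\<^bsub>lp_quot sc\<^esub>)"
proof -
  interpret letterplace_operator sc j i 1 "kpolarization i j :: ('v, _, 'k) kskew \<Rightarrow> _"
    by (rule polar_operator)
  show ?thesis using induced_word[of "[(v, k)]"]
    by (simp add: place_subst_def lp_quot.divided_word_0)
qed

text \<open>For fixed v, coefficient vectors c are turned into combinations of the letters (v|a).
  Matrices act on these coefficients, so commutators can be checked by matrix algebra.\<close>

definition letter_sum :: "'v \<Rightarrow> ('m::finite \<Rightarrow> 'k) \<Rightarrow> ('v, 'm, 'k) kskew set" where
  "letter_sum v c = finsum (lp_quot sc) (\<lambda>a. c a \<odot>\<^bsub>lp_quot sc\<^esub> quot_letter sc (v, a)) UNIV"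

lemma letter_sum_closed [simp]: "letter_sum v c \<in> carrier (lp_quot sc)"
  unfolding letter_sum_def by (rule lp_quot.finsum_closed) auto

lemma letter_sum_add: "letter_sum v (\<lambda>a. c a + d a) = letter_sum v c \<oplus>\<^bsub>lp_quot sc\<^esub> letter_sum v d"
  unfolding letter_sum_def by (simp add: lp_quot.smult_l_distr lp_quot.finsum_addf Pi_def)

lemma letter_sum_scale: "letter_sum v (\<lambda>a. d * c a) = d \<odot>\<^bsub>lp_quot sc\<^esub> letter_sum v c"
  unfolding letter_sum_def by (simp add: lp_quot.smult_finsum lp_quot.smult_smult)

lemma letter_sum_zero: "letter_sum v (\<lambda>a. 0) = \<zero>\<^bsub>lp_quot sc\<^esub>"
  unfolding letter_sum_def by (simp add: lp_quot.finsum_zero)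

lemma letter_sum_sum:
  "letter_sum v (\<lambda>a. \<Sum>b\<in>S. c b a) = finsum (lp_quot sc) (\<lambda>b. letter_sum v (c b)) S"
  by (induction S rule: infinite_finite_induct)
    (simp_all add: letter_sum_zero lp_quot.finsum_infinite letter_sum_add)

lemma letter_sum_single: "letter_sum v (\<lambda>a. if a = i then c else 0) =
  c \<odot>\<^bsub>lp_quot sc\<^esub> quot_letter sc (v, i)"
proof -
  have "letter_sum v (\<lambda>a. if a = i then c else 0) =
    finsum (lp_quot sc) (\<lambda>a. if i = a then c \<odot>\<^bsub>lp_quot sc\<^esub> quot_letter sc (v, a) else \<zero>\<^bsub>lp_quot
      sc\<^esub>) UNIV"
    unfolding letter_sum_def by (rule lp_quot.finsum_cong') auto
  also have "\<dots> = c \<odot>\<^bsub>lp_quot sc\<^esub> quot_letter sc (v, i)"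
    using lp_quot.finsum_singleton[where i = i and A = UNIV
      and f = "\<lambda>a. c \<odot>\<^bsub>lp_quot sc\<^esub> quot_letter sc (v, a)"] by auto
  finally show ?thesis .
qed

text \<open>The linear extension of the assignment of D_{ab} to the elementary matrix at (a,
  b).\<close>

definition gl_op :: "'k ^ 'm::finite ^ 'm \<Rightarrow> ('v, 'm, 'k) kskew set \<Rightarrow> ('v, 'm, 'k) kskew set" where
  "gl_op X p = finsum (lp_quot sc) (\<lambda>a. finsum (lp_quot sc) (\<lambda>b. X $ a $ b \<odot>\<^bsub>lp_quot sc\<^esub> polar a b
    p) UNIV) UNIV"

lemma der_gl_op: "lp_quot.der sc (gl_op X)"
  unfolding gl_op_def[abs_def] by (intro lp_quot.der_finsum lp_quot.der_scale der_polar)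

lemma gl_op_closed: "p \<in> carrier (lp_quot sc) \<Longrightarrow> gl_op X p \<in> carrier (lp_quot sc)"
  by (rule klinear_closed[OF lp_quot.der_linear[OF der_gl_op]])

lemma gl_op_letter: "gl_op X (quot_letter sc (v, k)) = letter_sum v (\<lambda>a. X $ a $ k)"
proof -
  have "finsum (lp_quot sc) (\<lambda>b. X $ a $ b \<odot>\<^bsub>lp_quot sc\<^esub> polar a b (quot_letter sc (v, k))) UNIV =
    X $ a $ k \<odot>\<^bsub>lp_quot sc\<^esub> quot_letter sc (v, a)" for a
  proof -
    have "finsum (lp_quot sc) (\<lambda>b. X $ a $ b \<odot>\<^bsub>lp_quot sc\<^esub> polar a b (quot_letter sc (v, k))) UNIV =
      finsum (lp_quot sc) (\<lambda>b. if k = b then X $ a $ b \<odot>\<^bsub>lp_quot sc\<^esub> quot_letter sc (v, a) else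
        \<zero>\<^bsub>lp_quot sc\<^esub>) UNIV"
      by (rule lp_quot.finsum_cong') (auto simp: polar_letter)
    then show ?thesis
      using lp_quot.finsum_singleton[where i = k and A = UNIV
        and f = "\<lambda>b. X $ a $ b \<odot>\<^bsub>lp_quot sc\<^esub> quot_letter sc (v, a)"] by auto
  qed
  then show ?thesis by (simp add: gl_op_def letter_sum_def)
qed

text \<open>Each letter (v|b) goes to the b-th column of X, so the coefficient vector is multiplied
  by X.\<close>

lemma gl_op_letter_sum:
  "gl_op X (letter_sum v c) = letter_sum v (\<lambda>a. \<Sum>b\<in>UNIV. X $ a $ b * c b)"
proof -
  note l = lp_quot.der_linear[OF der_gl_op[of X]]
  have "gl_op X (letter_sum v c) = finsum (lp_quot sc) (\<lambda>b. gl_op X (c b \<odot>\<^bsub>lp_quot sc\<^esub> quot_letter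
    sc (v, b))) UNIV"
    unfolding letter_sum_def
    by (rule klinear_finsum[OF lp_quot.kmod_axioms lp_quot.kmod_axioms l]) auto
  also have "\<dots> = finsum (lp_quot sc) (\<lambda>b. letter_sum v (\<lambda>a. c b * X $ a $ b)) UNIV"
    by (simp add: klinear_smult[OF l] gl_op_letter letter_sum_scale)
  also have "\<dots> = letter_sum v (\<lambda>a. \<Sum>b\<in>UNIV. X $ a $ b * c b)"
    by (simp add: letter_sum_sum[symmetric] mult.commute)
  finally show ?thesis .
qed

text \<open>The test used for all identities between these operators: a derivation is recognised
  from the k-th column of X appearing at each letter of place k.\<close>

lemma gl_op_eq:
  assumes "lp_quot.der sc f" "\<And>v k. f (quot_letter sc (v, k)) = letter_sum v (\<lambda>a. X $ a $ k)"
    "p \<in> carrier (lp_quot sc)"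
  shows "gl_op X p = f p"
proof (rule lp_quot.der_eq[OF lp_quot_span der_gl_op assms(1) _ assms(3)])
  show "gl_op X (quot_letter sc x) = f (quot_letter sc x)" for x
    by (cases x) (simp add: gl_op_letter assms(2))
qed

lemma gl_op_elementary:
  fixes i j :: "'m::finite"
  shows "p \<in> carrier (lp_quot sc) \<Longrightarrow> gl_op (elementary_matrix i j) p = polar i j p"
proof (rule gl_op_eq[OF der_polar])
  fix v and k :: 'm
  show "polar i j (quot_letter sc (v, k)) = letter_sum v (\<lambda>a. elementary_matrix i j $ a $ k)"
    using letter_sum_single[of v i 1]
    by (simp add: polar_letter elementary_matrix_def letter_sum_zero)
qed

lemma gl_op_add:
  "p \<in> carrier (lp_quot sc) \<Longrightarrow> gl_op (X + Y) p = gl_op X p \<oplus>\<^bsub>lp_quot sc\<^esub> gl_op Y p"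
  by (rule gl_op_eq[OF lp_quot.der_plus[OF der_gl_op der_gl_op]]) (simp_all add: gl_op_letter
    letter_sum_add)

lemma gl_op_scale:
  "p \<in> carrier (lp_quot sc) \<Longrightarrow> gl_op (\<chi> a b. c * X $ a $ b) p = c \<odot>\<^bsub>lp_quot sc\<^esub> gl_op X p"
  by (rule gl_op_eq[OF lp_quot.der_scale[OF der_gl_op]]) (simp_all add: gl_op_letter
    letter_sum_scale)

text \<open>Both sides are derivations. On a letter of place k, composing two operators multiplies
  coefficient vectors by the two matrices, so the commutator gives the k-th column of XY -
  YX.\<close>

lemma gl_op_commutator:
  fixes X Y :: "'k ^ 'm::finite ^ 'm"
  shows "p \<in> carrier (lp_quot sc) \<Longrightarrow>
    gl_op (X ** Y - Y ** X) p = gl_op X (gl_op Y p) \<ominus>\<^bsub>lp_quot sc\<^esub> gl_op Y (gl_op X p)"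
proof (rule gl_op_eq[OF lp_quot.der_commutator[OF der_gl_op der_gl_op]])
  fix v and k :: 'm
  let ?P = "lp_quot sc"
  have "letter_sum v (\<lambda>a. (X ** Y - Y ** X) $ a $ k) =
    letter_sum v (\<lambda>a. (X ** Y) $ a $ k + (- 1) * (Y ** X) $ a $ k)" by simp
  also have "\<dots> = letter_sum v (\<lambda>a. (X ** Y) $ a $ k) \<ominus>\<^bsub>?P\<^esub> letter_sum v (\<lambda>a. (Y ** X) $ a $ k)"
    unfolding letter_sum_add letter_sum_scale by (simp add: lp_quot.smult_minus_one a_minus_def)
  finally show "gl_op X (gl_op Y (quot_letter sc (v, k))) \<ominus>\<^bsub>?P\<^esub> gl_op Y (gl_op X (quot_letter sc
    (v, k))) =
    letter_sum v (\<lambda>a. (X ** Y - Y ** X) $ a $ k)"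
    by (simp add: gl_op_letter gl_op_letter_sum matrix_matrix_mult_def)
qed

section \<open>The representation on the tensor power\<close>

definition gl_rep :: "(('k, 'm::{finite,linorder}) vec, 'm) vec \<Rightarrow> ('m, 'v, 'k) ext_power \<Rightarrow>
  ('m, 'v, 'k) ext_power" where
  "gl_rep X = transport (lp_quot sc) (ext_power sc) (Phi sc) (gl_op X)"

lemma gl_rep_eq: "t \<in> carrier (ext_power sc) \<Longrightarrow> gl_rep X t = Phi sc (gl_op X (Psi sc t))"
  by (simp add: gl_rep_def transport_Phi)

lemma gl_rep_derivation: "gl_rep X \<in> alg_derivations (ext_power sc)"
proof -
  interpret T: kalg "tensor_power (exterior sc) :: ('k, ('b, 'v, 'k) ext_power) module"
    by (rule kalg_tensor_power[OF kalg_exterior])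
  note l = lp_quot.der_linear[OF der_gl_op[of X]]
  have lin: "klinear (ext_power sc) (ext_power sc) (gl_rep X)"
    unfolding klinear_ext_power
    by (rule klinear_cong[OF klinear_compose[OF klinear_compose[OF Psi_linear l] Phi_linear] _
      T.kmod_axioms])
      (simp add: gl_rep_eq ext_power_sel)
  have "gl_rep X (x \<otimes>\<^bsub>ext_power sc\<^esub> y) =
    (gl_rep X x \<otimes>\<^bsub>ext_power sc\<^esub> y) \<oplus>\<^bsub>ext_power sc\<^esub> (x \<otimes>\<^bsub>ext_power sc\<^esub> gl_rep X y)"
    if xy: "x \<in> carrier (ext_power sc)" "y \<in> carrier (ext_power sc)" for x y
  proof -
    have c: "Psi sc x \<in> carrier (lp_quot sc)" "Psi sc y \<in> carrier (lp_quot sc)"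
      "x \<in> carrier (tensor_power (exterior sc))" "y \<in> carrier (tensor_power (exterior sc))"
      using xy by (auto simp: ext_power_sel Psi_closed)
    then show ?thesis
      using xy by (simp add: ext_power_sel graded_mult_eq gl_rep_eq Phi_closed gl_op_closed Psi_Phi
          lp_quot.der_Leibniz[OF der_gl_op] klinear_add[OF Phi_linear])
  qed
  then show ?thesis
    using lin unfolding alg_derivations_def derivation_def additive_endo_def
    by (simp add: klinear_def gl_rep_def transport_extensional)
qed

lemma gl_rep: "gl_derivation_rep (ext_power sc) (gl_rep :: (('k, 'm::{finite,linorder}) vec, 'm)
  vec \<Rightarrow> _)"
proof -
  interpret T: kalg "tensor_power (exterior sc) :: ('k, ('m, 'v, 'k) ext_power) module"
    by (rule kalg_tensor_power[OF kalg_exterior])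
  \<comment> \<open>Subtraction is built from the carrier, zero and addition, which the two records
    share; they differ only in the product.\<close>
  have minus: "x \<ominus>\<^bsub>ext_power sc\<^esub> y = x \<ominus>\<^bsub>tensor_power (exterior sc)\<^esub> y"
    for x y :: "('m, 'v, 'k) ext_power"
    by (simp add: a_minus_def a_inv_def m_inv_def ext_power_sel)
  show ?thesis
    unfolding gl_derivation_rep_def
  proof (intro conjI allI ballI)
    fix X Y :: "(('k, 'm) vec, 'm) vec" and c and t :: "('m, 'v, 'k) ext_power"
    assume t: "t \<in> carrier (ext_power sc)"
    then have p: "Psi sc t \<in> carrier (lp_quot sc)" by (simp add: ext_power_sel Psi_closed)
    note cl = gl_op_closed[OF p]
    show "gl_rep (X + Y) t = gl_rep X t \<oplus>\<^bsub>ext_power sc\<^esub> gl_rep Y t"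
      using t cl by (simp add: gl_rep_eq gl_op_add[OF p] klinear_add[OF Phi_linear]
        ext_power_sel(4))
    show "gl_rep (\<chi> a b. c * X $ a $ b) t = c \<odot>\<^bsub>ext_power sc\<^esub> gl_rep X t"
      using t cl by (simp add: gl_rep_eq gl_op_scale[OF p] klinear_smult[OF Phi_linear]
        ext_power_sel(5))
    show "gl_rep (X ** Y - Y ** X) t = gl_rep X (gl_rep Y t) \<ominus>\<^bsub>ext_power sc\<^esub> gl_rep Y (gl_rep X t)"
      using t cl by (simp add: minus gl_rep_eq gl_op_commutator[OF p] Phi_closed Psi_Phi
        gl_op_closed
          ext_power_sel(1) klinear_minus[OF lp_quot.kmod_axioms T.kmod_axioms Phi_linear])
  qed (rule gl_rep_derivation)
qed

lemma transport_cong: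
  assumes "\<And>p. p \<in> carrier (lp_quot sc) \<Longrightarrow> D p = D' p"
  shows "transport (lp_quot sc) (ext_power sc) (Phi sc :: ('v, 'm::{finite,linorder}, 'k) kskew
    set \<Rightarrow> _) D =
    transport (lp_quot sc) (ext_power sc) (Phi sc) D'"
proof (rule extensionalityI[OF transport_extensional transport_extensional])
  fix t :: "('m, 'v, 'k) ext_power" assume "t \<in> carrier (ext_power sc)"
  then show "transport (lp_quot sc) (ext_power sc) (Phi sc) D t =
    transport (lp_quot sc) (ext_power sc) (Phi sc) D' t"
    by (simp add: transport_Phi assms Psi_closed ext_power_sel)
qed

text \<open>On the diagonal, the simple product is by definition the transported polarization. Off
  the diagonal it is a geometric product, hence a transported first divided power, and that agrees
  with the polarization on words.\<close>

lemma gl_rep_elementary: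
  fixes i j :: "'m::{finite,linorder}"
  shows "gl_rep (elementary_matrix i j) = simple_geom_product sc (Phi sc) i j"
proof (cases "i = j")
  case True
  show ?thesis
    unfolding simple_geom_product_def gl_rep_def True
    by (simp, rule transport_cong, rule gl_op_elementary)
next
  case False
  interpret D: letterplace_operator sc j i 1 "kpolarization i j :: ('v, 'm, 'k) kskew \<Rightarrow> _"
    by (rule polar_operator)
  have "letterplace_operator j i (int 1) (kdivided_polarization i j 1 :: ('v, 'm, 'k) kskew \<Rightarrow> _)"
    using False by (intro kdivided_polarization_operator) auto
  then interpret E: letterplace_operator sc j i 1 "kdivided_polarization i j 1 :: ('v, 'm, 'k)
    kskew \<Rightarrow> _"
    unfolding of_nat_1 .
  have "induced KSkew (lp_ideal sc) (kdivided_polarization i j 1) p = polar i j p"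
    if "p \<in> carrier (lp_quot sc)" for p
  proof (rule lp_quot.klinear_eq_on_words[OF lp_quot_span E.klinear_induced D.klinear_induced
    lp_quot.kmod_axioms _ that])
    show "induced KSkew (lp_ideal sc) (kdivided_polarization i j 1) (quot_word sc w) =
      polar i j (quot_word sc w)" for w
      unfolding D.induced_word E.induced_word ..
  qed
  then show ?thesis
    using False unfolding simple_geom_product_def gl_rep_def
    by (simp add: geom_product_transport[OF False[symmetric]])
      (rule transport_cong, simp add: gl_op_elementary)
qed

text \<open>Homomorphisms that agree on letters agree on words, and words span. This is the sense in
  which the assignment on letters induces the isomorphism.\<close>

lemma alg_hom_eq_Phi:
  fixes \<Psi> :: "('v, 'm::{finite,linorder}, 'k) kskew set \<Rightarrow> ('m, 'v, 'k) ext_power"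
  assumes "\<Psi> \<in> alg_hom (lp_quot sc) (ext_power sc)" "\<And>x. \<Psi> (quot_letter sc x) =
    Phi sc (quot_letter sc x)"
    and "p \<in> carrier (lp_quot sc)"
  shows "\<Psi> p = Phi sc p"
proof -
  interpret T: kalg "tensor_power (exterior sc) :: ('k, ('m, 'v, 'k) ext_power) module"
    by (rule kalg_tensor_power[OF kalg_exterior])
  have hom: "\<Psi> \<in> ring_hom (lp_quot sc) (ext_power sc)"
    "klinear (lp_quot sc) (tensor_power (exterior sc)) \<Psi>"
    using assms(1) by (auto simp: alg_hom_def klinear_ext_power)
  have Phi_hom: "(Phi sc :: _ \<Rightarrow> ('m, 'v, 'k) ext_power) \<in> ring_hom (lp_quot sc) (ext_power sc)"
    using Phi_iso[of sc] by (auto simp: alg_iso_def ring_iso_def)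
  show ?thesis
  proof (rule lp_quot.klinear_eq_on_words[OF lp_quot_span hom(2) Phi_linear T.kmod_axioms _
    assms(3)])
    fix w :: "('v \<times> 'm) list"
    show "\<Psi> (quot_word sc w) = Phi sc (quot_word sc w)"
      using ring_hom_wprod[OF hom(1) lp_quot.monoid_axioms, of w "quot_letter sc"]
        ring_hom_wprod[OF Phi_hom lp_quot.monoid_axioms, of w "quot_letter sc"]
          by (simp add: assms(2))
  qed
qed

end

text \<open>One \<open>\<Phi>\<close> is fixed for all three claims, since the diagonal simple
  products depend on it; the clause about \<open>\<Psi>\<close> determines it on the
  carrier.\<close>

theorem mainTheorem6:
  fixes sc :: "'k::field \<Rightarrow> 'v::ab_group_add \<Rightarrow> 'v"
    and basis :: "'v set"
  assumes "finite_dimensional_vector_space sc basis"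
  shows
    "\<exists>\<Phi> :: ('v, 'm::{finite,linorder}, 'k) kskew set \<Rightarrow> ('m, 'v, 'k) ext_power.
      \<Phi> \<in> alg_iso (lp_quot sc) (ext_power sc) \<and>
      (\<forall>v i. \<Phi> (lp_ideal sc +>\<^bsub>KSkew\<^esub> klp v i) =
         ext_tensor sc (\<lambda>k. if k = i then ext_vec sc v else \<one>\<^bsub>exterior sc\<^esub>)) \<and>
      (\<forall>\<Psi> \<in> alg_hom (lp_quot sc) (ext_power sc).
         (\<forall>v i. \<Psi> (lp_ideal sc +>\<^bsub>KSkew\<^esub> klp v i) =
            ext_tensor sc (\<lambda>k. if k = i then ext_vec sc v else \<one>\<^bsub>exterior sc\<^esub>)) \<longrightarrow>
         (\<forall>x\<in>carrier (lp_quot sc). \<Psi> x = \<Phi> x)) \<and>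
      (\<forall>i j. kpolarization j i ` lp_ideal sc \<subseteq> (lp_ideal sc :: ('v, 'm, 'k) kskew set)) \<and>
      (\<forall>i j h. i \<noteq> j \<and> h > 0 \<longrightarrow>
         kdivided_polarization j i h ` lp_ideal sc \<subseteq> (lp_ideal sc :: ('v, 'm, 'k) kskew set) \<and>
         geom_product sc j i h =
           transport (lp_quot sc) (ext_power sc) \<Phi>
             (induced KSkew (lp_ideal sc) (kdivided_polarization j i h))) \<and>
      (\<exists>\<rho>. gl_derivation_rep (ext_power sc) \<rho> \<and>
         (\<forall>i j. \<rho> (elementary_matrix i j) = simple_geom_product sc \<Phi> i j))"
proof (intro exI[of _ "Phi sc"] conjI allI impI ballI)
  show "(Phi sc :: ('v, 'm, 'k) kskew set \<Rightarrow> _) \<in> alg_iso (lp_quot sc) (ext_power sc)"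
    by (rule Phi_iso)
  show "Phi sc (lp_ideal sc +>\<^bsub>KSkew\<^esub> klp v i) =
    ext_tensor sc (\<lambda>k :: 'm. if k = i then ext_vec sc v else \<one>\<^bsub>exterior sc\<^esub>)" for v i
    by (simp add: quot_letter_eq Phi_letter)
  show "\<Psi> x = Phi sc x"
    if "\<Psi> \<in> alg_hom (lp_quot sc) (ext_power sc)" "x \<in> carrier (lp_quot sc)"
      "\<forall>v i. \<Psi> (lp_ideal sc +>\<^bsub>KSkew\<^esub> klp v i) =
        ext_tensor sc (\<lambda>k. if k = i then ext_vec sc v else \<one>\<^bsub>exterior sc\<^esub>)"
    for \<Psi> :: "('v, 'm, 'k) kskew set \<Rightarrow> ('m, 'v, 'k) ext_power" and x
  proof (rule alg_hom_eq_Phi[OF that(1) _ that(2)])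
    show "\<Psi> (quot_letter sc x) = Phi sc (quot_letter sc x)" for x
      using that(3) by (cases x) (simp add: quot_letter_eq Phi_letter)
  qed
  show "kpolarization j i ` lp_ideal sc \<subseteq> (lp_ideal sc :: ('v, 'm, 'k) kskew set)" for i j
    by (rule letterplace_operator.lp_ideal_invariant[OF kpolarization_operator])
  show "kdivided_polarization j i h ` lp_ideal sc \<subseteq> (lp_ideal sc :: ('v, 'm, 'k) kskew set)"
    if "i \<noteq> j \<and> h > 0" for i j h
    using that by (intro letterplace_operator.lp_ideal_invariant[OF kdivided_polarization_operator]) auto
  show "geom_product sc j i h = transport (lp_quot sc) (ext_power sc) (Phi sc)
      (induced KSkew (lp_ideal sc) (kdivided_polarization j i h))"
    if "i \<noteq> j \<and> h > 0" for i j :: 'm and h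
    using that by (intro geom_product_transport) auto
  show "\<exists>\<rho>. gl_derivation_rep (ext_power sc) \<rho> \<and>
    (\<forall>i j :: 'm. \<rho> (elementary_matrix i j) = simple_geom_product sc (Phi sc) i j)"
    using gl_rep[of sc] gl_rep_elementary[of sc] by blast
qed

end
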